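(* Fix $\sigma>0$ and $\lambda=(\lambda_1,\dots,\lambda_{2m})\in\mathbb{R}^{2mn}$. Suppose that $\nabla f_i$ and $\mathrm{Prox}_{g_i}$ are strongly semismooth for every $i\in\{1,\dots,m\}$ and that the graph $\mathcal{G}$ is undirected and connected. Let $\{\eta_t\}$ be a sequence of positive numbers with $\eta_t\to0$ as $t\to\infty$, and let $\hat x$ be the (unique) solution of $\min_{x\in\mathbb{R}^{mn}}\phi(x)$, where $$\phi(x):=\min_{y\in\mathbb{R}^{2mn}}\Big\{F(x)+G(y)+\frac\sigma2\Big\|Bx-y-\frac1\sigma\lambda\Big\|^2-\frac1{2\sigma}\|\lambda\|^2\Big\}.$$ Then there exists a neighborhood $\mathbb{B}(\hat x,\delta)$ of $\hat x$ such that for any initial point $x^0\in\mathbb{B}(\hat x,\delta)$, the sequence $\{x^t\}$ generated by the distributed inexact semismooth Newton (DiSSN) method described in the context converges superlinearly to $\hat x$. In addition, if for some $\tilde\eta$ one has $\eta_t\le\tilde\eta\|\nabla\phi(x^t)\|$ for all $t$, then $\{x^t\}$ converges quadratically to $\hat x$.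
   Context: Setting. For $i=1,\dots,m$: $f_i:\mathbb{R}^n\to\mathbb{R}$ is differentiable, $\mu_i$-strongly convex ($\mu_i>0$) and $L_i$-smooth (its gradient is $L_i$-Lipschitz); $g_i:\mathbb{R}^n\to(-\infty,+\infty]$ is closed proper convex. A differentiable $f$ is $\mu$-strongly convex if $f(y)\ge f(x)+\langle\nabla f(x),y-x\rangle+\frac{\mu}{2}\|y-x\|^2$ for all $x,y$. Proximal mapping: $\mathrm{Prox}_p(x):=\operatorname{argmin}_y\{p(y)+\frac12\|y-x\|^2\}$. Conjugate: $p^*(v):=\sup_x\{\langle x,v\rangle-p(x)\}$. For a locally Lipschitz map $\Phi$, $\partial\Phi(x)$ is the Clarke subdifferential: the convex hull of all limits of Jacobians $\Phi'(x^k)$ with $x^k\to x$ and $\Phi$ differentiable at $x^k$. $\Phi$ is strongly semismooth at $x$ if it is directionally differentiable at $x$ and for every $V\in\partial\Phi(x+\Delta x)$ with $\Delta x\to0$, $\Phi(x+\Delta x)-\Phi(x)-V\Delta x=O(\|\Delta x\|^2)$; strongly semismooth means at every point. Network: $\mathcal{G}=(\mathcal{V},\mathcal{E})$ is a graph with $\mathcal{V}=\{1,\dots,m\}$; $\mathcal{N}_i$ denotes the set consisting of the agents $j$ with $(i,j)\in\mathcal{E}$ together with $i$ itself. $\mathcal{L}\in\mathbb{R}^{m\times m}$ is a gossip matrix of $\mathcal{G}$: $\mathcal{L}^T=\mathcal{L}$, $\mathcal{L}\succeq0$, $\operatorname{Null}(\mathcal{L})=\operatorname{Span}\{\mathbf{1}_m\}$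 ($\mathbf{1}_m$ is the all-ones vector), and $\mathcal{L}_{ij}\neq0$ only if $i=j$ or $(i,j)\in\mathcal{E}$. Put $W:=\mathcal{L}\otimes I_n\in\mathbb{R}^{mn\times mn}$ and $B:=\begin{pmatrix}I_{mn}\\ W\end{pmatrix}\in\mathbb{R}^{2mn\times mn}$. For $x=(x_1,\dots,x_m)\in\mathbb{R}^{mn}$, $F(x):=\sum_{i=1}^m f_i(x_i)$. For $y=(y_1,\dots,y_{2m})\in\mathbb{R}^{2mn}$, $G(y):=\sum_{i=1}^m g_i(y_i)$ if $y_{m+1}=\dots=y_{2m}=0$, and $G(y):=+\infty$ otherwise. Constants: $\mu=\min_i\mu_i$, $L=\max_iL_i+\sigma\|B\|^2$ ($\|B\|$ the Frobenius norm), $\beta=\frac{\sqrt L-\sqrt\mu}{\sqrt L+\sqrt\mu}$, and for $\eta>0$ $$N(\eta):=\left\lceil\frac{2\ln\big(\frac1\eta\sqrt{\frac{2L}{\mu}}\big)}{\ln\big(\frac{1}{1-\sqrt{\mu/L}}\big)}\right\rceil .$$ DiSSN method. Given $x^0\in\mathbb{R}^{mn}$, for $t=0,1,\dots$ every agent $i=1,\dots,m$ does the following. (1) Compute $u_i^t=\sigma x_i^t-\lambda_i$ and $u_{i+m}^t=\sigma\sum_{k\in\mathcal{N}_i}\mathcal{L}_{ik}x_k^t-\lambda_{i+m}$. (2) Choose $V_i^t\in\partial\nabla f_i(x_i^t)$, $H_i^t\in\partial\mathrm{Prox}_{\sigma g_i^*}(u_i^t)$ and set $T_i^t=\mathrm{Prox}_{\sigma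 g_i^*}(u_i^t)$. (3) Set $d_i^0=d_i^{-1}=0\in\mathbb{R}^n$, $N_t=N(\eta_t)$, and for $j=0,1,\dots,N_t$ compute $\tilde d_i^j=d_i^j+\beta(d_i^j-d_i^{j-1})$, $\hat d_i^j=\sum_{k\in\mathcal{N}_i}\mathcal{L}_{ik}\tilde d_k^j$ and $$d_i^{j+1}=\tilde d_i^j-\frac1L\Big[V_i^t\tilde d_i^j+\sigma H_i^t\tilde d_i^j+\sigma\sum_{k\in\mathcal{N}_i}\mathcal{L}_{ik}\hat d_k^j+\nabla f_i(x_i^t)+T_i^t+\sum_{k\in\mathcal{N}_i}\mathcal{L}_{ik}u_{k+m}^t\Big].$$ (4) Update $x_i^{t+1}=x_i^t+d_i^{N_t+1}$ (with the convention $d_i^{j}=0$ for $j\le0$). *)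

theory Defs
  imports "HOL-Analysis.Analysis" "HOL-Library.Landau_Symbols"
begin

section \<open>Convex and nonsmooth analysis\<close>

definition gradient :: "('a::real_inner \<Rightarrow> real) \<Rightarrow> 'a \<Rightarrow> 'a" where
  "gradient f x = (THE D. GDERIV f x :> D)"

definition strongly_convex :: "real \<Rightarrow> ('a::real_inner \<Rightarrow> real) \<Rightarrow> bool" where
  "strongly_convex \<mu> f \<longleftrightarrow>
     (\<forall>x y. f y \<ge> f x + gradient f x \<bullet> (y - x) + \<mu> / 2 * (norm (y - x))\<^sup>2)"

definition smooth :: "real \<Rightarrow> ('a::real_inner \<Rightarrow> real) \<Rightarrow> bool" where
  "smooth L f \<longleftrightarrow> L-lipschitz_on UNIV (gradient f)"

definition epigraph :: "('a \<Rightarrow> ereal) \<Rightarrow> ('a \<times> real) set" where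
  "epigraph g = {(x, r). g x \<le> ereal r}"

definition closed_proper_convex :: "('a::real_normed_vector \<Rightarrow> ereal) \<Rightarrow> bool" where
  "closed_proper_convex g \<longleftrightarrow>
     (\<forall>x. g x \<noteq> -\<infinity>) \<and> (\<exists>x. g x \<noteq> \<infinity>) \<and> convex (epigraph g) \<and> closed (epigraph g)"

definition Prox :: "('a::real_normed_vector \<Rightarrow> ereal) \<Rightarrow> 'a \<Rightarrow> 'a" where
  "Prox p x = arg_min (\<lambda>y. p y + ereal (1 / 2 * (norm (y - x))\<^sup>2)) (\<lambda>_. True)"

definition conjugate :: "('a::real_inner \<Rightarrow> ereal) \<Rightarrow> 'a \<Rightarrow> ereal" where
  "conjugate p v = (SUP x. ereal (x \<bullet> v) - p x)"

definition clarke :: "(real^'a \<Rightarrow> real^'b) \<Rightarrow> real^'a \<Rightarrow> (real^'a^'b) set" where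
  "clarke \<Phi> x = convex hull
     {V. \<exists>s. s \<longlonglongrightarrow> x \<and> (\<forall>k. \<Phi> differentiable (at (s k))) \<and>
             (\<lambda>k. jacobian \<Phi> (at (s k))) \<longlonglongrightarrow> V}"

definition locally_lipschitz :: "('a::metric_space \<Rightarrow> 'b::metric_space) \<Rightarrow> bool" where
  "locally_lipschitz \<Phi> \<longleftrightarrow> (\<forall>x. \<exists>e>0. \<exists>C. C-lipschitz_on (ball x e) \<Phi>)"

definition directionally_differentiable_at ::
  "('a::real_normed_vector \<Rightarrow> 'b::real_normed_vector) \<Rightarrow> 'a \<Rightarrow> bool" where
  "directionally_differentiable_at \<Phi> x \<longleftrightarrow>
     (\<forall>h. \<exists>l. ((\<lambda>s. (\<Phi> (x + s *\<^sub>R h) - \<Phi> x) /\<^sub>R s) \<longlongrightarrow> l) (at_right 0))"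

(* The bound in the O-term is uniform over V in clarke \<Phi> (x + h). *)
definition strongly_semismooth_at :: "(real^'a \<Rightarrow> real^'b) \<Rightarrow> real^'a \<Rightarrow> bool" where
  "strongly_semismooth_at \<Phi> x \<longleftrightarrow>
     directionally_differentiable_at \<Phi> x \<and>
     (\<exists>C. \<forall>\<^sub>F h in nhds 0. \<forall>V \<in> clarke \<Phi> (x + h).
        norm (\<Phi> (x + h) - \<Phi> x - V *v h) \<le> C * (norm h)\<^sup>2)"

definition strongly_semismooth :: "(real^'a \<Rightarrow> real^'b) \<Rightarrow> bool" where
  "strongly_semismooth \<Phi> \<longleftrightarrow>
     locally_lipschitz \<Phi> \<and> (\<forall>x. strongly_semismooth_at \<Phi> x)"

definition converges_superlinearly :: "(nat \<Rightarrow> 'a::real_normed_vector) \<Rightarrow> 'a \<Rightarrow> bool" where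
  "converges_superlinearly x a \<longleftrightarrow> x \<longlonglongrightarrow> a \<and>
     (\<lambda>t. norm (x (Suc t) - a)) \<in> o(\<lambda>t. norm (x t - a))"

definition converges_quadratically :: "(nat \<Rightarrow> 'a::real_normed_vector) \<Rightarrow> 'a \<Rightarrow> bool" where
  "converges_quadratically x a \<longleftrightarrow> x \<longlonglongrightarrow> a \<and>
     (\<lambda>t. norm (x (Suc t) - a)) \<in> O(\<lambda>t. (norm (x t - a))\<^sup>2)"


section \<open>Network\<close>

(* The agents are the elements of the finite type 'm; edges are ordered pairs. *)
definition undirected_connected :: "('m \<times> 'm) set \<Rightarrow> bool" where
  "undirected_connected E \<longleftrightarrow> sym E \<and> (\<forall>i j. (i, j) \<in> E\<^sup>*)"

definition neighbours :: "('m \<times> 'm) set \<Rightarrow> 'm \<Rightarrow> 'm set" where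
  "neighbours E i = insert i {j. (i, j) \<in> E}"

definition gossip_matrix :: "('m::finite \<times> 'm) set \<Rightarrow> real^'m^'m \<Rightarrow> bool" where
  "gossip_matrix E A \<longleftrightarrow>
     transpose A = A \<and> (\<forall>v. v \<bullet> (A *v v) \<ge> 0) \<and> {v. A *v v = 0} = span {\<chi> i. 1} \<and>
     (\<forall>i j. A $ i $ j \<noteq> 0 \<longrightarrow> i = j \<or> (i, j) \<in> E)"


section \<open>Block vectors and matrices\<close>

(* R^{mn} is real^('m * 'n) and R^{2mn} is real^(('m + 'm) * 'n); the block indices 1..m and
   m+1..2m of the latter are Inl i and Inr i. *)
definition block :: "real^('b::finite \<times> 'n::finite) \<Rightarrow> 'b \<Rightarrow> real^'n" where
  "block x i = (\<chi> k. x $ (i, k))"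

definition kronecker ::
  "real^'b^'a \<Rightarrow> real^'d^'c \<Rightarrow> real^('b::finite \<times> 'd::finite)^('a::finite \<times> 'c::finite)" where
  "kronecker P Q = (\<chi> r c. P $ fst r $ fst c * Q $ snd r $ snd c)"

definition W_mat :: "real^'m^'m \<Rightarrow> real^('m::finite \<times> 'n::finite)^('m \<times> 'n)" where
  "W_mat A = kronecker A (mat 1 :: real^'n^'n)"

definition B_mat :: "real^'m^'m \<Rightarrow> real^('m::finite \<times> 'n::finite)^(('m + 'm) \<times> 'n)" where
  "B_mat A = (\<chi> r. case fst r of
       Inl i \<Rightarrow> (mat 1 :: real^('m \<times> 'n)^('m \<times> 'n)) $ (i, snd r)
     | Inr i \<Rightarrow> W_mat A $ (i, snd r))"


section \<open>Objective functions\<close>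

definition F_obj :: "('m::finite \<Rightarrow> real^'n::finite \<Rightarrow> real) \<Rightarrow> real^('m \<times> 'n) \<Rightarrow> real" where
  "F_obj f x = (\<Sum>i\<in>UNIV. f i (block x i))"

definition G_obj :: "('m::finite \<Rightarrow> real^'n::finite \<Rightarrow> ereal) \<Rightarrow> real^(('m + 'm) \<times> 'n) \<Rightarrow> ereal" where
  "G_obj g y = (if \<forall>i. block y (Inr i) = 0 then \<Sum>i\<in>UNIV. g i (block y (Inl i)) else \<infinity>)"

(* Under the hypotheses of the theorem the infimum is finite and attained. *)
definition phi ::
  "('m::finite \<Rightarrow> real^'n::finite \<Rightarrow> real) \<Rightarrow> ('m \<Rightarrow> real^'n \<Rightarrow> ereal) \<Rightarrow> real^'m^'m \<Rightarrow>
   real \<Rightarrow> real^(('m + 'm) \<times> 'n) \<Rightarrow> real^('m \<times> 'n) \<Rightarrow> ereal" where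
  "phi f g A \<sigma> lam x = (INF y. ereal (F_obj f x) + G_obj g y +
     ereal (\<sigma> / 2 * (norm (B_mat A *v x - y - (1 / \<sigma>) *\<^sub>R lam))\<^sup>2 - 1 / (2 * \<sigma>) * (norm lam)\<^sup>2))"


section \<open>The DiSSN method\<close>

definition mu_const :: "('m::finite \<Rightarrow> real) \<Rightarrow> real" where
  "mu_const mus = Min (range mus)"

(* The norm of real^'a^'b is the Frobenius norm; the itself argument carries the type 'n. *)
definition L_const :: "'n::finite itself \<Rightarrow> ('m::finite \<Rightarrow> real) \<Rightarrow> real^'m^'m \<Rightarrow> real \<Rightarrow> real" where
  "L_const _ Ls A \<sigma> =
     Max (range Ls) + \<sigma> * (norm (B_mat A :: real^('m \<times> 'n)^(('m + 'm) \<times> 'n)))\<^sup>2"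

definition beta_const :: "real \<Rightarrow> real \<Rightarrow> real" where
  "beta_const \<mu> L = (sqrt L - sqrt \<mu>) / (sqrt L + sqrt \<mu>)"

definition N_iter :: "real \<Rightarrow> real \<Rightarrow> real \<Rightarrow> int" where
  "N_iter \<mu> L \<eta> = \<lceil>2 * ln (1 / \<eta> * sqrt (2 * L / \<mu>)) / ln (1 / (1 - sqrt (\<mu> / L)))\<rceil>"

definition dual_u :: "('m::finite \<times> 'm) set \<Rightarrow> real^'m^'m \<Rightarrow> real \<Rightarrow> real^(('m + 'm) \<times> 'n::finite) \<Rightarrow>
    real^('m \<times> 'n) \<Rightarrow> 'm + 'm \<Rightarrow> real^'n" where
  "dual_u E A \<sigma> lam x b = (case b of
       Inl i \<Rightarrow> \<sigma> *\<^sub>R block x i - block lam (Inl i)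
     | Inr i \<Rightarrow> \<sigma> *\<^sub>R (\<Sum>k\<in>neighbours E i. A $ i $ k *\<^sub>R block x k) - block lam (Inr i))"

(* d j i is the inner iterate d_i^j, with d_i^j = 0 for all integers j <= 0; N may be negative,
   in which case no inner step is made. c i is the part of the bracket that does not depend on j. *)
definition inner_iterates ::
  "('m::finite \<times> 'm) set \<Rightarrow> real^'m^'m \<Rightarrow> real \<Rightarrow> real \<Rightarrow> real \<Rightarrow> ('m \<Rightarrow> real^'n^'n) \<Rightarrow>
   ('m \<Rightarrow> real^'n^'n) \<Rightarrow> ('m \<Rightarrow> real^'n::finite) \<Rightarrow> int \<Rightarrow> (int \<Rightarrow> 'm \<Rightarrow> real^'n) \<Rightarrow> bool" where
  "inner_iterates E A \<sigma> \<mu> L V H c N d \<longleftrightarrow>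
     (\<forall>j\<le>0. \<forall>i. d j i = 0) \<and>
     (\<forall>j\<in>{0..N}.
        let dt = (\<lambda>i. d j i + beta_const \<mu> L *\<^sub>R (d j i - d (j - 1) i));
            dh = (\<lambda>i. \<Sum>k\<in>neighbours E i. A $ i $ k *\<^sub>R dt k)
        in \<forall>i. d (j + 1) i = dt i - (1 / L) *\<^sub>R
             (V i *v dt i + \<sigma> *\<^sub>R (H i *v dt i)
              + \<sigma> *\<^sub>R (\<Sum>k\<in>neighbours E i. A $ i $ k *\<^sub>R dh k) + c i))"

definition dissn_step ::
  "('m::finite \<Rightarrow> real^'n::finite \<Rightarrow> real) \<Rightarrow> ('m \<Rightarrow> real^'n \<Rightarrow> ereal) \<Rightarrow> ('m \<times> 'm) set \<Rightarrow> real^'m^'m \<Rightarrow>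
   real \<Rightarrow> real^(('m + 'm) \<times> 'n) \<Rightarrow> real \<Rightarrow> real \<Rightarrow> real \<Rightarrow> real^('m \<times> 'n) \<Rightarrow> real^('m \<times> 'n) \<Rightarrow> bool" where
  "dissn_step f g E A \<sigma> lam \<mu> L \<eta> x x' \<longleftrightarrow>
     (let u = dual_u E A \<sigma> lam x;
          P = (\<lambda>i. Prox (\<lambda>v. ereal \<sigma> * conjugate (g i) v));
          c = (\<lambda>i. gradient (f i) (block x i) + P i (u (Inl i))
                   + (\<Sum>k\<in>neighbours E i. A $ i $ k *\<^sub>R u (Inr k)));
          N = N_iter \<mu> L \<eta>
      in \<exists>V H d.
        (\<forall>i. V i \<in> clarke (gradient (f i)) (block x i)) \<and>
        (\<forall>i. H i \<in> clarke (P i) (u (Inl i))) \<and>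
        inner_iterates E A \<sigma> \<mu> L V H c N d \<and>
        (\<forall>i. block x' i = block x i + d (N + 1) i))"

definition dissn_sequence ::
  "('m::finite \<Rightarrow> real^'n::finite \<Rightarrow> real) \<Rightarrow> ('m \<Rightarrow> real^'n \<Rightarrow> ereal) \<Rightarrow> ('m \<Rightarrow> real) \<Rightarrow> ('m \<Rightarrow> real) \<Rightarrow>
   ('m \<times> 'm) set \<Rightarrow> real^'m^'m \<Rightarrow> real \<Rightarrow> real^(('m + 'm) \<times> 'n) \<Rightarrow> (nat \<Rightarrow> real) \<Rightarrow>
   (nat \<Rightarrow> real^('m \<times> 'n)) \<Rightarrow> bool" where
  "dissn_sequence f g mus Ls E A \<sigma> lam \<eta> x \<longleftrightarrow>
     (\<forall>t. dissn_step f g E A \<sigma> lam (mu_const mus) (L_const TYPE('n) Ls A \<sigma>) (\<eta> t) (x t) (x (Suc t)))"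

end

theory Submission
  imports Defs
begin

text \<open>Write \<open>\<Psi>\<close> for the gradient of \<open>\<phi>\<close>. Minimising over \<open>y\<close> in the definition of \<open>\<phi>\<close> leaves a sum of Moreau envelopes, so
\<open>\<Psi> x\<close> is \<open>\<nabla>F x + B\<^sup>T P (\<sigma> B x - \<lambda>)\<close>, where \<open>P\<close> applies the proximal maps of the scaled conjugates to the first \<open>m\<close>
blocks (\<open>GDERIV_phi_real\<close>). The solution is a zero of \<open>\<Psi>\<close>, and one outer iteration is an inexact
semismooth Newton step for \<open>\<Psi> x = 0\<close>. Its matrix is \<open>M = diag V + \<sigma> (diag H + W\<^sup>2)\<close>, and the exact Newton direction \<open>ds\<close>
solves \<open>M ds = - \<Psi> x\<close>.

If \<open>\<mu> \<le> M\<close>, then \<open>M (x + ds - xhat) = M (x - xhat) - (\<Psi> x - \<Psi> xhat)\<close> shows that the exact Newton iterate is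
quadratically close to the solution, since strong semismoothness makes the right-hand side of second
order (\<open>newton_residual_semismooth\<close>). The inner loop is Nesterov's accelerated gradient method for
\<open>1/2 d \<bullet> M d + \<Psi> x \<bullet> d\<close>, and after \<open>N(\<eta>)\<close> steps it has found \<open>ds\<close> up to the relative error \<open>\<eta>\<close>
(\<open>nesterov_inner_accuracy\<close>). Together, for the error \<open>r\<close> of the outer iterates,
\<open>r (t+1) \<le> (C r t + D \<eta> t) r t\<close> near the solution (\<open>dissn_step_error\<close>). As \<open>\<eta>\<close> tends to 0, this is superlinear
convergence (\<open>inexact_newton_local_convergence\<close>); if moreover \<open>\<eta> t \<le> c norm (\<Psi> (x t))\<close>, then Lipschitz continuity of \<open>\<Psi>\<close>
bounds \<open>\<eta> t\<close> by a multiple of \<open>r t\<close>, and the convergence is quadratic.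

Two points are less obvious. The accelerated method needs \<open>M\<close> to be symmetric with spectrum in \<open>[\<mu>, L]\<close>. This holds
because \<open>V\<close> and \<open>H\<close> are convex combinations of limits of Jacobians of gradients of convex functions
(\<open>clarke_symmetric\<close>, \<open>clarke_bounds\<close>). And semismoothness is assumed for the proximal map of \<open>g\<close> with parameter 1,
whereas the method uses the conjugate with parameter \<open>\<sigma>\<close>. Both maps parametrise the graph of the
subdifferential of \<open>g\<close>, and the change of parameters is a Lipschitz homeomorphism whose
derivatives, where they exist, are invertible, along which the second-order estimate can be carried over
(\<open>dual_prox_semismooth_estimate\<close>).\<close>

section \<open>Symmetry and bounds of Clarke Jacobians\<close>

text \<open>Jacobians inherit the one-sided bounds of their map by testing the map along a ray; this is the
form of differentiability that those tests use.\<close>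

lemma has_derivative_ray:
  fixes \<Phi> :: "'a::real_normed_vector \<Rightarrow> 'b::real_normed_vector"
  assumes "(\<Phi> has_derivative D) (at x)" "e > 0"
  obtains t where "t > 0" "norm (\<Phi> (x + t *\<^sub>R h) - \<Phi> x - t *\<^sub>R D h) \<le> e * t"
proof -
  interpret D: bounded_linear D using assms(1) by (rule has_derivative_bounded_linear)
  have "e / (norm h + 1) > 0" using assms(2) by (intro divide_pos_pos add_nonneg_pos) auto
  then obtain d where d: "d > 0" "\<And>y. norm (y - x) < d \<Longrightarrow>
      norm (\<Phi> y - \<Phi> x - D (y - x)) \<le> e / (norm h + 1) * norm (y - x)"
    using assms(1) unfolding has_derivative_at_alt by metis
  define t where "t = d / (norm h + 1)"
  have n: "norm h + 1 > 0" by (smt (verit) norm_ge_zero)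
  have t: "t > 0" using d n by (simp add: t_def)
  have "norm (x + t *\<^sub>R h - x) = t * norm h" using t by simp
  moreover have "t * norm h < d" using n d by (simp add: t_def field_simps)
  ultimately have "norm (\<Phi> (x + t *\<^sub>R h) - \<Phi> x - t *\<^sub>R D h) \<le> e / (norm h + 1) * (t * norm h)"
    using d(2)[of "x + t *\<^sub>R h"] t by (simp add: D.scaleR)
  also have "\<dots> \<le> e * t"
    using n t assms(2) by (simp add: field_simps)
  finally show thesis using t that by blast
qed

text \<open>Both \<open>D h \<bullet> k\<close> and \<open>D k \<bullet> h\<close> are limits of the same second difference of \<open>\<phi>\<close> over a shrinking
parallelogram, divided by the square of its scale: apply the mean value theorem along one side and
differentiability of the gradient at the corner \<open>x\<close>. The gradients treated below are merely Lipschitz, so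
second derivatives are known only at individual points.\<close>

lemma hessian_symmetric:
  fixes \<phi> :: "'a::real_inner \<Rightarrow> real"
  assumes grad: "\<And>x. GDERIV \<phi> x :> \<Phi> x" and D: "(\<Phi> has_derivative D) (at x)"
  shows "D h \<bullet> k = D k \<bullet> h"
proof -
  interpret D: bounded_linear D using D by (rule has_derivative_bounded_linear)
  have bound: "\<bar>D k \<bullet> h - D h \<bullet> k\<bar> \<le> 4 * e * (norm h + norm k)\<^sup>2" if e: "e > 0" for e
  proof -
    obtain d where d: "d > 0" "\<And>y. norm (y - x) < d \<Longrightarrow>
        norm (\<Phi> y - \<Phi> x - D (y - x)) \<le> e * norm (y - x)"
      using D e unfolding has_derivative_at_alt by metis
    define M where "M = norm h + norm k"
    have M0: "M \<ge> 0" by (simp add: M_def)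
    \<comment> \<open>The scale keeps the whole parallelogram inside the ball where the gradient is nearly linear.\<close>
    define s where "s = d / (M + 1)"
    have s: "s > 0" "s * M < d" using d(1) M0 by (auto simp: s_def field_simps)
    have claim: "\<bar>\<phi> (x + s *\<^sub>R h + s *\<^sub>R k) - \<phi> (x + s *\<^sub>R h) - \<phi> (x + s *\<^sub>R k) + \<phi> x
        - s\<^sup>2 * (D k \<bullet> h)\<bar> \<le> 2 * e * s\<^sup>2 * M * M"
      if hk: "norm h + norm k = M" for h k
    proof -
      define p where "p t = \<phi> (x + t *\<^sub>R h + s *\<^sub>R k) - \<phi> (x + t *\<^sub>R h)" for t
      define w where "w t = (\<Phi> (x + t *\<^sub>R h + s *\<^sub>R k) - \<Phi> (x + t *\<^sub>R h)) \<bullet> h" for t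
      have g: "(\<phi> has_derivative (\<lambda>v. v \<bullet> \<Phi> y)) (at y)" for y
        using grad[of y] by (simp add: gderiv_def)
      have g2: "((\<lambda>t. \<phi> (c + t *\<^sub>R h)) has_derivative (\<lambda>u. u * (h \<bullet> \<Phi> (c + t *\<^sub>R h)))) (at t within S)"
        for c t S
        by (rule has_derivative_compose[OF _ g, THEN has_derivative_eq_rhs])
          (auto intro!: derivative_eq_intros)
      have "(p has_derivative (\<lambda>u. u * w t)) (at t within S)" for t S
      proof -
        have "p = (\<lambda>t. \<phi> ((x + s *\<^sub>R k) + t *\<^sub>R h) - \<phi> (x + t *\<^sub>R h))"
          by (auto simp: p_def fun_eq_iff add.commute add.left_commute)
        moreover have "((\<lambda>t. \<phi> ((x + s *\<^sub>R k) + t *\<^sub>R h) - \<phi> (x + t *\<^sub>R h))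
            has_derivative (\<lambda>u. u * w t)) (at t within S)"
        proof (rule has_derivative_eq_rhs[OF has_derivative_diff[OF g2 g2]])
          have "x + s *\<^sub>R k + t *\<^sub>R h = x + t *\<^sub>R h + s *\<^sub>R k" by simp
          then show "(\<lambda>u. u * (h \<bullet> \<Phi> (x + s *\<^sub>R k + t *\<^sub>R h)) - u * (h \<bullet> \<Phi> (x + t *\<^sub>R h))) = (\<lambda>u. u * w t)"
            by (simp only: w_def inner_diff_left right_diff_distrib inner_commute[of h])
        qed
        ultimately show ?thesis by simp
      qed
      then obtain \<tau> where \<tau>: "\<tau> \<in> {0<..<s}" "p s - p 0 = s * w \<tau>"
        using mvt_simple[of 0 s p "\<lambda>t u. u * w t"] s by auto
      define r where "r y = \<Phi> y - \<Phi> x - D (y - x)" for y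
      have small: "norm (r (x + z)) \<le> e * (s * M)" if "norm z \<le> s * M" for z
      proof -
        have "norm (r (x + z)) \<le> e * norm z" using d(2)[of "x + z"] that s by (simp add: r_def)
        also have "\<dots> \<le> e * (s * M)" using that e by (intro mult_left_mono) auto
        finally show ?thesis .
      qed
      have h1: "norm (\<tau> *\<^sub>R h) \<le> s * norm h" using \<tau> by (simp add: mult_right_mono)
      have h2: "norm (\<tau> *\<^sub>R h + s *\<^sub>R k) \<le> s * M"
        using norm_triangle_ineq[of "\<tau> *\<^sub>R h" "s *\<^sub>R k"] h1 s by (simp add: hk[symmetric] algebra_simps)
      have h3: "norm (\<tau> *\<^sub>R h) \<le> s * M" using h1 s hk by (smt (verit) mult_left_mono norm_ge_zero)
      have weq: "w \<tau> = s * (D k \<bullet> h) + (r (x + (\<tau> *\<^sub>R h + s *\<^sub>R k)) - r (x + \<tau> *\<^sub>R h)) \<bullet> h"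
        by (simp add: w_def r_def D.add D.scaleR algebra_simps)
      have "\<bar>w \<tau> - s * (D k \<bullet> h)\<bar> \<le> norm (r (x + (\<tau> *\<^sub>R h + s *\<^sub>R k)) - r (x + \<tau> *\<^sub>R h)) * norm h"
        unfolding weq by (simp add: Cauchy_Schwarz_ineq2)
      also have "\<dots> \<le> (2 * (e * (s * M))) * M"
      proof (rule mult_mono)
        show "norm (r (x + (\<tau> *\<^sub>R h + s *\<^sub>R k)) - r (x + \<tau> *\<^sub>R h)) \<le> 2 * (e * (s * M))"
          using norm_triangle_ineq4[of "r (x + (\<tau> *\<^sub>R h + s *\<^sub>R k))" "r (x + \<tau> *\<^sub>R h)"] small[OF h2] small[OF h3]
          by linarith
        show "norm h \<le> M" using hk norm_ge_zero[of k] by linarith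
      qed (use e s M0 in auto)
      finally have "s * \<bar>w \<tau> - s * (D k \<bullet> h)\<bar> \<le> s * ((2 * (e * (s * M))) * M)"
        using s by (intro mult_left_mono) auto
      also have "\<dots> = 2 * e * s\<^sup>2 * M * M" by (simp add: power2_eq_square)
      finally have "\<bar>s * (w \<tau> - s * (D k \<bullet> h))\<bar> \<le> 2 * e * s\<^sup>2 * M * M"
        using s by (simp add: abs_mult)
      moreover have "\<phi> (x + s *\<^sub>R h + s *\<^sub>R k) - \<phi> (x + s *\<^sub>R h) - \<phi> (x + s *\<^sub>R k) + \<phi> x
        - s\<^sup>2 * (D k \<bullet> h) = s * (w \<tau> - s * (D k \<bullet> h))"
        using \<tau>(2) by (simp add: p_def power2_eq_square algebra_simps)
      ultimately show ?thesis by simp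
    qed
    have "\<bar>s\<^sup>2 * (D k \<bullet> h) - s\<^sup>2 * (D h \<bullet> k)\<bar> \<le> 4 * e * s\<^sup>2 * M * M"
    proof -
      have "x + s *\<^sub>R k + s *\<^sub>R h = x + s *\<^sub>R h + s *\<^sub>R k" by simp
      then have "\<bar>\<phi> (x + s *\<^sub>R h + s *\<^sub>R k) - \<phi> (x + s *\<^sub>R k) - \<phi> (x + s *\<^sub>R h) + \<phi> x
        - s\<^sup>2 * (D h \<bullet> k)\<bar> \<le> 2 * e * s\<^sup>2 * M * M"
        using claim[of k h] by (simp only: M_def add.commute[of "norm k"])
      with claim[of h k] show ?thesis by (simp only: M_def) linarith
    qed
    then have "s\<^sup>2 * \<bar>D k \<bullet> h - D h \<bullet> k\<bar> \<le> s\<^sup>2 * (4 * e * M\<^sup>2)"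
    proof -
      have "s\<^sup>2 * (D k \<bullet> h) - s\<^sup>2 * (D h \<bullet> k) = s\<^sup>2 * (D k \<bullet> h - D h \<bullet> k)" by (simp add: right_diff_distrib)
      moreover assume "\<bar>s\<^sup>2 * (D k \<bullet> h) - s\<^sup>2 * (D h \<bullet> k)\<bar> \<le> 4 * e * s\<^sup>2 * M * M"
      ultimately show ?thesis by (simp add: abs_mult power2_eq_square mult_ac)
    qed
    then show ?thesis using s by (simp add: M_def)
  qed
  have "\<bar>D k \<bullet> h - D h \<bullet> k\<bar> \<le> 0"
  proof (rule field_le_epsilon)
    fix e :: real assume "e > 0"
    define N where "N = (norm h + norm k)\<^sup>2"
    have "N \<ge> 0" by (simp add: N_def)
    then have "e / (4 * (N + 1)) > 0" using \<open>e > 0\<close> by simp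
    from bound[OF this] have "\<bar>D k \<bullet> h - D h \<bullet> k\<bar> \<le> 4 * (e / (4 * (N + 1))) * N" by (simp add: N_def)
    also have "4 * (e / (4 * (N + 1))) * N = e * (N / (N + 1))" using \<open>N \<ge> 0\<close> by (simp add: field_simps)
    also have "\<dots> \<le> 0 + e" using \<open>e > 0\<close> \<open>N \<ge> 0\<close> by (simp add: field_simps)
    finally show "\<bar>D k \<bullet> h - D h \<bullet> k\<bar> \<le> 0 + e" .
  qed
  then show ?thesis by simp
qed

lemma derivative_monotone_bounds:
  fixes \<Phi> :: "'a::real_inner \<Rightarrow> 'a"
  assumes D: "(\<Phi> has_derivative D) (at x)"
  shows "(\<And>y z. m * (norm (y - z))\<^sup>2 \<le> (\<Phi> y - \<Phi> z) \<bullet> (y - z)) \<Longrightarrow> m * (norm h)\<^sup>2 \<le> D h \<bullet> h"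
    and "(\<And>y z. (\<Phi> y - \<Phi> z) \<bullet> (y - z) \<le> K * (norm (y - z))\<^sup>2) \<Longrightarrow> D h \<bullet> h \<le> K * (norm h)\<^sup>2"
proof -
  have approx: "\<exists>t>0. \<bar>(\<Phi> (x + t *\<^sub>R h) - \<Phi> x) \<bullet> (t *\<^sub>R h) - t\<^sup>2 * (D h \<bullet> h)\<bar> \<le> t\<^sup>2 * e" if "e > 0" for e
  proof -
    have "e / (norm h + 1) > 0" using that by (intro divide_pos_pos add_nonneg_pos) auto
    from has_derivative_ray[OF D this, of h]
    obtain t where t: "t > 0" "norm (\<Phi> (x + t *\<^sub>R h) - \<Phi> x - t *\<^sub>R D h) \<le> e / (norm h + 1) * t" .
    have "\<bar>(\<Phi> (x + t *\<^sub>R h) - \<Phi> x) \<bullet> (t *\<^sub>R h) - t\<^sup>2 * (D h \<bullet> h)\<bar>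
      = \<bar>(\<Phi> (x + t *\<^sub>R h) - \<Phi> x - t *\<^sub>R D h) \<bullet> (t *\<^sub>R h)\<bar>"
      by (simp add: power2_eq_square inner_diff_left right_diff_distrib)
    also have "\<dots> \<le> (e / (norm h + 1) * t) * norm (t *\<^sub>R h)"
      by (rule order_trans[OF Cauchy_Schwarz_ineq2]) (intro mult_right_mono t norm_ge_zero)
    also have "\<dots> = t\<^sup>2 * e * (norm h / (norm h + 1))" using t by (simp add: power2_eq_square)
    also have "\<dots> \<le> t\<^sup>2 * e"
    proof (rule mult_left_le)
      show "norm h / (norm h + 1) \<le> 1" by (smt (verit) divide_le_eq_1 norm_ge_zero)
    qed (use that t in auto)
    finally show ?thesis using t by blast
  qed
  show "m * (norm h)\<^sup>2 \<le> D h \<bullet> h"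
    if m: "\<And>y z. m * (norm (y - z))\<^sup>2 \<le> (\<Phi> y - \<Phi> z) \<bullet> (y - z)"
  proof (rule field_le_epsilon)
    fix e :: real assume "e > 0"
    from approx[OF this] obtain t where t: "t > 0"
      "\<bar>(\<Phi> (x + t *\<^sub>R h) - \<Phi> x) \<bullet> (t *\<^sub>R h) - t\<^sup>2 * (D h \<bullet> h)\<bar> \<le> t\<^sup>2 * e" by blast
    have "t\<^sup>2 * (m * (norm h)\<^sup>2) \<le> (\<Phi> (x + t *\<^sub>R h) - \<Phi> x) \<bullet> (t *\<^sub>R h)"
      using m[of "x + t *\<^sub>R h" x] by (simp add: power_mult_distrib mult.left_commute)
    also have "\<dots> \<le> t\<^sup>2 * (D h \<bullet> h + e)" using t(2) unfolding abs_le_iff distrib_left by linarith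
    finally show "m * (norm h)\<^sup>2 \<le> D h \<bullet> h + e" using t(1) by simp
  qed
  show "D h \<bullet> h \<le> K * (norm h)\<^sup>2"
    if m: "\<And>y z. (\<Phi> y - \<Phi> z) \<bullet> (y - z) \<le> K * (norm (y - z))\<^sup>2"
  proof (rule field_le_epsilon)
    fix e :: real assume "e > 0"
    from approx[OF this] obtain t where t: "t > 0"
      "\<bar>(\<Phi> (x + t *\<^sub>R h) - \<Phi> x) \<bullet> (t *\<^sub>R h) - t\<^sup>2 * (D h \<bullet> h)\<bar> \<le> t\<^sup>2 * e" by blast
    have "t\<^sup>2 * (D h \<bullet> h) \<le> (\<Phi> (x + t *\<^sub>R h) - \<Phi> x) \<bullet> (t *\<^sub>R h) + t\<^sup>2 * e"
      using t(2) unfolding abs_le_iff by linarith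
    also have "\<dots> \<le> t\<^sup>2 * (K * (norm h)\<^sup>2 + e)"
      using m[of "x + t *\<^sub>R h" x] by (simp add: power_mult_distrib distrib_left mult.left_commute)
    finally show "D h \<bullet> h \<le> K * (norm h)\<^sup>2 + e" using t(1) by simp
  qed
qed

lemma derivative_nonexpansive:
  fixes \<Phi> :: "'a::real_normed_vector \<Rightarrow> 'b::real_normed_vector"
  assumes D: "(\<Phi> has_derivative D) (at x)" and ne: "\<And>y z. norm (\<Phi> y - \<Phi> z) \<le> norm (y - z)"
  shows "norm (D h) \<le> norm h"
proof (rule field_le_epsilon)
  fix e :: real assume "e > 0"
  from has_derivative_ray[OF D this, of h]
  obtain t where t: "t > 0" "norm (\<Phi> (x + t *\<^sub>R h) - \<Phi> x - t *\<^sub>R D h) \<le> e * t" .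
  have "norm (\<Phi> (x + t *\<^sub>R h) - \<Phi> x) \<le> t * norm h" using ne[of "x + t *\<^sub>R h" x] t(1) by simp
  then have "norm (t *\<^sub>R D h) \<le> t * norm h + e * t"
    using norm_triangle_sub[of "t *\<^sub>R D h" "\<Phi> (x + t *\<^sub>R h) - \<Phi> x"] t(2)
    by (simp only: norm_minus_commute[of "t *\<^sub>R D h"])
  then have "t * norm (D h) \<le> t * (norm h + e)" using t(1) by (simp add: distrib_left mult.commute)
  then show "norm (D h) \<le> norm h + e" using t(1) by simp
qed

text \<open>Closed convex properties of Jacobians pass to the Clarke subdifferential; symmetry and the
quadratic-form bounds below are such properties.\<close>

lemma clarke_minimal:
  assumes "convex S" "closed S" "\<And>y. \<Phi> differentiable (at y) \<Longrightarrow> jacobian \<Phi> (at y) \<in> S"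
  shows "clarke \<Phi> x \<subseteq> S"
  unfolding clarke_def
proof (rule hull_minimal[where S = convex, OF _ assms(1)], clarify)
  fix V s assume "\<forall>k. \<Phi> differentiable (at (s k))" "(\<lambda>k. jacobian \<Phi> (at (s k))) \<longlonglongrightarrow> V"
  then show "V \<in> S" using assms(3) closed_sequentially[OF assms(2), of "\<lambda>k. jacobian \<Phi> (at (s k))" V] by simp
qed

lemma tendsto_matrix_vector_mult:
  fixes V :: "'x \<Rightarrow> real^'a^'b"
  assumes "(V \<longlongrightarrow> V0) F" "(w \<longlongrightarrow> w0) F"
  shows "((\<lambda>k. V k *v w k) \<longlongrightarrow> V0 *v w0) F"
  unfolding matrix_vector_mult_def
  by (intro tendsto_vec_lambda tendsto_sum tendsto_mult tendsto_vec_nth assms)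

lemma continuous_matrix_vector_mult [continuous_intros]:
  "continuous_on S (\<lambda>V::real^'a^'b. V *v h)"
  by (auto simp: continuous_on_def intro: tendsto_matrix_vector_mult tendsto_ident_at tendsto_const)

lemma clarke_bounds:
  fixes \<Phi> :: "real^'n::finite \<Rightarrow> real^'n"
  assumes V: "V \<in> clarke \<Phi> x"
    and m: "\<And>y z. m * (norm (y - z))\<^sup>2 \<le> (\<Phi> y - \<Phi> z) \<bullet> (y - z)"
    and K: "\<And>y z. (\<Phi> y - \<Phi> z) \<bullet> (y - z) \<le> K * (norm (y - z))\<^sup>2"
  shows "m * (norm h)\<^sup>2 \<le> (V *v h) \<bullet> h" "(V *v h) \<bullet> h \<le> K * (norm h)\<^sup>2"
proof -
  let ?S = "{V. m * (norm h)\<^sup>2 \<le> (V *v h) \<bullet> h \<and> (V *v h) \<bullet> h \<le> K * (norm h)\<^sup>2}"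
  have "clarke \<Phi> x \<subseteq> ?S"
  proof (rule clarke_minimal)
    have "?S = (\<lambda>V. (V *v h) \<bullet> h) -` {m * (norm h)\<^sup>2..K * (norm h)\<^sup>2}" by auto
    moreover have "linear (\<lambda>V::real^'n^'n. (V *v h) \<bullet> h)"
      by (rule linearI) (auto simp: matrix_vector_mult_add_rdistrib scaleR_matrix_vector_assoc[symmetric] inner_left_distrib)
    ultimately show "convex ?S" by (simp only: convex_linear_vimage convex_real_interval)
    have "?S = {V. m * (norm h)\<^sup>2 \<le> (V *v h) \<bullet> h} \<inter> {V. (V *v h) \<bullet> h \<le> K * (norm h)\<^sup>2}" by auto
    then show "closed ?S"
      by (auto intro!: closed_Int closed_Collect_le continuous_intros)
    show "jacobian \<Phi> (at y) \<in> ?S" if "\<Phi> differentiable (at y)" for y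
      using derivative_monotone_bounds(1)[OF that[unfolded jacobian_works] m, of h]
        derivative_monotone_bounds(2)[OF that[unfolded jacobian_works] K, of h] by simp
  qed
  with V show "m * (norm h)\<^sup>2 \<le> (V *v h) \<bullet> h" "(V *v h) \<bullet> h \<le> K * (norm h)\<^sup>2" by auto
qed

lemma clarke_symmetric:
  fixes \<Phi> :: "real^'n::finite \<Rightarrow> real^'n"
  assumes V: "V \<in> clarke \<Phi> x" and grad: "\<And>x. GDERIV \<phi> x :> \<Phi> x"
  shows "(V *v h) \<bullet> k = (V *v k) \<bullet> h"
proof -
  let ?S = "{V. (V *v h) \<bullet> k = (V *v k) \<bullet> h}"
  have "clarke \<Phi> x \<subseteq> ?S"
  proof (rule clarke_minimal)
    show "convex ?S"
      by (rule convexI) (simp add: matrix_vector_mult_add_rdistrib scaleR_matrix_vector_assoc[symmetric] inner_left_distrib)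
    show "closed ?S" by (auto intro!: closed_Collect_eq continuous_intros)
    show "jacobian \<Phi> (at y) \<in> ?S" if "\<Phi> differentiable (at y)" for y
      using hessian_symmetric[OF grad that[unfolded jacobian_works]] by simp
  qed
  with V show ?thesis by auto
qed

section \<open>Proximal maps and Moreau envelopes\<close>

text \<open>Envelopes are differentiated through two-sided quadratic bounds, since they are defined by
minimisation and have no formula to differentiate.\<close>

lemma GDERIV_quadratic_bound:
  fixes f :: "'a::real_inner \<Rightarrow> real"
  assumes "\<And>y. \<bar>f y - f x - v \<bullet> (y - x)\<bar> \<le> C * (norm (y - x))\<^sup>2"
  shows "GDERIV f x :> v"
  unfolding gderiv_def has_derivative_at_alt
proof (intro conjI allI impI)
  show "bounded_linear (\<lambda>h. h \<bullet> v)" by (rule bounded_linear_inner_left)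
  fix e :: real assume e: "e > 0"
  show "\<exists>d>0. \<forall>y. norm (y - x) < d \<longrightarrow> norm (f y - f x - (y - x) \<bullet> v) \<le> e * norm (y - x)"
  proof (intro exI[of _ "e / (\<bar>C\<bar> + 1)"] conjI allI impI)
    show "e / (\<bar>C\<bar> + 1) > 0" using e by (simp add: add_nonneg_pos)
    fix y assume y: "norm (y - x) < e / (\<bar>C\<bar> + 1)"
    have "norm (f y - f x - (y - x) \<bullet> v) \<le> C * (norm (y - x))\<^sup>2"
      using assms[of y] by (simp add: inner_commute)
    also have "\<dots> \<le> ((\<bar>C\<bar> + 1) * norm (y - x)) * norm (y - x)"
      by (simp add: power2_eq_square mult.assoc[symmetric] mult_right_mono)
    also have "\<dots> \<le> e * norm (y - x)"
      using y by (intro mult_right_mono) (simp_all add: pos_less_divide_eq add_nonneg_pos mult.commute)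
    finally show "norm (f y - f x - (y - x) \<bullet> v) \<le> e * norm (y - x)" .
  qed
qed

definition subgradient_at :: "('a::real_inner \<Rightarrow> ereal) \<Rightarrow> 'a \<Rightarrow> 'a \<Rightarrow> bool" where
  "subgradient_at g z q \<longleftrightarrow> \<bar>g z\<bar> \<noteq> \<infinity> \<and> (\<forall>x. g z + ereal (q \<bullet> (x - z)) \<le> g x)"

lemma subgradient_at_monotone:
  assumes "subgradient_at g z q" "subgradient_at g z' q'"
  shows "(q - q') \<bullet> (z - z') \<ge> 0"
proof -
  obtain r r' where r: "g z = ereal r" "g z' = ereal r'"
    using assms unfolding subgradient_at_def by (metis abs_ereal.simps(2,3) ereal_cases)
  have "r + q \<bullet> (z' - z) \<le> r'" "r' + q' \<bullet> (z - z') \<le> r"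
    using assms r unfolding subgradient_at_def by (metis ereal_less_eq(3) plus_ereal.simps(1))+
  then show ?thesis by (simp add: inner_diff_left inner_diff_right)
qed

text \<open>The subgradient inequality makes the proximal objective grow like \<open>1/2 \<cdot> (norm (x - z))\<^sup>2\<close> away from \<open>z\<close>,
so \<open>z\<close> is its only minimiser and the choice hidden in \<open>arg_min\<close> is harmless.\<close>

lemma Prox_eqI:
  assumes "subgradient_at p z (w - z)"
  shows "Prox p w = z"
proof -
  obtain r where r: "p z = ereal r"
    using assms unfolding subgradient_at_def by (metis abs_ereal.simps(2,3) ereal_cases)
  have id: "(w - z) \<bullet> (x - z) + 1 / 2 * (norm (x - w))\<^sup>2
      = 1 / 2 * (norm (z - w))\<^sup>2 + 1 / 2 * (norm (x - z))\<^sup>2" for x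
    unfolding power2_norm_eq_inner by (simp add: inner_diff_left inner_diff_right inner_commute algebra_simps)
  have le: "ereal (r + 1 / 2 * (norm (z - w))\<^sup>2 + 1 / 2 * (norm (x - z))\<^sup>2) \<le> p x + ereal (1 / 2 * (norm (x - w))\<^sup>2)" for x
  proof -
    have "ereal (r + (w - z) \<bullet> (x - z)) \<le> p x"
      using assms r unfolding subgradient_at_def by (metis plus_ereal.simps(1))
    then have "ereal (r + (w - z) \<bullet> (x - z)) + ereal (1 / 2 * (norm (x - w))\<^sup>2) \<le> p x + ereal (1 / 2 * (norm (x - w))\<^sup>2)"
      by (rule add_right_mono)
    then show ?thesis by (simp only: plus_ereal.simps(1) add.assoc id)
  qed
  show ?thesis unfolding Prox_def arg_min_def
  proof (rule some_equality)
    show "is_arg_min (\<lambda>y. p y + ereal (1 / 2 * (norm (y - w))\<^sup>2)) (\<lambda>_. True) z"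
      unfolding is_arg_min_def
    proof (clarsimp simp: not_less)
      fix y
      have "p z + ereal ((norm (z - w))\<^sup>2 / 2) \<le> ereal (r + 1 / 2 * (norm (z - w))\<^sup>2 + 1 / 2 * (norm (y - z))\<^sup>2)"
        by (simp add: r)
      also note le[of y]
      finally show "p z + ereal ((norm (z - w))\<^sup>2 / 2) \<le> p y + ereal ((norm (y - w))\<^sup>2 / 2)" by simp
    qed
  next
    fix y assume "is_arg_min (\<lambda>y. p y + ereal (1 / 2 * (norm (y - w))\<^sup>2)) (\<lambda>_. True) y"
    then have "p y + ereal (1 / 2 * (norm (y - w))\<^sup>2) \<le> p z + ereal (1 / 2 * (norm (z - w))\<^sup>2)"
      unfolding is_arg_min_def by (simp add: not_less)
    with le[of y] have "ereal (r + 1 / 2 * (norm (z - w))\<^sup>2 + 1 / 2 * (norm (y - z))\<^sup>2) \<le> ereal (r + 1 / 2 * (norm (z - w))\<^sup>2)"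
      unfolding r plus_ereal.simps(1) by (rule order_trans)
    then show "y = z" by simp
  qed
qed

text \<open>Fenchel duality: \<open>q\<close> being a subgradient of \<open>g\<close> at \<open>z\<close> is the equality case of the Fenchel-Young inequality,
which reads equally well as \<open>z\<close> being a subgradient of the conjugate at \<open>q\<close>. With the previous
lemma this evaluates the proximal map of the scaled conjugate (Moreau decomposition).\<close>

lemma subgradient_at_conjugate:
  assumes "subgradient_at g z q" "\<sigma> > 0"
  shows "subgradient_at (\<lambda>v. ereal \<sigma> * conjugate g v) q (\<sigma> *\<^sub>R z)"
proof -
  obtain r where r: "g z = ereal r"
    using assms unfolding subgradient_at_def by (metis abs_ereal.simps(2,3) ereal_cases)
  have ge: "ereal (z \<bullet> v - r) \<le> conjugate g v" for v
    unfolding conjugate_def by (rule SUP_upper2[of z]) (simp_all add: r)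
  have "conjugate g q \<le> ereal (z \<bullet> q - r)"
    unfolding conjugate_def
  proof (rule SUP_least)
    fix x
    have "ereal (r + q \<bullet> (x - z)) \<le> g x"
      using assms r unfolding subgradient_at_def by (metis plus_ereal.simps(1))
    then show "ereal (x \<bullet> q) - g x \<le> ereal (z \<bullet> q - r)"
      by (cases "g x") (auto simp: inner_diff_right inner_commute)
  qed
  with ge[of q] have q: "conjugate g q = ereal (z \<bullet> q - r)" by (rule antisym[rotated])
  show ?thesis unfolding subgradient_at_def
  proof (intro conjI allI)
    show "\<bar>ereal \<sigma> * conjugate g q\<bar> \<noteq> \<infinity>" by (simp add: q)
    fix x
    have "ereal \<sigma> * ereal (z \<bullet> x - r) \<le> ereal \<sigma> * conjugate g x"
      using ge assms(2) by (intro ereal_mult_left_mono) auto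
    then show "ereal \<sigma> * conjugate g q + ereal (\<sigma> *\<^sub>R z \<bullet> (x - q)) \<le> ereal \<sigma> * conjugate g x"
      by (simp add: q algebra_simps)
  qed
qed

text \<open>Separate a point just below the graph from the epigraph; the hyperplane cannot be vertical because
the point lies on the same vertical line as a point of the epigraph.\<close>

lemma closed_proper_convex_affine_minorant:
  fixes g :: "'a::euclidean_space \<Rightarrow> ereal"
  assumes "closed_proper_convex g"
  obtains a b where "\<And>x r. (x, r) \<in> epigraph g \<Longrightarrow> a \<bullet> x + b \<le> r"
proof -
  obtain x0 where "g x0 \<noteq> \<infinity>" "g x0 \<noteq> -\<infinity>" using assms by (auto simp: closed_proper_convex_def)
  then obtain r0 where r0: "g x0 = ereal r0" by (metis ereal_cases)
  have in0: "(x0, r0) \<in> epigraph g" and out: "(x0, r0 - 1) \<notin> epigraph g"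
    by (auto simp: epigraph_def r0)
  have "convex (epigraph g)" "closed (epigraph g)" using assms by (simp_all add: closed_proper_convex_def)
  from separating_hyperplane_closed_point[OF this out]
  obtain c \<beta> where c: "c \<bullet> (x0, r0 - 1) < \<beta>" "\<And>y. y \<in> epigraph g \<Longrightarrow> \<beta> < c \<bullet> y"
    by blast
  obtain a \<alpha> where a: "c = (a, \<alpha>)" by (cases c)
  have \<alpha>: "\<alpha> > 0" using c(1) c(2)[OF in0] by (simp add: a inner_Pair algebra_simps)
  have "((- 1 / \<alpha>) *\<^sub>R a) \<bullet> x + \<beta> / \<alpha> \<le> r" if "(x, r) \<in> epigraph g" for x r
  proof -
    have "\<beta> - a \<bullet> x \<le> \<alpha> * r" using c(2)[OF that] by (simp add: a inner_Pair)
    then show ?thesis using \<alpha> by (simp add: field_simps)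
  qed
  then show thesis using that by blast
qed

text \<open>Minimising over the epigraph instead of over \<open>x\<close> keeps the objective real-valued and continuous, so
compactness applies directly; the affine minorant makes the relevant part of the epigraph bounded.\<close>

lemma epigraph_prox_attained:
  fixes g :: "'a::euclidean_space \<Rightarrow> ereal"
  assumes g: "closed_proper_convex g" and s: "s > 0"
  obtains z r where "(z, r) \<in> epigraph g"
    "\<And>x t. (x, t) \<in> epigraph g \<Longrightarrow> r + s / 2 * (norm (z - w))\<^sup>2 \<le> t + s / 2 * (norm (x - w))\<^sup>2"
proof -
  obtain a b where ab: "\<And>x r. (x, r) \<in> epigraph g \<Longrightarrow> a \<bullet> x + b \<le> r"
    using closed_proper_convex_affine_minorant[OF g] by metis
  obtain x0 where "g x0 \<noteq> \<infinity>" "g x0 \<noteq> -\<infinity>" using g by (auto simp: closed_proper_convex_def)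
  then obtain r0 where r0: "g x0 = ereal r0" by (metis ereal_cases)
  have in0: "(x0, r0) \<in> epigraph g" by (auto simp: epigraph_def r0)
  define q where "q y = snd y + s / 2 * (norm (fst y - w))\<^sup>2" for y :: "'a \<times> real"
  define c0 where "c0 = q (x0, r0)"
  define c1 where "c1 = c0 - b - a \<bullet> w"
  \<comment> \<open>Beyond radius \<open>T\<close> the quadratic term outweighs the affine minorant; \<open>lo\<close> bounds
      that minorant from below on the ball of radius \<open>T\<close>.\<close>
  define T where "T = max 1 (2 * (norm a + \<bar>c1\<bar> + 1) / s)"
  define lo where "lo = a \<bullet> w + b - norm a * T"
  have bnd: "fst y \<in> cball w T \<and> snd y \<in> {lo..c0}" if y: "y \<in> epigraph g" "q y \<le> c0" for y
  proof -
    obtain x r where xr: "y = (x, r)" by (cases y)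
    define t where "t = norm (x - w)"
    have r1: "a \<bullet> x + b \<le> r" using ab y xr by simp
    have r2: "r + s / 2 * t\<^sup>2 \<le> c0" using y xr by (simp add: q_def t_def)
    have ax: "a \<bullet> x \<ge> a \<bullet> w - norm a * t"
      using Cauchy_Schwarz_ineq2[of a "x - w"] by (simp add: t_def inner_diff_right abs_le_iff)
    have "t \<le> T"
    proof (rule ccontr)
      assume "\<not> t \<le> T"
      then have t: "t > 1" "2 * (norm a + \<bar>c1\<bar> + 1) / s < t" by (auto simp: T_def)
      then have "norm a + \<bar>c1\<bar> + 1 < s / 2 * t" using s by (simp add: field_simps)
      then have "(norm a + \<bar>c1\<bar> + 1) * t \<le> (s / 2 * t) * t" using t(1) by (intro mult_right_mono) auto
      moreover have "(\<bar>c1\<bar> + 1) * t \<ge> (\<bar>c1\<bar> + 1) * 1" using t(1) by (intro mult_left_mono) auto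
      ultimately have "c1 + norm a * t < s / 2 * t\<^sup>2" by (simp add: power2_eq_square algebra_simps)
      then show False using r1 r2 ax by (simp add: c1_def)
    qed
    moreover have "r \<le> c0" using r2 s by (smt (verit) half_gt_zero mult_nonneg_nonneg zero_le_power2)
    moreover have "norm a * t \<le> norm a * T" using \<open>t \<le> T\<close> by (intro mult_left_mono) auto
    then have "lo \<le> r" using r1 ax by (simp add: lo_def)
    ultimately show ?thesis by (simp add: xr t_def dist_norm norm_minus_commute)
  qed
  let ?K = "epigraph g \<inter> (cball w T \<times> {lo..c0})"
  have "compact ?K"
    using g by (intro closed_Int_compact compact_Times) (auto simp: closed_proper_convex_def)
  moreover have "?K \<noteq> {}" using bnd[OF in0] in0 by (auto simp: c0_def)
  moreover have "continuous_on ?K q" unfolding q_def by (intro continuous_intros)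
  ultimately obtain m where m: "m \<in> ?K" "\<forall>y\<in>?K. q m \<le> q y" using continuous_attains_inf by blast
  have "q m \<le> q y" if "y \<in> epigraph g" for y
  proof (cases "q y \<le> c0")
    case True then show ?thesis using m bnd[OF that] that by (auto simp: mem_Times_iff)
  next
    case False
    moreover have "(x0, r0) \<in> ?K" using bnd[OF in0] in0 by (simp add: c0_def)
    then have "q m \<le> c0" using m(2) by (auto simp: c0_def)
    ultimately show ?thesis by linarith
  qed
  then show thesis using that[of "fst m" "snd m"] m(1) by (auto simp: q_def)
qed

text \<open>First-order optimality at the minimiser over the epigraph, obtained by moving a small step \<open>t\<close> towards an arbitrary
point of the epigraph and dividing by \<open>t\<close>.\<close>

lemma prox_subgradient_exists:
  fixes g :: "'a::euclidean_space \<Rightarrow> ereal"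
  assumes g: "closed_proper_convex g" and s: "s > 0"
  obtains z where "subgradient_at g z (s *\<^sub>R (w - z))"
proof -
  obtain z r where z: "(z, r) \<in> epigraph g"
    "\<And>x t. (x, t) \<in> epigraph g \<Longrightarrow> r + s / 2 * (norm (z - w))\<^sup>2 \<le> t + s / 2 * (norm (x - w))\<^sup>2"
    using epigraph_prox_attained[OF g s, of w] by metis
  have "g z \<noteq> -\<infinity>" using g by (simp add: closed_proper_convex_def)
  then obtain r0 where r0: "g z = ereal r0" using z(1) by (cases "g z") (auto simp: epigraph_def)
  have rr: "r0 = r" using z(1) z(2)[of z r0] r0 by (auto simp: epigraph_def)
  have "g z + ereal (s *\<^sub>R (w - z) \<bullet> (x - z)) \<le> g x" for x
  proof (cases "g x")
    case (real \<rho>)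
    then have x: "(x, \<rho>) \<in> epigraph g" by (simp add: epigraph_def)
    have "r - \<rho> + s * ((w - z) \<bullet> (x - z)) \<le> 0"
    proof (rule field_le_epsilon)
      fix e :: real assume e: "e > 0"
      define N where "N = s / 2 * (norm (x - z))\<^sup>2"
      have N: "N \<ge> 0" using s by (simp add: N_def)
      define t where "t = min 1 (e / (N + 1))"
      have t: "0 < t" "t \<le> 1" "t \<le> e / (N + 1)" using e N by (auto simp: t_def)
      have "t * N \<le> e / (N + 1) * (N + 1)" using t N by (intro mult_mono) auto
      then have tN: "t * N \<le> e" using N by simp
      have "(1 - t) *\<^sub>R (z, r) + t *\<^sub>R (x, \<rho>) \<in> epigraph g"
        using g z(1) x t by (intro convexD) (auto simp: closed_proper_convex_def)
      then have "((1 - t) *\<^sub>R z + t *\<^sub>R x, (1 - t) * r + t * \<rho>) \<in> epigraph g" by simp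
      from z(2)[OF this]
      have "r + s / 2 * (norm (z - w))\<^sup>2 \<le> (1 - t) * r + t * \<rho> + s / 2 * (norm ((z - w) + t *\<^sub>R (x - z)))\<^sup>2"
        by (simp add: algebra_simps)
      also have "(norm ((z - w) + t *\<^sub>R (x - z)))\<^sup>2 = (norm (z - w))\<^sup>2 - 2 * t * ((w - z) \<bullet> (x - z)) + t\<^sup>2 * (norm (x - z))\<^sup>2"
        unfolding power2_norm_eq_inner
        by (simp add: inner_add_left inner_add_right inner_diff_left inner_diff_right inner_commute power2_eq_square algebra_simps)
      finally have "t * (r - \<rho> + s * ((w - z) \<bullet> (x - z))) \<le> t * (t * N)"
        by (simp add: N_def power2_eq_square algebra_simps)
      then show "r - \<rho> + s * ((w - z) \<bullet> (x - z)) \<le> 0 + e" using t(1) tN by simp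
    qed
    then show ?thesis by (simp add: r0 rr real)
  next
    case MInf then show ?thesis using g by (simp add: closed_proper_convex_def)
  qed simp
  then have "subgradient_at g z (s *\<^sub>R (w - z))" by (simp add: subgradient_at_def r0)
  then show thesis by (rule that)
qed

lemma Prox_subgradient:
  fixes g :: "'a::euclidean_space \<Rightarrow> ereal"
  assumes "closed_proper_convex g"
  shows "subgradient_at g (Prox g w) (w - Prox g w)"
proof -
  obtain z where z: "subgradient_at g z (1 *\<^sub>R (w - z))"
    using prox_subgradient_exists[OF assms zero_less_one] by metis
  then have "Prox g w = z" by (intro Prox_eqI) simp
  with z show ?thesis by simp
qed

abbreviation dual_prox :: "real \<Rightarrow> ('a::real_inner \<Rightarrow> ereal) \<Rightarrow> 'a \<Rightarrow> 'a" where
  "dual_prox \<sigma> g \<equiv> Prox (\<lambda>v. ereal \<sigma> * conjugate g v)"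

text \<open>Moreau decomposition of \<open>u\<close>: the pair consisting of \<open>(u - q) / \<sigma>\<close> and \<open>q = dual_prox \<sigma> g u\<close> lies on the graph of the
subdifferential of \<open>g\<close>. All later facts about the dual proximal map come from this inclusion.\<close>

lemma dual_prox_subgradient:
  fixes g :: "'a::euclidean_space \<Rightarrow> ereal"
  assumes "closed_proper_convex g" and \<sigma>: "\<sigma> > 0"
  shows "subgradient_at g ((1 / \<sigma>) *\<^sub>R (u - dual_prox \<sigma> g u)) (dual_prox \<sigma> g u)"
proof -
  obtain z where z: "subgradient_at g z (\<sigma> *\<^sub>R ((1 / \<sigma>) *\<^sub>R u - z))"
    using prox_subgradient_exists[OF assms] by metis
  have "\<sigma> *\<^sub>R ((1 / \<sigma>) *\<^sub>R u - z) = u - \<sigma> *\<^sub>R z" using \<sigma> by (simp add: scaleR_diff_right)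
  then have z': "subgradient_at g z (u - \<sigma> *\<^sub>R z)" using z by simp
  have "dual_prox \<sigma> g u = u - \<sigma> *\<^sub>R z"
    using subgradient_at_conjugate[OF z' \<sigma>] by (intro Prox_eqI) simp
  with z' \<sigma> show ?thesis by simp
qed

text \<open>Firm nonexpansiveness is monotonicity of the subdifferential, rewritten.\<close>

lemma Prox_firmly_nonexpansive:
  fixes g :: "'a::euclidean_space \<Rightarrow> ereal"
  assumes "closed_proper_convex g"
  shows "(norm (Prox g x - Prox g y))\<^sup>2 \<le> (Prox g x - Prox g y) \<bullet> (x - y)"
  using subgradient_at_monotone[OF Prox_subgradient[OF assms, of x] Prox_subgradient[OF assms, of y]]
  unfolding power2_norm_eq_inner by (simp add: inner_diff_left inner_diff_right inner_commute)

lemma dual_prox_firmly_nonexpansive: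
  fixes g :: "'a::euclidean_space \<Rightarrow> ereal"
  assumes "closed_proper_convex g" "\<sigma> > 0"
  shows "(norm (dual_prox \<sigma> g x - dual_prox \<sigma> g y))\<^sup>2 \<le> (dual_prox \<sigma> g x - dual_prox \<sigma> g y) \<bullet> (x - y)"
proof -
  define P where "P = dual_prox \<sigma> g"
  have "0 \<le> (P x - P y) \<bullet> ((1 / \<sigma>) *\<^sub>R (x - P x) - (1 / \<sigma>) *\<^sub>R (y - P y))"
    unfolding P_def by (rule subgradient_at_monotone[OF dual_prox_subgradient[OF assms] dual_prox_subgradient[OF assms]])
  also have "\<dots> = (1 / \<sigma>) * ((P x - P y) \<bullet> (x - y) - (norm (P x - P y))\<^sup>2)"
    unfolding power2_norm_eq_inner by (simp add: inner_diff_right algebra_simps)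
  finally show ?thesis using assms(2) by (simp add: zero_le_divide_iff P_def)
qed

lemma firmly_nonexpansive_bounds:
  fixes P :: "'a::real_inner \<Rightarrow> 'a"
  assumes "\<And>x y. (norm (P x - P y))\<^sup>2 \<le> (P x - P y) \<bullet> (x - y)"
  shows "norm (P x - P y) \<le> norm (x - y)"
    and "0 * (norm (x - y))\<^sup>2 \<le> (P x - P y) \<bullet> (x - y)"
    and "(P x - P y) \<bullet> (x - y) \<le> 1 * (norm (x - y))\<^sup>2"
proof -
  have "norm (P x - P y) * norm (P x - P y) \<le> norm (P x - P y) * norm (x - y)"
    using order_trans[OF assms norm_cauchy_schwarz, of x y] by (simp add: power2_eq_square)
  then show *: "norm (P x - P y) \<le> norm (x - y)"
    by (cases "norm (P x - P y) = 0") auto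
  show "0 * (norm (x - y))\<^sup>2 \<le> (P x - P y) \<bullet> (x - y)"
    using assms[of x y] by (metis mult_zero_left order_trans zero_le_power2)
  have "(P x - P y) \<bullet> (x - y) \<le> norm (P x - P y) * norm (x - y)" by (rule norm_cauchy_schwarz)
  also have "\<dots> \<le> norm (x - y) * norm (x - y)" using * by (rule mult_right_mono) simp
  finally show "(P x - P y) \<bullet> (x - y) \<le> 1 * (norm (x - y))\<^sup>2" by (simp add: power2_eq_square)
qed

text \<open>The Moreau envelope \<open>min y. g y + \<sigma> / 2 \<cdot> (norm (u / \<sigma> - y))\<^sup>2\<close>, written through its minimiser
\<open>(u - dual_prox \<sigma> g u) / \<sigma>\<close> and parametrised by the dual point \<open>u\<close> rather than by \<open>u / \<sigma>\<close>. In this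
parametrisation \<open>\<sigma>\<close> times the envelope is a potential of the dual proximal map.\<close>

definition envelope :: "real \<Rightarrow> ('a::real_inner \<Rightarrow> ereal) \<Rightarrow> 'a \<Rightarrow> real" where
  "envelope \<sigma> g u = real_of_ereal (g ((1 / \<sigma>) *\<^sub>R (u - dual_prox \<sigma> g u)))
     + 1 / (2 * \<sigma>) * (norm (dual_prox \<sigma> g u))\<^sup>2"

lemma envelope_attained:
  fixes g :: "'a::euclidean_space \<Rightarrow> ereal"
  assumes "closed_proper_convex g" "\<sigma> > 0"
  shows "ereal (envelope \<sigma> g u) = g ((1 / \<sigma>) *\<^sub>R (u - dual_prox \<sigma> g u))
      + ereal (\<sigma> / 2 * (norm ((1 / \<sigma>) *\<^sub>R u - (1 / \<sigma>) *\<^sub>R (u - dual_prox \<sigma> g u)))\<^sup>2)"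
proof -
  have "\<bar>g ((1 / \<sigma>) *\<^sub>R (u - dual_prox \<sigma> g u))\<bar> \<noteq> \<infinity>"
    using dual_prox_subgradient[OF assms] by (simp add: subgradient_at_def)
  moreover have "(1 / \<sigma>) *\<^sub>R u - (1 / \<sigma>) *\<^sub>R (u - dual_prox \<sigma> g u) = (1 / \<sigma>) *\<^sub>R dual_prox \<sigma> g u"
    by (simp add: scaleR_diff_right)
  moreover have "\<sigma> / 2 * (norm ((1 / \<sigma>) *\<^sub>R dual_prox \<sigma> g u))\<^sup>2 = 1 / (2 * \<sigma>) * (norm (dual_prox \<sigma> g u))\<^sup>2"
    using assms(2) by (simp add: power_mult_distrib power_divide power2_eq_square)
  ultimately show ?thesis
    by (cases "g ((1 / \<sigma>) *\<^sub>R (u - dual_prox \<sigma> g u))") (auto simp: envelope_def)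
qed

lemma envelope_le:
  fixes g :: "'a::euclidean_space \<Rightarrow> ereal"
  assumes "closed_proper_convex g" "\<sigma> > 0"
  shows "ereal (envelope \<sigma> g u) \<le> g y + ereal (\<sigma> / 2 * (norm ((1 / \<sigma>) *\<^sub>R u - y))\<^sup>2)"
proof -
  define q where "q = dual_prox \<sigma> g u"
  define z where "z = (1 / \<sigma>) *\<^sub>R (u - q)"
  have sub: "subgradient_at g z q" using dual_prox_subgradient[OF assms, of u] by (simp add: q_def z_def)
  obtain r where r: "g z = ereal r"
    using sub unfolding subgradient_at_def by (metis abs_ereal.simps(2,3) ereal_cases)
  have "ereal (r + q \<bullet> (y - z)) \<le> g y"
    using sub r unfolding subgradient_at_def by (metis plus_ereal.simps(1))
  then have *: "ereal (r + q \<bullet> (y - z)) + ereal (\<sigma> / 2 * (norm ((1 / \<sigma>) *\<^sub>R u - y))\<^sup>2)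
      \<le> g y + ereal (\<sigma> / 2 * (norm ((1 / \<sigma>) *\<^sub>R u - y))\<^sup>2)"
    by (rule add_right_mono)
  have u: "(1 / \<sigma>) *\<^sub>R u = z + (1 / \<sigma>) *\<^sub>R q" by (simp add: z_def scaleR_diff_right)
  have "(norm (z + (1 / \<sigma>) *\<^sub>R q - y))\<^sup>2
      = (1 / \<sigma>)\<^sup>2 * (norm q)\<^sup>2 - 2 * (1 / \<sigma>) * (q \<bullet> (y - z)) + (norm (y - z))\<^sup>2"
    unfolding power2_norm_eq_inner
    by (simp add: inner_add_left inner_add_right inner_diff_left inner_diff_right inner_commute power2_eq_square algebra_simps)
  then have "\<sigma> / 2 * (norm (z + (1 / \<sigma>) *\<^sub>R q - y))\<^sup>2
      = 1 / (2 * \<sigma>) * (norm q)\<^sup>2 - q \<bullet> (y - z) + \<sigma> / 2 * (norm (y - z))\<^sup>2"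
    using assms(2) by (simp add: field_simps power2_eq_square)
  moreover have "0 \<le> \<sigma> / 2 * (norm (y - z))\<^sup>2" using assms(2) by simp
  moreover have "envelope \<sigma> g u = r + 1 / (2 * \<sigma>) * (norm q)\<^sup>2"
    by (simp add: envelope_def q_def[symmetric] z_def[symmetric] r)
  ultimately have "envelope \<sigma> g u \<le> r + q \<bullet> (y - z) + \<sigma> / 2 * (norm ((1 / \<sigma>) *\<^sub>R u - y))\<^sup>2"
    unfolding u by linarith
  with * show ?thesis by (metis ereal_less_eq(3) order_trans plus_ereal.simps(1))
qed

text \<open>Upper bound: use the minimiser for \<open>u\<close> as a competitor for \<open>v\<close>. Lower bound: exchange \<open>u\<close> and \<open>v\<close> and compare
the two slopes by monotonicity of the dual proximal map.\<close>

lemma envelope_quadratic_bound: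
  fixes g :: "'a::euclidean_space \<Rightarrow> ereal"
  assumes "closed_proper_convex g" "\<sigma> > 0"
  shows "\<bar>envelope \<sigma> g v - envelope \<sigma> g u - ((1 / \<sigma>) *\<^sub>R dual_prox \<sigma> g u) \<bullet> (v - u)\<bar>
      \<le> 1 / (2 * \<sigma>) * (norm (v - u))\<^sup>2"
proof -
  define P where "P = dual_prox \<sigma> g"
  have upper: "envelope \<sigma> g v \<le> envelope \<sigma> g u + (1 / \<sigma>) * (P u \<bullet> (v - u)) + 1 / (2 * \<sigma>) * (norm (v - u))\<^sup>2" for u v
  proof -
    define z where "z = (1 / \<sigma>) *\<^sub>R (u - P u)"
    have "\<bar>g z\<bar> \<noteq> \<infinity>"
      using dual_prox_subgradient[OF assms, of u] by (simp add: subgradient_at_def z_def P_def)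
    then obtain r where r: "g z = ereal r" by auto
    have "envelope \<sigma> g v \<le> r + \<sigma> / 2 * (norm ((1 / \<sigma>) *\<^sub>R v - z))\<^sup>2"
      using envelope_le[OF assms, of v z] by (simp add: r)
    also have "(1 / \<sigma>) *\<^sub>R v - z = (1 / \<sigma>) *\<^sub>R (P u + (v - u))" by (simp add: z_def algebra_simps)
    also have "\<sigma> / 2 * (norm ((1 / \<sigma>) *\<^sub>R (P u + (v - u))))\<^sup>2 = 1 / (2 * \<sigma>) * (norm (P u + (v - u)))\<^sup>2"
      using assms(2) by (simp add: power_mult_distrib power_divide power2_eq_square)
    also have "(norm (P u + (v - u)))\<^sup>2 = (norm (P u))\<^sup>2 + 2 * (P u \<bullet> (v - u)) + (norm (v - u))\<^sup>2"
      unfolding power2_norm_eq_inner by (simp add: inner_add_left inner_add_right inner_commute)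
    also have "r + 1 / (2 * \<sigma>) * \<dots> = (r + 1 / (2 * \<sigma>) * (norm (P u))\<^sup>2) + (1 / \<sigma>) * (P u \<bullet> (v - u)) + 1 / (2 * \<sigma>) * (norm (v - u))\<^sup>2"
      using assms(2) by (simp add: field_simps)
    finally show ?thesis by (simp add: envelope_def z_def[symmetric] P_def[symmetric] r)
  qed
  have "0 \<le> (P v - P u) \<bullet> (v - u)"
    using firmly_nonexpansive_bounds(2)[OF dual_prox_firmly_nonexpansive[OF assms]] by (simp add: P_def)
  then have "0 \<le> (1 / \<sigma>) * ((P v - P u) \<bullet> (v - u))" using assms(2) by simp
  also have "\<dots> = (1 / \<sigma>) * (P v \<bullet> (v - u)) - (1 / \<sigma>) * (P u \<bullet> (v - u))"
    by (simp add: inner_diff_left right_diff_distrib diff_divide_distrib)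
  finally have mon: "(1 / \<sigma>) * (P u \<bullet> (v - u)) \<le> (1 / \<sigma>) * (P v \<bullet> (v - u))" by simp
  have sw: "P v \<bullet> (u - v) = - (P v \<bullet> (v - u))" by (simp add: inner_diff_right)
  show ?thesis
    using upper[of v u] upper[of u v] mon
    by (simp add: abs_le_iff P_def[symmetric] norm_minus_commute[of u v] sw)
qed

lemma GDERIV_envelope:
  fixes g :: "'a::euclidean_space \<Rightarrow> ereal"
  assumes "closed_proper_convex g" "\<sigma> > 0"
  shows "GDERIV (envelope \<sigma> g) u :> (1 / \<sigma>) *\<^sub>R dual_prox \<sigma> g u"
  by (rule GDERIV_quadratic_bound[OF envelope_quadratic_bound[OF assms]])

section \<open>Strong semismoothness of the dual proximal map\<close>

lemma convex_combination_coercive: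
  fixes a n c :: real
  assumes "0 \<le> a" "a \<le> n" "c > 0"
  shows "min 1 c * n \<le> c * (n - a) + a"
proof -
  have "min 1 c * (n - a) \<le> c * (n - a)" "min 1 c * a \<le> 1 * a"
    using assms by (intro mult_right_mono; simp)+
  then show ?thesis by (simp add: right_diff_distrib)
qed

text \<open>On the graph of the subdifferential, a pair \<open>(p, q)\<close> is reached by \<open>dual_prox \<sigma> g\<close> from \<open>u = \<sigma> p + q\<close> and by
\<open>Prox g\<close> from \<open>w = p + q\<close>. The next two maps are the change of variables between \<open>u\<close> and \<open>w\<close>; they
carry the semismoothness of \<open>Prox g\<close>, with unit parameter, over to the parameter \<open>\<sigma>\<close>.\<close>

definition prox_shift :: "real \<Rightarrow> ('a::real_inner \<Rightarrow> ereal) \<Rightarrow> 'a \<Rightarrow> 'a" where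
  "prox_shift \<sigma> g u = (1 / \<sigma>) *\<^sub>R (u - dual_prox \<sigma> g u) + dual_prox \<sigma> g u"

lemma Prox_prox_shift:
  fixes g :: "'a::euclidean_space \<Rightarrow> ereal"
  assumes "closed_proper_convex g" "\<sigma> > 0"
  shows "Prox g (prox_shift \<sigma> g u) = (1 / \<sigma>) *\<^sub>R (u - dual_prox \<sigma> g u)"
  using dual_prox_subgradient[OF assms, of u] by (intro Prox_eqI) (simp add: prox_shift_def)

definition prox_unshift :: "real \<Rightarrow> ('a::real_inner \<Rightarrow> ereal) \<Rightarrow> 'a \<Rightarrow> 'a" where
  "prox_unshift \<sigma> g w = \<sigma> *\<^sub>R Prox g w + (w - Prox g w)"

lemma prox_unshift_shift:
  fixes g :: "'a::euclidean_space \<Rightarrow> ereal"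
  assumes "closed_proper_convex g" "\<sigma> > 0"
  shows "prox_unshift \<sigma> g (prox_shift \<sigma> g u) = u"
  using assms(2) unfolding prox_unshift_def Prox_prox_shift[OF assms]
  by (simp add: prox_shift_def)

lemma dual_prox_unshift:
  fixes g :: "'a::euclidean_space \<Rightarrow> ereal"
  assumes "closed_proper_convex g" "\<sigma> > 0"
  shows "dual_prox \<sigma> g (prox_unshift \<sigma> g w) = w - Prox g w"
  using subgradient_at_conjugate[OF Prox_subgradient[OF assms(1)] assms(2), of w]
  by (intro Prox_eqI) (simp add: prox_unshift_def)

lemma prox_shift_unshift:
  fixes g :: "'a::euclidean_space \<Rightarrow> ereal"
  assumes "closed_proper_convex g" "\<sigma> > 0"
  shows "prox_shift \<sigma> g (prox_unshift \<sigma> g w) = w"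
  using assms(2) unfolding prox_shift_def dual_prox_unshift[OF assms]
  by (simp add: prox_unshift_def)

lemma continuous_nonexpansive:
  fixes P :: "'a::real_normed_vector \<Rightarrow> 'b::real_normed_vector"
  assumes "\<And>x y. norm (P x - P y) \<le> norm (x - y)"
  shows "continuous_on UNIV P"
proof -
  have "1-lipschitz_on UNIV P" using assms by (intro lipschitz_onI) (auto simp: dist_norm)
  then show ?thesis by (rule lipschitz_on_continuous_on)
qed

text \<open>The derivative of \<open>prox_shift\<close> is a combination of the positive operators \<open>1 - H\<close> and \<open>H\<close>, with weights
\<open>1 / \<sigma>\<close> and 1, hence invertible uniformly in \<open>H\<close>. The same form reappears for the Jacobian of
\<open>Prox g\<close> when residuals are transferred.\<close>

lemma prox_shift_derivative_coercive:
  fixes H :: "'a::real_inner \<Rightarrow> 'a"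
  assumes "0 \<le> H h \<bullet> h" "H h \<bullet> h \<le> (norm h)\<^sup>2" "\<sigma> > 0"
  shows "min 1 (1 / \<sigma>) * (norm h)\<^sup>2 \<le> ((1 / \<sigma>) *\<^sub>R (h - H h) + H h) \<bullet> h"
proof -
  have "((1 / \<sigma>) *\<^sub>R (h - H h) + H h) \<bullet> h = 1 / \<sigma> * ((norm h)\<^sup>2 - H h \<bullet> h) + H h \<bullet> h"
    unfolding power2_norm_eq_inner by (simp add: inner_add_left inner_diff_left)
  then show ?thesis using convex_combination_coercive[OF assms(1,2), of "1 / \<sigma>"] assms(3) by simp
qed

text \<open>Differentiability moves from the dual proximal map to \<open>Prox g\<close> because the derivative of \<open>prox_shift\<close> is
invertible: its continuous inverse \<open>prox_unshift\<close> is then differentiable at the image point, and \<open>Prox g w\<close> is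
\<open>(T w - dual_prox \<sigma> g (T w)) / \<sigma>\<close> for this inverse \<open>T\<close>.\<close>

lemma Prox_jacobian_prox_shift:
  fixes g :: "real^'n::finite \<Rightarrow> ereal"
  assumes g: "closed_proper_convex g" and \<sigma>: "\<sigma> > 0"
    and diff: "dual_prox \<sigma> g differentiable (at s)"
  defines "H \<equiv> jacobian (dual_prox \<sigma> g) (at s)"
  shows "Prox g differentiable (at (prox_shift \<sigma> g s))"
    and "jacobian (Prox g) (at (prox_shift \<sigma> g s)) *v ((1 / \<sigma>) *\<^sub>R (h - H *v h) + H *v h)
        = (1 / \<sigma>) *\<^sub>R (h - H *v h)"
proof -
  define K where "K h = (1 / \<sigma>) *\<^sub>R (h - H *v h) + H *v h" for h
  have H: "(dual_prox \<sigma> g has_derivative (\<lambda>h. H *v h)) (at s)"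
    using diff unfolding H_def by (simp add: jacobian_works)
  note fne = firmly_nonexpansive_bounds[OF dual_prox_firmly_nonexpansive[OF g \<sigma>]]
  have coer: "min 1 (1 / \<sigma>) * (norm h)\<^sup>2 \<le> K h \<bullet> h" for h
    unfolding K_def using derivative_monotone_bounds(1)[OF H fne(2), of h] derivative_monotone_bounds(2)[OF H fne(3), of h]
    by (intro prox_shift_derivative_coercive \<sigma>) auto
  have K: "(prox_shift \<sigma> g has_derivative K) (at s)"
    unfolding prox_shift_def[abs_def] K_def[abs_def] using H
    by (auto intro!: derivative_eq_intros)
  then have "linear K" by (rule has_derivative_linear)
  moreover have "inj K"
  proof (rule linear_injective_0[OF \<open>linear K\<close>, THEN iffD2], intro allI impI)
    fix h assume "K h = 0"
    then have "min 1 (1 / \<sigma>) * (norm h)\<^sup>2 \<le> 0" using coer[of h] by simp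
    moreover have "min 1 (1 / \<sigma>) > 0" using \<sigma> by simp
    ultimately show "h = 0" by (simp add: mult_le_0_iff)
  qed
  ultimately obtain K' where K': "linear K'" "\<And>x. K' (K x) = x"
    using linear_injective_isomorphism by metis
  have "(prox_unshift \<sigma> g has_derivative K') (at (prox_shift \<sigma> g s))"
  proof (rule has_derivative_inverse_basic_x[OF K, where T = UNIV])
    show "bounded_linear K'" using K'(1) by (simp add: linear_conv_bounded_linear)
    show "K' \<circ> K = id" using K'(2) by auto
    have "continuous_on UNIV (Prox g)"
      by (intro continuous_nonexpansive firmly_nonexpansive_bounds(1) Prox_firmly_nonexpansive g)
    then have "continuous_on UNIV (prox_unshift \<sigma> g)"
      unfolding prox_unshift_def[abs_def] by (intro continuous_intros)
    then show "continuous (at (prox_shift \<sigma> g s)) (prox_unshift \<sigma> g)"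
      by (simp add: continuous_on_eq_continuous_at)
  qed (auto simp: prox_unshift_shift[OF g \<sigma>] prox_shift_unshift[OF g \<sigma>])
  note T = this
  have "((\<lambda>w. (1 / \<sigma>) *\<^sub>R (prox_unshift \<sigma> g w - dual_prox \<sigma> g (prox_unshift \<sigma> g w)))
      has_derivative (\<lambda>h. (1 / \<sigma>) *\<^sub>R (K' h - H *v K' h))) (at (prox_shift \<sigma> g s))"
    by (intro has_derivative_scaleR_right has_derivative_diff T has_derivative_compose[OF T])
      (simp add: prox_unshift_shift[OF g \<sigma>] H)
  moreover have "(\<lambda>w. (1 / \<sigma>) *\<^sub>R (prox_unshift \<sigma> g w - dual_prox \<sigma> g (prox_unshift \<sigma> g w))) = Prox g"
    unfolding dual_prox_unshift[OF g \<sigma>] using \<sigma> by (simp add: prox_unshift_def fun_eq_iff)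
  ultimately have R: "(Prox g has_derivative (\<lambda>h. (1 / \<sigma>) *\<^sub>R (K' h - H *v K' h))) (at (prox_shift \<sigma> g s))"
    by simp
  then show "Prox g differentiable (at (prox_shift \<sigma> g s))" by (auto simp: differentiable_def)
  then have "(\<lambda>h. jacobian (Prox g) (at (prox_shift \<sigma> g s)) *v h) = (\<lambda>h. (1 / \<sigma>) *\<^sub>R (K' h - H *v K' h))"
    using R has_derivative_unique unfolding jacobian_works by blast
  from fun_cong[OF this, of "K h"]
  show "jacobian (Prox g) (at (prox_shift \<sigma> g s)) *v ((1 / \<sigma>) *\<^sub>R (h - H *v h) + H *v h)
        = (1 / \<sigma>) *\<^sub>R (h - H *v h)"
    unfolding K'(2) unfolding K_def .
qed

lemma norm_matrix_le_of_nonexpansive: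
  fixes V :: "real^'n::finite^'n"
  assumes "\<And>h. norm (V *v h) \<le> norm h"
  shows "norm V \<le> real CARD('n) * real CARD('n)"
proof -
  have entry: "\<bar>V $ i $ j\<bar> \<le> 1" for i j
  proof -
    have "\<bar>V $ i $ j\<bar> = \<bar>(V *v axis j 1) $ i\<bar>" by (simp add: matrix_vector_mult_basis column_def)
    also have "\<dots> \<le> norm (axis j 1 :: real^'n)" using component_le_norm_cart assms order_trans by blast
    finally show ?thesis by simp
  qed
  have row: "norm (V $ i) \<le> real CARD('n)" for i
  proof -
    have "norm (V $ i) \<le> (\<Sum>j\<in>UNIV. \<bar>V $ i $ j\<bar>)" by (rule norm_le_l1_cart)
    also have "\<dots> \<le> (\<Sum>j\<in>(UNIV::'n set). 1)" by (intro sum_mono entry)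
    finally show ?thesis by simp
  qed
  have "norm V \<le> (\<Sum>i\<in>UNIV. norm (V $ i))" unfolding norm_vec_def by (rule L2_set_le_sum) simp
  also have "\<dots> \<le> (\<Sum>i\<in>(UNIV::'n set). real CARD('n))" by (intro sum_mono row)
  finally show ?thesis by simp
qed

text \<open>The Jacobians of \<open>Prox g\<close> along the shifted sequence are bounded, so a subsequence converges; the algebraic
relation between the two Jacobians survives in the limit.\<close>

lemma clarke_transfer:
  fixes g :: "real^'n::finite \<Rightarrow> ereal"
  assumes g: "closed_proper_convex g" and \<sigma>: "\<sigma> > 0"
    and s: "s \<longlonglongrightarrow> x" "\<And>k. dual_prox \<sigma> g differentiable (at (s k))"
      "(\<lambda>k. jacobian (dual_prox \<sigma> g) (at (s k))) \<longlonglongrightarrow> H"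
  obtains V where "V \<in> clarke (Prox g) (prox_shift \<sigma> g x)"
    "\<And>h. V *v ((1 / \<sigma>) *\<^sub>R (h - H *v h) + H *v h) = (1 / \<sigma>) *\<^sub>R (h - H *v h)"
proof -
  define J where "J k = jacobian (Prox g) (at (prox_shift \<sigma> g (s k)))" for k
  have Jd: "Prox g differentiable (at (prox_shift \<sigma> g (s k)))" for k
    by (rule Prox_jacobian_prox_shift(1)[OF g \<sigma> s(2)])
  have "norm (J k *v h) \<le> norm h" for k h
    unfolding J_def using Jd[unfolded jacobian_works]
    by (rule derivative_nonexpansive[OF _ firmly_nonexpansive_bounds(1)[OF Prox_firmly_nonexpansive[OF g]]])
  then have "norm (J k) \<le> real CARD('n) * real CARD('n)" for k
    by (rule norm_matrix_le_of_nonexpansive)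
  then have "bounded (range J)" by (auto simp: bounded_iff)
  then obtain V r where r: "strict_mono (r :: nat \<Rightarrow> nat)" "(J \<circ> r) \<longlonglongrightarrow> V"
    using bounded_imp_convergent_subsequence by blast
  have "continuous_on UNIV (dual_prox \<sigma> g)"
    by (intro continuous_nonexpansive firmly_nonexpansive_bounds(1) dual_prox_firmly_nonexpansive g \<sigma>)
  then have "continuous_on UNIV (prox_shift \<sigma> g)"
    unfolding prox_shift_def[abs_def] by (intro continuous_intros)
  then have "isCont (prox_shift \<sigma> g) x" by (simp add: continuous_on_eq_continuous_at)
  moreover have sr: "(\<lambda>k. s (r k)) \<longlonglongrightarrow> x"
    using LIMSEQ_subseq_LIMSEQ[OF s(1) r(1)] by (simp add: o_def)
  ultimately have "(\<lambda>k. prox_shift \<sigma> g (s (r k))) \<longlonglongrightarrow> prox_shift \<sigma> g x"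
    by (rule isCont_tendsto_compose)
  then have V: "V \<in> clarke (Prox g) (prox_shift \<sigma> g x)"
    unfolding clarke_def using r(2) Jd
    by (intro hull_inc CollectI exI[of _ "\<lambda>k. prox_shift \<sigma> g (s (r k))"]) (auto simp: J_def o_def)
  define Hr where "Hr k = jacobian (dual_prox \<sigma> g) (at (s (r k)))" for k
  have Hr: "Hr \<longlonglongrightarrow> H"
    using LIMSEQ_subseq_LIMSEQ[OF s(3) r(1)] by (simp add: o_def Hr_def[abs_def])
  have "V *v ((1 / \<sigma>) *\<^sub>R (h - H *v h) + H *v h) = (1 / \<sigma>) *\<^sub>R (h - H *v h)" for h
  proof -
    have "(\<lambda>k. (J \<circ> r) k *v ((1 / \<sigma>) *\<^sub>R (h - Hr k *v h) + Hr k *v h)) \<longlonglongrightarrow> V *v ((1 / \<sigma>) *\<^sub>R (h - H *v h) + H *v h)"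
      by (intro tendsto_matrix_vector_mult r tendsto_intros Hr)
    moreover have "(\<lambda>k. (J \<circ> r) k *v ((1 / \<sigma>) *\<^sub>R (h - Hr k *v h) + Hr k *v h)) = (\<lambda>k. (1 / \<sigma>) *\<^sub>R (h - Hr k *v h))"
      by (rule ext) (simp only: o_def J_def Hr_def Prox_jacobian_prox_shift(2)[OF g \<sigma> s(2)])
    moreover have "(\<lambda>k. (1 / \<sigma>) *\<^sub>R (h - Hr k *v h)) \<longlonglongrightarrow> (1 / \<sigma>) *\<^sub>R (h - H *v h)"
      by (intro tendsto_matrix_vector_mult tendsto_intros Hr)
    ultimately show ?thesis by (simp only: LIMSEQ_unique)
  qed
  with V show thesis by (rule that)
qed

text \<open>For increments along the graph, let \<open>\<delta> = dq - y\<close> be the linearisation error of the dual map (\<open>y\<close> stands for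
\<open>H k\<close>) and \<open>r\<close> that of \<open>Prox g\<close>. The relation between the Jacobians turns into
\<open>(\<delta> - V \<delta>) / \<sigma> + V \<delta> = - r\<close>, and the operator on the left is coercive.\<close>

lemma newton_residual_transfer:
  fixes V :: "real^'n::finite^'n"
  assumes \<sigma>: "\<sigma> > 0"
    and V: "0 \<le> (V *v (dq - y)) \<bullet> (dq - y)" "(V *v (dq - y)) \<bullet> (dq - y) \<le> (norm (dq - y))\<^sup>2"
    and VK: "V *v ((1 / \<sigma>) *\<^sub>R (k - y) + y) = (1 / \<sigma>) *\<^sub>R (k - y)"
    and e: "norm ((1 / \<sigma>) *\<^sub>R (k - dq) - V *v ((1 / \<sigma>) *\<^sub>R (k - dq) + dq)) \<le> \<epsilon>"
  shows "norm (dq - y) \<le> max 1 \<sigma> * \<epsilon>"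
proof -
  define \<delta> where "\<delta> = dq - y"
  define r where "r = (1 / \<sigma>) *\<^sub>R (k - dq) - V *v ((1 / \<sigma>) *\<^sub>R (k - dq) + dq)"
  have dq: "dq = y + \<delta>" by (simp add: \<delta>_def)
  have "(1 / \<sigma>) *\<^sub>R (k - dq) + dq = ((1 / \<sigma>) *\<^sub>R (k - y) + y) + (\<delta> - (1 / \<sigma>) *\<^sub>R \<delta>)"
    by (simp add: dq scaleR_diff_right scaleR_add_right)
  then have "V *v ((1 / \<sigma>) *\<^sub>R (k - dq) + dq)
      = V *v ((1 / \<sigma>) *\<^sub>R (k - y) + y) + V *v (\<delta> - (1 / \<sigma>) *\<^sub>R \<delta>)"
    by (simp only: matrix_vector_right_distrib)
  then have "V *v ((1 / \<sigma>) *\<^sub>R (k - dq) + dq) = (1 / \<sigma>) *\<^sub>R (k - y) + (V *v \<delta> - (1 / \<sigma>) *\<^sub>R (V *v \<delta>))"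
    by (simp only: VK) (simp add: matrix_vector_mult_diff_distrib matrix_vector_mult_scaleR)
  then have "- r = (1 / \<sigma>) *\<^sub>R (\<delta> - V *v \<delta>) + V *v \<delta>"
    by (simp add: r_def dq scaleR_diff_right scaleR_add_right)
  then have "min 1 (1 / \<sigma>) * (norm \<delta>)\<^sup>2 \<le> (- r) \<bullet> \<delta>"
    using prox_shift_derivative_coercive[of "\<lambda>h. V *v h" \<delta> \<sigma>] V[folded \<delta>_def] \<sigma> by simp
  also have "\<dots> \<le> norm r * norm \<delta>" using norm_cauchy_schwarz[of "- r" \<delta>] by simp
  also have "\<dots> \<le> \<epsilon> * norm \<delta>" using e by (simp add: r_def mult_right_mono)
  finally have "(min 1 (1 / \<sigma>) * norm \<delta>) * norm \<delta> \<le> \<epsilon> * norm \<delta>" by (simp add: power2_eq_square)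
  then have *: "min 1 (1 / \<sigma>) * norm \<delta> \<le> \<epsilon>"
    using order_trans[OF norm_ge_zero e] by (cases "\<delta> = 0") auto
  have "norm \<delta> = max 1 \<sigma> * (min 1 (1 / \<sigma>) * norm \<delta>)"
    using \<sigma> by (auto simp: max_def min_def field_simps)
  also have "\<dots> \<le> max 1 \<sigma> * \<epsilon>" using * by (intro mult_left_mono) auto
  finally show ?thesis by (simp add: \<delta>_def)
qed

text \<open>The bound for limiting Jacobians follows by transfer to \<open>Prox g\<close>; since \<open>prox_shift\<close> is Lipschitz, the transferred
increment is small and its square is of the right order. The bound extends to the convex hull because, for a fixed increment, the
admissible matrices form a convex set.\<close>

lemma dual_prox_semismooth_estimate:
  fixes g :: "real^'n::finite \<Rightarrow> ereal"
  assumes g: "closed_proper_convex g" and \<sigma>: "\<sigma> > 0"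
    and ss: "strongly_semismooth (Prox g)"
  shows "\<exists>C. \<forall>\<^sub>F k in nhds 0. \<forall>H \<in> clarke (dual_prox \<sigma> g) (u + k).
      norm (dual_prox \<sigma> g (u + k) - dual_prox \<sigma> g u - H *v k) \<le> C * (norm k)\<^sup>2"
proof -
  define P where "P = dual_prox \<sigma> g"
  define S where "S = prox_shift \<sigma> g"
  obtain C where C: "\<forall>\<^sub>F h in nhds 0. \<forall>V \<in> clarke (Prox g) (S u + h).
        norm (Prox g (S u + h) - Prox g (S u) - V *v h) \<le> C * (norm h)\<^sup>2"
    using ss unfolding strongly_semismooth_def strongly_semismooth_at_def by blast
  have ne: "norm (P x - P y) \<le> norm (x - y)" for x y
    unfolding P_def by (intro firmly_nonexpansive_bounds(1) dual_prox_firmly_nonexpansive g \<sigma>)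
  define M where "M = 2 / \<sigma> + 1"
  have S_diff: "S (u + k) - S u = (1 / \<sigma>) *\<^sub>R (k - (P (u + k) - P u)) + (P (u + k) - P u)" for k
    by (simp add: S_def P_def prox_shift_def scaleR_diff_right scaleR_add_right)
  have S_lip: "norm (S (u + k) - S u) \<le> M * norm k" for k
  proof -
    have q: "norm (P (u + k) - P u) \<le> norm k" using ne[of "u + k" u] by simp
    have "norm (S (u + k) - S u) \<le> (1 / \<sigma>) * norm (k - (P (u + k) - P u)) + norm (P (u + k) - P u)"
      unfolding S_diff by (rule order_trans[OF norm_triangle_ineq]) (use \<sigma> in simp)
    also have "\<dots> \<le> (1 / \<sigma>) * (2 * norm k) + norm k"
      using q \<sigma> norm_triangle_ineq4[of k "P (u + k) - P u"] by (intro add_mono mult_left_mono) auto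
    finally show ?thesis by (simp add: M_def algebra_simps)
  qed
  have "((\<lambda>k. S (u + k) - S u) \<longlongrightarrow> 0) (nhds 0)"
  proof (rule tendsto_0_le[where K = M])
    show "((\<lambda>k. k) \<longlongrightarrow> (0 :: real^'n)) (nhds 0)" by (rule filterlim_ident)
  qed (simp add: S_lip mult.commute)
  from filterlim_iff[THEN iffD1, OF this, rule_format, OF C]
  have ev: "\<forall>\<^sub>F k in nhds 0. \<forall>V \<in> clarke (Prox g) (S (u + k)).
      norm (Prox g (S (u + k)) - Prox g (S u) - V *v (S (u + k) - S u)) \<le> C * (norm (S (u + k) - S u))\<^sup>2"
    by simp
  have "\<forall>\<^sub>F k in nhds 0. \<forall>H \<in> clarke P (u + k).
      norm (P (u + k) - P u - H *v k) \<le> (max 1 \<sigma> * (\<bar>C\<bar> * M\<^sup>2)) * (norm k)\<^sup>2"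
    using ev
  proof eventually_elim
    case (elim k)
    let ?c = "(max 1 \<sigma> * (\<bar>C\<bar> * M\<^sup>2)) * (norm k)\<^sup>2"
    let ?S = "{H. norm (P (u + k) - P u - H *v k) \<le> ?c}"
    have "clarke P (u + k) \<subseteq> ?S"
      unfolding clarke_def
    proof (rule hull_minimal[where S = convex], clarify)
      fix H s assume s: "s \<longlonglongrightarrow> u + k" "\<forall>k. P differentiable (at (s k))"
        "(\<lambda>k. jacobian P (at (s k))) \<longlonglongrightarrow> H"
      obtain V where V: "V \<in> clarke (Prox g) (S (u + k))"
        "\<And>h. V *v ((1 / \<sigma>) *\<^sub>R (h - H *v h) + H *v h) = (1 / \<sigma>) *\<^sub>R (h - H *v h)"
        using clarke_transfer[OF g \<sigma> s(1) _ s(3)[unfolded P_def]] s(2) unfolding P_def S_def by blast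
      have Vb: "0 \<le> (V *v h) \<bullet> h" "(V *v h) \<bullet> h \<le> (norm h)\<^sup>2" for h
        using clarke_bounds[OF V(1), of 0 1 h] firmly_nonexpansive_bounds(2,3)[OF Prox_firmly_nonexpansive[OF g]]
        by auto
      have R: "Prox g (S (u + k)) - Prox g (S u) = (1 / \<sigma>) *\<^sub>R (k - (P (u + k) - P u))"
        by (simp add: S_def P_def Prox_prox_shift[OF g \<sigma>] scaleR_diff_right scaleR_add_right)
      have "norm (P (u + k) - P u - H *v k) \<le> max 1 \<sigma> * (C * (norm (S (u + k) - S u))\<^sup>2)"
      proof (rule newton_residual_transfer[OF \<sigma> Vb V(2)])
        show "norm ((1 / \<sigma>) *\<^sub>R (k - (P (u + k) - P u)) - V *v ((1 / \<sigma>) *\<^sub>R (k - (P (u + k) - P u)) + (P (u + k) - P u)))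
          \<le> C * (norm (S (u + k) - S u))\<^sup>2"
          using elim V(1) unfolding R by (metis S_diff)
      qed
      also have "\<dots> \<le> max 1 \<sigma> * (\<bar>C\<bar> * (M * norm k)\<^sup>2)"
        using S_lip[of k] by (intro mult_left_mono mult_mono power_mono) auto
      finally show "norm (P (u + k) - P u - H *v k) \<le> ?c" by (simp add: power_mult_distrib mult_ac)
    next
      show "convex ?S"
      proof (rule convexI, clarify)
        fix H1 H2 :: "real^'n^'n" and a b :: real
        assume H: "norm (P (u + k) - P u - H1 *v k) \<le> ?c" "norm (P (u + k) - P u - H2 *v k) \<le> ?c"
          and ab: "0 \<le> a" "0 \<le> b" "a + b = 1"
        have "z - (a *\<^sub>R H1 + b *\<^sub>R H2) *v k = a *\<^sub>R (z - H1 *v k) + b *\<^sub>R (z - H2 *v k)" for z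
        proof -
          have "z = a *\<^sub>R z + b *\<^sub>R z" using ab(3) by (metis scaleR_add_left scaleR_one)
          moreover have "a *\<^sub>R (z - H1 *v k) + b *\<^sub>R (z - H2 *v k) = (a *\<^sub>R z + b *\<^sub>R z) - (a *\<^sub>R H1 + b *\<^sub>R H2) *v k"
            by (simp add: matrix_vector_mult_add_rdistrib scaleR_matrix_vector_assoc[symmetric] scaleR_diff_right)
          ultimately show ?thesis by simp
        qed
        then have "norm (P (u + k) - P u - (a *\<^sub>R H1 + b *\<^sub>R H2) *v k)
            = norm (a *\<^sub>R (P (u + k) - P u - H1 *v k) + b *\<^sub>R (P (u + k) - P u - H2 *v k))" by simp
        also have "\<dots> \<le> a * ?c + b * ?c"
          by (rule order_trans[OF norm_triangle_ineq]) (use ab H in \<open>auto intro!: add_mono mult_left_mono\<close>)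
        also have "\<dots> = ?c" using ab(3) by (metis distrib_right mult_1)
        finally show "norm (P (u + k) - P u - (a *\<^sub>R H1 + b *\<^sub>R H2) *v k) \<le> ?c" .
      qed
    qed
    then show ?case by blast
  qed
  then show ?thesis unfolding P_def by blast
qed

section \<open>Accuracy of the accelerated inner loop\<close>

text \<open>The Lyapunov function of Nesterov's method with constant momentum for the quadratic form of \<open>M\<close>,
centred at its minimiser 0. The second term measures the auxiliary sequence of estimates,
expressed through the current iterate \<open>x\<close> and the previous one \<open>xp\<close>.\<close>

definition nesterov_energy :: "('a::real_inner \<Rightarrow> 'a) \<Rightarrow> real \<Rightarrow> real \<Rightarrow> 'a \<Rightarrow> 'a \<Rightarrow> real" where
  "nesterov_energy M \<mu> \<theta> x xp = 1 / 2 * (M x \<bullet> x) + \<mu> / 2 * (norm (x + (1 / \<theta> - 1) *\<^sub>R (x - xp)))\<^sup>2"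

lemma beta_const_eq:
  assumes "0 < \<mu>" "0 < L"
  shows "beta_const \<mu> L = (1 - sqrt (\<mu> / L)) / (1 + sqrt (\<mu> / L))"
proof -
  have *: "(l - m) / (l + m) = (1 - m / l) / (1 + m / l)" if "l > 0" for l m :: real
  proof -
    have "1 - m / l = (l - m) / l" "1 + m / l = (l + m) / l" using that by (simp_all add: field_simps)
    then show ?thesis using that by simp
  qed
  show ?thesis unfolding beta_const_def real_sqrt_divide by (rule *) (use assms in simp)
qed

lemma norm_convex_combination_sq:
  fixes x y :: "'a::real_inner"
  assumes "0 \<le> t" "t \<le> 1"
  shows "(norm ((1 - t) *\<^sub>R x + t *\<^sub>R y))\<^sup>2 \<le> (1 - t) * (norm x)\<^sup>2 + t * (norm y)\<^sup>2"
proof -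
  have "(1 - t) * (norm x)\<^sup>2 + t * (norm y)\<^sup>2 - (norm ((1 - t) *\<^sub>R x + t *\<^sub>R y))\<^sup>2 = t * (1 - t) * (norm (x - y))\<^sup>2"
    unfolding power2_norm_eq_inner
    by (simp add: inner_add_left inner_add_right inner_diff_left inner_diff_right inner_commute algebra_simps)
  moreover have "t * (1 - t) * (norm (x - y))\<^sup>2 \<ge> 0" using assms by simp
  ultimately show ?thesis by linarith
qed

text \<open>With \<open>z\<close> the auxiliary point belonging to \<open>(x, xp)\<close>, the momentum is chosen so that \<open>x = (1 + \<theta>) y - \<theta> z\<close>.
The decrease adds three facts at \<open>y\<close>: the descent of one gradient step, strong convexity towards the
minimiser (weight \<open>\<theta>\<close>) and convexity towards \<open>x\<close> (weight \<open>1 - \<theta>\<close>). The terms with the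
squared gradient cancel since \<open>\<theta>\<^sup>2 = \<mu> / L\<close>, and those with the gradient tested against \<open>y\<close> and \<open>z\<close> cancel
by the identity for \<open>x\<close>.\<close>

lemma nesterov_energy_decrease:
  fixes M :: "'a::real_inner \<Rightarrow> 'a"
  assumes lin: "linear M" and sym: "\<And>x y. M x \<bullet> y = M y \<bullet> x"
    and low: "\<And>x. \<mu> * (norm x)\<^sup>2 \<le> M x \<bullet> x" and up: "\<And>x. M x \<bullet> x \<le> L * (norm x)\<^sup>2"
    and \<mu>: "0 < \<mu>" "\<mu> \<le> L"
  defines "\<theta> \<equiv> sqrt (\<mu> / L)"
  assumes y: "y = x + beta_const \<mu> L *\<^sub>R (x - xp)" and xn: "xn = y - (1 / L) *\<^sub>R M y"
  shows "nesterov_energy M \<mu> \<theta> xn x \<le> (1 - \<theta>) * nesterov_energy M \<mu> \<theta> x xp"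
proof -
  interpret M: linear M by (rule lin)
  have L: "L > 0" using \<mu> by simp
  have \<theta>: "0 < \<theta>" "\<theta> \<le> 1" using \<mu> L by (auto simp: \<theta>_def)
  have \<theta>2: "\<theta> * \<theta> = \<mu> / L" using \<mu> L by (simp add: \<theta>_def)
  have \<theta>L: "1 / (\<theta> * L) = \<theta> / \<mu>" using \<theta> \<theta>2 L \<mu> by (simp add: field_simps)
  define z where "z = x + (1 / \<theta> - 1) *\<^sub>R (x - xp)"
  define zn where "zn = xn + (1 / \<theta> - 1) *\<^sub>R (xn - x)"
  define g where "g = M y"
  define c where "c = (1 - \<theta>) *\<^sub>R z + \<theta> *\<^sub>R y"
  have \<beta>: "(1 + \<theta>) * beta_const \<mu> L = 1 - \<theta>"
    using beta_const_eq[OF \<mu>(1) L] \<theta> by (simp add: \<theta>_def[symmetric])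
  have "(1 + \<theta>) *\<^sub>R y = (1 + \<theta>) *\<^sub>R x + (1 - \<theta>) *\<^sub>R (x - xp)"
    unfolding y scaleR_add_right scaleR_scaleR \<beta> by simp
  moreover have "\<theta> *\<^sub>R z = \<theta> *\<^sub>R x + (\<theta> * (1 / \<theta> - 1)) *\<^sub>R (x - xp)"
    unfolding z_def scaleR_add_right scaleR_scaleR by simp
  moreover have "\<theta> * (1 / \<theta> - 1) = 1 - \<theta>" using \<theta> by (simp add: field_simps)
  ultimately have x_eq: "x = (1 + \<theta>) *\<^sub>R y - \<theta> *\<^sub>R z" by (simp add: scaleR_add_left)
  have "\<theta> *\<^sub>R zn = xn - (1 - \<theta>) *\<^sub>R x"
  proof -
    have "\<theta> *\<^sub>R zn = \<theta> *\<^sub>R xn + (\<theta> * (1 / \<theta> - 1)) *\<^sub>R (xn - x)"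
      unfolding zn_def scaleR_add_right scaleR_scaleR by simp
    then show ?thesis using \<open>\<theta> * (1 / \<theta> - 1) = 1 - \<theta>\<close> by (simp add: algebra_simps)
  qed
  also have "\<dots> = \<theta> *\<^sub>R c - (1 / L) *\<^sub>R g"
    unfolding c_def xn x_eq g_def by (simp add: algebra_simps)
  also have "\<dots> = \<theta> *\<^sub>R (c - (1 / (\<theta> * L)) *\<^sub>R g)" using \<theta> by (simp add: scaleR_diff_right)
  finally have zn_eq: "zn = c - (\<theta> / \<mu>) *\<^sub>R g" using \<theta> \<theta>L by simp
  have descent: "1 / 2 * (M xn \<bullet> xn) \<le> 1 / 2 * (g \<bullet> y) - 1 / (2 * L) * (norm g)\<^sup>2"
  proof -
    have "M xn \<bullet> xn = g \<bullet> y - 2 / L * (norm g)\<^sup>2 + (1 / L)\<^sup>2 * (M g \<bullet> g)"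
      unfolding xn g_def[symmetric] power2_norm_eq_inner
      by (simp add: M.diff M.scaleR inner_diff_left inner_diff_right g_def[symmetric] sym[of g y] power2_eq_square algebra_simps)
    also have "(1 / L)\<^sup>2 * (M g \<bullet> g) \<le> (1 / L)\<^sup>2 * (L * (norm g)\<^sup>2)" by (intro mult_left_mono up) simp
    also have "(1 / L)\<^sup>2 * (L * (norm g)\<^sup>2) = 1 / L * (norm g)\<^sup>2" using L by (simp add: power2_eq_square)
    finally show ?thesis by simp
  qed
  have zn_norm: "\<mu> / 2 * (norm zn)\<^sup>2 = \<mu> / 2 * (norm c)\<^sup>2 - \<theta> * (g \<bullet> c) + 1 / (2 * L) * (norm g)\<^sup>2"
  proof -
    have "(norm zn)\<^sup>2 = (norm c)\<^sup>2 - 2 * (\<theta> / \<mu>) * (g \<bullet> c) + (\<theta> * \<theta>) / (\<mu> * \<mu>) * (norm g)\<^sup>2"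
      unfolding zn_eq power2_norm_eq_inner
      by (simp add: inner_diff_left inner_diff_right inner_commute algebra_simps)
    then show ?thesis using \<mu> L unfolding \<theta>2 by (simp add: field_simps)
  qed
  have c_norm: "(norm c)\<^sup>2 \<le> (1 - \<theta>) * (norm z)\<^sup>2 + \<theta> * (norm y)\<^sup>2"
    unfolding c_def using \<theta> by (intro norm_convex_combination_sq) auto
  have conv: "(1 - \<theta>) * (1 / 2 * (g \<bullet> y) + \<theta> * (g \<bullet> (y - z))) \<le> (1 - \<theta>) * (1 / 2 * (M x \<bullet> x))"
  proof (rule mult_left_mono)
    have "0 \<le> \<mu> * (norm (x - y))\<^sup>2" using \<mu> by simp
    then have "0 \<le> M (x - y) \<bullet> (x - y)" using low[of "x - y"] by linarith
    then have "0 \<le> M x \<bullet> x - 2 * (g \<bullet> x) + g \<bullet> y"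
      by (simp add: M.diff inner_diff_left inner_diff_right g_def sym[of x y])
    moreover have "g \<bullet> x = g \<bullet> y + \<theta> * (g \<bullet> (y - z))"
      by (subst x_eq) (simp add: inner_diff_right inner_add_right algebra_simps)
    ultimately show "1 / 2 * (g \<bullet> y) + \<theta> * (g \<bullet> (y - z)) \<le> 1 / 2 * (M x \<bullet> x)" by simp
  qed (use \<theta> in simp)
  have strong: "\<theta> / 2 * (\<mu> * (norm y)\<^sup>2) \<le> \<theta> / 2 * (g \<bullet> y)"
    using low[of y] \<theta> unfolding g_def by (intro mult_left_mono) auto
  have gc: "g \<bullet> c = (1 - \<theta>) * (g \<bullet> z) + \<theta> * (g \<bullet> y)" by (simp add: c_def inner_add_right)
  have "\<mu> / 2 * (norm c)\<^sup>2 \<le> \<mu> / 2 * ((1 - \<theta>) * (norm z)\<^sup>2 + \<theta> * (norm y)\<^sup>2)"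
    using c_norm \<mu> by (intro mult_left_mono) auto
  then have "1 / 2 * (M xn \<bullet> xn) + \<mu> / 2 * (norm zn)\<^sup>2
     \<le> 1 / 2 * (g \<bullet> y) + \<mu> / 2 * ((1 - \<theta>) * (norm z)\<^sup>2 + \<theta> * (norm y)\<^sup>2) - \<theta> * (g \<bullet> c)"
    using descent zn_norm by linarith
  also have "\<dots> \<le> (1 - \<theta>) * (1 / 2 * (M x \<bullet> x)) + (1 - \<theta>) * (\<mu> / 2 * (norm z)\<^sup>2)"
    using conv strong unfolding gc inner_diff_right by (simp add: field_simps)
  finally show ?thesis
    unfolding nesterov_energy_def z_def[symmetric] zn_def[symmetric] by (simp add: algebra_simps)
qed

lemma N_iter_contraction:
  assumes \<mu>: "0 < \<mu>" "\<mu> < L" and \<eta>: "\<eta> > 0" and n: "real_of_int (N_iter \<mu> L \<eta>) \<le> real n"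
  shows "2 * L / \<mu> * (1 - sqrt (\<mu> / L)) ^ n \<le> \<eta>\<^sup>2"
proof -
  define \<rho> where "\<rho> = 1 - sqrt (\<mu> / L)"
  define X where "X = 1 / \<eta> * sqrt (2 * L / \<mu>)"
  have \<rho>: "0 < \<rho>" "\<rho> < 1" using \<mu> by (auto simp: \<rho>_def)
  have X: "X > 0" using \<mu> \<eta> by (simp add: X_def)
  have l: "ln (1 / \<rho>) > 0" "ln (1 / \<rho>) = - ln \<rho>" using \<rho> by (auto simp: ln_div)
  have "2 * ln X / ln (1 / \<rho>) \<le> real n"
    using n unfolding N_iter_def X_def[symmetric] \<rho>_def[symmetric] by linarith
  then have "2 * ln X \<le> real n * ln (1 / \<rho>)" using l(1) by (simp add: field_simps)
  then have "2 * ln X \<le> - (real n * ln \<rho>)" by (simp add: l(2))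
  then have "real n * ln \<rho> \<le> - ln (X\<^sup>2)" using X by (simp add: ln_realpow)
  then have "exp (real n * ln \<rho>) \<le> exp (- ln (X\<^sup>2))" by simp
  moreover have "exp (real n * ln \<rho>) = \<rho> ^ n" using \<rho> by (simp add: exp_of_nat_mult)
  ultimately have "\<rho> ^ n \<le> 1 / X\<^sup>2" using X by (simp add: exp_minus inverse_eq_divide)
  then have "2 * L / \<mu> * \<rho> ^ n \<le> 2 * L / \<mu> * (1 / X\<^sup>2)" using \<mu> by (intro mult_left_mono) auto
  also have "X\<^sup>2 = (2 * L / \<mu>) / \<eta>\<^sup>2" using \<mu> by (simp add: X_def power_mult_distrib power_divide)
  also have "2 * L / \<mu> * (1 / (2 * L / \<mu> / \<eta>\<^sup>2)) = \<eta>\<^sup>2" using \<mu> by simp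
  finally show ?thesis by (simp add: \<rho>_def)
qed

text \<open>Subtracting the solution \<open>ds\<close> makes the recursion homogeneous, so the energy contracts by \<open>1 - \<theta>\<close> in every
step. It starts below \<open>L \<cdot> (norm ds)\<^sup>2\<close>, as the loop starts at rest in 0, and \<open>N_iter\<close> is the number of
contractions that leaves the fraction \<open>\<eta>\<^sup>2\<close> of the squared distance.\<close>

lemma nesterov_inner_accuracy:
  fixes M :: "'a::real_inner \<Rightarrow> 'a" and d :: "int \<Rightarrow> 'a"
  assumes lin: "linear M" and sym: "\<And>x y. M x \<bullet> y = M y \<bullet> x"
    and low: "\<And>x. \<mu> * (norm x)\<^sup>2 \<le> M x \<bullet> x" and up: "\<And>x. M x \<bullet> x \<le> L * (norm x)\<^sup>2"
    and \<mu>: "0 < \<mu>" "\<mu> < L" and \<eta>: "\<eta> > 0"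
    and d0: "\<And>j. j \<le> 0 \<Longrightarrow> d j = 0"
    and step: "\<And>j. 0 \<le> j \<Longrightarrow> j \<le> N_iter \<mu> L \<eta> \<Longrightarrow>
       d (j + 1) = (d j + beta_const \<mu> L *\<^sub>R (d j - d (j - 1)))
          - (1 / L) *\<^sub>R (M (d j + beta_const \<mu> L *\<^sub>R (d j - d (j - 1))) + c)"
    and sol: "M ds + c = 0"
  shows "norm (d (N_iter \<mu> L \<eta> + 1) - ds) \<le> \<eta> * norm ds"
proof -
  interpret M: linear M by (rule lin)
  define N where "N = N_iter \<mu> L \<eta>"
  define \<theta> where "\<theta> = sqrt (\<mu> / L)"
  define \<epsilon> where "\<epsilon> j = d j - ds" for j
  have \<theta>: "0 < \<theta>" "\<theta> < 1" using \<mu> by (auto simp: \<theta>_def)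
  have rec: "nesterov_energy M \<mu> \<theta> (\<epsilon> (j + 1)) (\<epsilon> j) \<le> (1 - \<theta>) * nesterov_energy M \<mu> \<theta> (\<epsilon> j) (\<epsilon> (j - 1))"
    if j: "0 \<le> j" "j \<le> N" for j
    unfolding \<theta>_def
  proof (rule nesterov_energy_decrease[OF lin sym low up])
    let ?y = "\<epsilon> j + beta_const \<mu> L *\<^sub>R (\<epsilon> j - \<epsilon> (j - 1))"
    have y: "d j + beta_const \<mu> L *\<^sub>R (d j - d (j - 1)) = ?y + ds" by (simp add: \<epsilon>_def)
    have "M (?y + ds) + c = M ?y" using sol by (simp only: M.add add.assoc) simp
    then show "\<epsilon> (j + 1) = ?y - (1 / L) *\<^sub>R M ?y"
      unfolding \<epsilon>_def[of "j + 1"] step[OF j[unfolded N_def]] y by simp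
  qed (use \<mu> in auto)
  have E: "nesterov_energy M \<mu> \<theta> (\<epsilon> (int k)) (\<epsilon> (int k - 1)) \<le> (1 - \<theta>) ^ k * (L * (norm ds)\<^sup>2)"
    if "int k \<le> max 0 (N + 1)" for k
    using that
  proof (induction k)
    case 0
    have "M (- ds) \<bullet> (- ds) \<le> L * (norm ds)\<^sup>2" using up[of "- ds"] by simp
    moreover have "\<mu> * (norm ds)\<^sup>2 \<le> L * (norm ds)\<^sup>2" using \<mu> by (intro mult_right_mono) auto
    ultimately show ?case by (simp add: nesterov_energy_def \<epsilon>_def d0)
  next
    case (Suc k)
    then have k: "int k \<le> N" by simp
    have "nesterov_energy M \<mu> \<theta> (\<epsilon> (int k + 1)) (\<epsilon> (int k)) \<le> (1 - \<theta>) * nesterov_energy M \<mu> \<theta> (\<epsilon> (int k)) (\<epsilon> (int k - 1))"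
      using k by (intro rec) auto
    also have "\<dots> \<le> (1 - \<theta>) * ((1 - \<theta>) ^ k * (L * (norm ds)\<^sup>2))"
      using Suc k \<theta> by (intro mult_left_mono) auto
    finally show ?case by (simp add: mult.assoc add.commute)
  qed
  \<comment> \<open>If \<open>N + 1\<close> is negative, the output is still the initial value 0, which is the case \<open>n = 0\<close>.\<close>
  define n where "n = nat (N + 1)"
  have dn: "\<epsilon> (N + 1) = \<epsilon> (int n)" by (cases "N + 1 \<le> 0") (simp_all add: n_def \<epsilon>_def d0)
  have "\<mu> / 2 * (norm (\<epsilon> (int n)))\<^sup>2 \<le> nesterov_energy M \<mu> \<theta> (\<epsilon> (int n)) (\<epsilon> (int n - 1))"
    using low[of "\<epsilon> (int n)"] \<mu> unfolding nesterov_energy_def by (intro add_increasing2) auto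
  also have "\<dots> \<le> (1 - \<theta>) ^ n * (L * (norm ds)\<^sup>2)" by (rule E) (simp add: n_def)
  finally have "(norm (\<epsilon> (int n)))\<^sup>2 \<le> (2 * L / \<mu> * (1 - \<theta>) ^ n) * (norm ds)\<^sup>2"
    using \<mu> by (simp add: field_simps)
  also have "\<dots> \<le> \<eta>\<^sup>2 * (norm ds)\<^sup>2"
  proof (rule mult_right_mono)
    have "real_of_int N \<le> real n" by (simp add: n_def)
    then show "2 * L / \<mu> * (1 - \<theta>) ^ n \<le> \<eta>\<^sup>2"
      unfolding \<theta>_def using N_iter_contraction[OF \<mu> \<eta>] by (simp add: N_def)
  qed simp
  finally have "(norm (\<epsilon> (int n)))\<^sup>2 \<le> (\<eta> * norm ds)\<^sup>2" by (simp add: power_mult_distrib)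
  then have "norm (\<epsilon> (int n)) \<le> \<eta> * norm ds" using \<eta> by (simp add: power2_le_iff_abs_le)
  then show ?thesis using dn by (simp add: \<epsilon>_def N_def)
qed

section \<open>Local convergence of inexact Newton iterations\<close>

text \<open>Once \<open>D \<cdot> \<eta> t\<close> is below 1/4, the errors halve as long as they are small. Before that time \<open>T\<close> the tolerance may be
large and the error may grow, but at most by the factor \<open>Q\<close> per step; starting within \<open>\<delta>1 / Q ^ T\<close>
compensates for these finitely many steps. The radius therefore depends on the tolerance sequence.\<close>

lemma inexact_newton_local_convergence:
  fixes a :: "'a::real_normed_vector" and \<eta> :: "nat \<Rightarrow> real"
  assumes \<delta>0: "\<delta>0 > 0" and C: "C \<ge> 0" "D \<ge> 0" and \<eta>: "\<And>t. \<eta> t > 0" "\<eta> \<longlonglongrightarrow> 0"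
  shows "\<exists>\<delta>>0. \<forall>x. x 0 \<in> ball a \<delta> \<and>
      (\<forall>t. norm (x t - a) < \<delta>0 \<longrightarrow> norm (x (Suc t) - a) \<le> (C * norm (x t - a) + D * \<eta> t) * norm (x t - a)) \<longrightarrow>
      converges_superlinearly x a \<and> (\<forall>t. norm (x t - a) < \<delta>0)"
proof -
  obtain B where B: "\<And>t. \<eta> t \<le> B"
    using convergent_imp_Bseq[of \<eta>] \<eta>(2) by (force simp: convergent_def Bseq_def abs_le_iff)
  have B0: "B \<ge> 0" using B[of 0] \<eta>(1)[of 0] by simp
  define Q where "Q = max 1 (C * \<delta>0 + D * B)"
  have Q: "Q \<ge> 1" by (simp add: Q_def)
  define \<delta>1 where "\<delta>1 = min \<delta>0 (1 / (4 * (C + 1)))"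
  have \<delta>1: "\<delta>1 > 0" "\<delta>1 \<le> \<delta>0" using \<delta>0 C by (auto simp: \<delta>1_def)
  have C\<delta>: "C * r \<le> 1 / 4" if "r \<le> \<delta>1" "0 \<le> r" for r
  proof -
    have "C * r \<le> (C + 1) * (1 / (4 * (C + 1)))" using that C by (intro mult_mono) (auto simp: \<delta>1_def)
    also have "\<dots> = 1 / 4" using C by (simp add: divide_simps)
    finally show ?thesis .
  qed
  have "(\<lambda>t. D * \<eta> t) \<longlonglongrightarrow> D * 0" by (intro tendsto_mult tendsto_const \<eta>)
  then have D\<eta>: "(\<lambda>t. D * \<eta> t) \<longlonglongrightarrow> 0" by simp
  then have "\<forall>\<^sub>F t in sequentially. D * \<eta> t < 1 / 4" by (rule order_tendstoD) simp
  then obtain T where T: "\<And>t. t \<ge> T \<Longrightarrow> D * \<eta> t < 1 / 4" by (auto simp: eventually_sequentially)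
  define \<delta> where "\<delta> = \<delta>1 / Q ^ T"
  have Qt: "Q ^ t \<ge> 1" for t using Q by simp
  have "\<delta> > 0" using \<delta>1 Q by (simp add: \<delta>_def)
  moreover have "converges_superlinearly x a \<and> (\<forall>t. norm (x t - a) < \<delta>0)"
    if x0: "x 0 \<in> ball a \<delta>" and step: "\<And>t. norm (x t - a) < \<delta>0 \<Longrightarrow>
      norm (x (Suc t) - a) \<le> (C * norm (x t - a) + D * \<eta> t) * norm (x t - a)" for x :: "nat \<Rightarrow> 'a"
  proof -
    define r where "r t = norm (x t - a)" for t
    have r0: "r t \<ge> 0" for t by (simp add: r_def)
    have st: "r (Suc t) \<le> (C * r t + D * \<eta> t) * r t" if "r t < \<delta>0" for t
      using step[of t] that by (simp add: r_def)
    have rs: "r 0 < \<delta>" using x0 by (simp add: r_def dist_norm norm_minus_commute)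
    have early: "r t \<le> Q ^ t * r 0" if "t \<le> T" for t
      using that
    proof (induction t)
      case (Suc t)
      have "r t \<le> Q ^ t * r 0" using Suc by simp
      also have "\<dots> \<le> Q ^ T * r 0" using Suc.prems Q r0 by (intro mult_right_mono power_increasing) auto
      also have "\<dots> < Q ^ T * \<delta>" using rs Q by (intro mult_strict_left_mono) auto
      also have "\<dots> = \<delta>1" using Q by (simp add: \<delta>_def)
      finally have small: "r t < \<delta>0" using \<delta>1 by simp
      have "r (Suc t) \<le> (C * r t + D * \<eta> t) * r t" by (rule st[OF small])
      also have "\<dots> \<le> Q * r t"
      proof (rule mult_right_mono)
        have "C * r t + D * \<eta> t \<le> C * \<delta>0 + D * B" using small B C by (intro add_mono mult_left_mono) auto
        then show "C * r t + D * \<eta> t \<le> Q" by (simp add: Q_def)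
      qed (rule r0)
      also have "\<dots> \<le> Q * (Q ^ t * r 0)" using Suc Q by (intro mult_left_mono) auto
      finally show ?case by (simp add: mult.assoc)
    qed simp
    have early_small: "r t < \<delta>1" if "t \<le> T" for t
    proof -
      have "r t \<le> Q ^ t * r 0" by (rule early[OF that])
      also have "\<dots> \<le> Q ^ T * r 0" using that Q r0 by (intro mult_right_mono power_increasing) auto
      also have "\<dots> < Q ^ T * \<delta>" using rs Q by (intro mult_strict_left_mono) auto
      also have "\<dots> = \<delta>1" using Q by (simp add: \<delta>_def)
      finally show ?thesis .
    qed
    have halve: "r (Suc t) \<le> 1 / 2 * r t" if "t \<ge> T" "r t < \<delta>1" for t
    proof -
      have "r (Suc t) \<le> (C * r t + D * \<eta> t) * r t" using that \<delta>1 by (intro st) auto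
      also have "\<dots> \<le> 1 / 2 * r t"
        using C\<delta>[of "r t"] T[of t] that r0[of t] by (intro mult_right_mono) auto
      finally show ?thesis .
    qed
    have late: "r (T + k) < \<delta>1 \<and> r (T + k) \<le> (1 / 2) ^ k * r T" for k
    proof (induction k)
      case 0 then show ?case using early_small by simp
    next
      case (Suc k)
      then have h: "r (T + Suc k) \<le> 1 / 2 * r (T + k)" using halve[of "T + k"] by simp
      with Suc r0[of "T + k"] have "r (T + Suc k) < \<delta>1" by linarith
      moreover have "r (T + Suc k) \<le> (1 / 2) ^ Suc k * r T" using h Suc by simp
      ultimately show ?case by simp
    qed
    have small: "r t < \<delta>1" for t
      using early_small[of t] late[of "t - T"] by (cases "t \<le> T") auto
    have "(\<lambda>k. (1 / 2) ^ k * r T) \<longlonglongrightarrow> 0 * r T"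
      by (rule tendsto_mult[OF LIMSEQ_realpow_zero tendsto_const]) simp_all
    then have geo: "(\<lambda>k. (1 / 2) ^ k * r T) \<longlonglongrightarrow> 0" by simp
    have "(\<lambda>k. r (T + k)) \<longlonglongrightarrow> 0"
    proof (rule Lim_null_comparison[OF _ geo])
      show "\<forall>\<^sub>F k in sequentially. norm (r (T + k)) \<le> (1 / 2) ^ k * r T" using late r0 by simp
    qed
    then have "r \<longlonglongrightarrow> 0" by (subst (asm) add.commute) (rule LIMSEQ_offset)
    then have lim: "x \<longlonglongrightarrow> a" unfolding r_def by (simp add: LIM_zero_iff tendsto_norm_zero_iff)
    have "(\<lambda>t. C * r t + D * \<eta> t) \<longlonglongrightarrow> C * 0 + D * 0"
      by (intro tendsto_intros \<open>r \<longlonglongrightarrow> 0\<close> \<eta>)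
    then have fac: "(\<lambda>t. C * r t + D * \<eta> t) \<longlonglongrightarrow> 0" by simp
    have "(\<lambda>t. r (Suc t)) \<in> o(r)"
    proof (rule landau_o.smallI)
      fix c :: real assume "c > 0"
      with fac have "\<forall>\<^sub>F t in sequentially. C * r t + D * \<eta> t < c" by (intro order_tendstoD)
      then show "\<forall>\<^sub>F t in sequentially. norm (r (Suc t)) \<le> c * norm (r t)"
      proof eventually_elim
        case (elim t)
        have "r (Suc t) \<le> (C * r t + D * \<eta> t) * r t" using small[of t] \<delta>1 by (intro st) auto
        also have "\<dots> \<le> c * r t" using elim r0 by (intro mult_right_mono) auto
        finally show ?case using r0 by simp
      qed
    qed
    then have "converges_superlinearly x a"
      using lim unfolding converges_superlinearly_def r_def by (intro conjI)
    moreover have "norm (x t - a) < \<delta>0" for t using small[of t] \<delta>1(2) unfolding r_def by linarith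
    ultimately show ?thesis by blast
  qed
  ultimately show ?thesis by blast
qed

section \<open>Block vectors and the gossip matrix\<close>

definition unblock :: "('b::finite \<Rightarrow> real^'n::finite) \<Rightarrow> real^('b \<times> 'n)" where
  "unblock v = (\<chi> p. v (fst p) $ snd p)"

lemma block_unblock [simp]: "block (unblock v) i = v i"
  by (simp add: block_def unblock_def)

lemma block_linear_simps [simp]:
  "block (x + y) i = block x i + block y i"
  "block (x - y) i = block x i - block y i"
  "block (c *\<^sub>R x) i = c *\<^sub>R block x i"
  "block 0 i = 0"
  by (simp_all add: block_def vec_eq_iff)

lemma linear_block: "linear (\<lambda>x. block x i)"
  by (rule linearI) simp_all

lemma block_eqI: "(\<And>i. block x i = block y i) \<Longrightarrow> x = y"
  by (auto simp: block_def vec_eq_iff)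

lemma inner_block: "x \<bullet> y = (\<Sum>i\<in>UNIV. block x i \<bullet> block y i)"
  by (simp add: inner_vec_def block_def sum.cartesian_product UNIV_Times_UNIV[symmetric] del: UNIV_Times_UNIV)

lemma norm_block_sq: "(norm x)\<^sup>2 = (\<Sum>i\<in>UNIV. (norm (block x i))\<^sup>2)"
  by (simp add: power2_norm_eq_inner inner_block)

lemma norm_block_le: "norm (block x i) \<le> norm x"
proof -
  have "(norm (block x i))\<^sup>2 \<le> (norm x)\<^sup>2"
    unfolding norm_block_sq by (rule member_le_sum) auto
  then show ?thesis by (rule power2_le_imp_le) simp
qed

lemma norm_le_sum_block: "norm x \<le> (\<Sum>i\<in>UNIV. norm (block x i))"
proof -
  have "norm x = L2_set (\<lambda>i. norm (block x i)) UNIV"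
    by (simp add: L2_set_def norm_block_sq[symmetric])
  also have "\<dots> \<le> (\<Sum>i\<in>UNIV. norm (block x i))" by (rule L2_set_le_sum) simp
  finally show ?thesis .
qed

lemma sum_UNIV_Plus:
  fixes h :: "'a::finite + 'b::finite \<Rightarrow> 'c::comm_monoid_add"
  shows "sum h UNIV = (\<Sum>i\<in>UNIV. h (Inl i)) + (\<Sum>i\<in>UNIV. h (Inr i))"
  unfolding UNIV_Plus_UNIV[symmetric] by (subst sum.Plus) (auto simp: o_def)

lemma norm_matrix_vector_le:
  fixes B :: "real^'a::finite^'b::finite"
  shows "norm (B *v x) \<le> norm B * norm x"
proof -
  have "norm (B *v x) \<le> L2_set (\<lambda>r. norm (B $ r) * norm x) UNIV"
    unfolding norm_vec_def[of "B *v x"]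
  proof (rule L2_set_mono)
    show "norm ((B *v x) $ r) \<le> norm (B $ r) * norm x" for r
      by (simp add: matrix_vector_mul_component Cauchy_Schwarz_ineq2)
  qed simp
  also have "\<dots> = norm B * norm x"
    by (simp add: L2_set_left_distrib[symmetric] norm_vec_def[of B])
  finally show ?thesis .
qed

definition gossip :: "real^'m^'m \<Rightarrow> ('m::finite \<Rightarrow> real^'n) \<Rightarrow> 'm \<Rightarrow> real^'n" where
  "gossip A v i = (\<Sum>k\<in>UNIV. A $ i $ k *\<^sub>R v k)"

lemma gossip_linear_simps:
  "gossip A (\<lambda>k. v k + w k) i = gossip A v i + gossip A w i"
  "gossip A (\<lambda>k. v k - w k) i = gossip A v i - gossip A w i"
  "gossip A (\<lambda>k. c *\<^sub>R v k) i = c *\<^sub>R gossip A v i"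
  by (simp_all add: gossip_def sum.distrib sum_subtractf scaleR_add_right scaleR_diff_right
      scaleR_sum_right mult.commute)

lemma sum_neighbours_eq_gossip:
  assumes "gossip_matrix E A"
  shows "(\<Sum>k\<in>neighbours E i. A $ i $ k *\<^sub>R v k) = gossip A v i"
  unfolding gossip_def
proof (rule sum.mono_neutral_left)
  show "\<forall>k\<in>UNIV - neighbours E i. A $ i $ k *\<^sub>R v k = 0"
    using assms by (auto simp: gossip_matrix_def neighbours_def)
qed auto

lemma gossip_symmetric:
  fixes v w :: "'m::finite \<Rightarrow> real^'n::finite"
  assumes "gossip_matrix E A"
  shows "(\<Sum>i\<in>UNIV. gossip A v i \<bullet> w i) = (\<Sum>i\<in>UNIV. v i \<bullet> gossip A w i)"
proof -
  have tr: "transpose A = A" using assms by (simp add: gossip_matrix_def)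
  have A: "A $ i $ k = A $ k $ i" for i k
    by (subst tr[symmetric]) (simp add: transpose_def)
  have "(\<Sum>i\<in>UNIV. gossip A v i \<bullet> w i) = (\<Sum>i\<in>UNIV. \<Sum>k\<in>UNIV. A $ i $ k * (v k \<bullet> w i))"
    by (simp add: gossip_def inner_sum_left)
  also have "\<dots> = (\<Sum>k\<in>UNIV. \<Sum>i\<in>UNIV. A $ i $ k * (v k \<bullet> w i))" by (rule sum.swap)
  also have "\<dots> = (\<Sum>k\<in>UNIV. v k \<bullet> gossip A w k)"
    by (simp add: gossip_def inner_sum_right) (simp add: A)
  finally show ?thesis .
qed

lemma block_B_mat:
  fixes x :: "real^('m::finite \<times> 'n::finite)"
  shows "block (B_mat A *v x) (Inl i) = block x i"
    and "block (B_mat A *v x) (Inr i) = gossip A (block x) i"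
proof -
  have "(B_mat A *v x) $ (Inl i, k) = (mat 1 *v x) $ (i, k)" for k
    by (simp add: matrix_vector_mult_def B_mat_def)
  then show "block (B_mat A *v x) (Inl i) = block x i"
    by (simp add: block_def)
  have "(B_mat A *v x) $ (Inr i, k) = (\<Sum>j\<in>UNIV. A $ i $ j * x $ (j, k))" for k
  proof -
    have "(B_mat A *v x) $ (Inr i, k)
        = (\<Sum>p\<in>UNIV. A $ i $ fst p * (mat 1 :: real^'n^'n) $ k $ snd p * x $ p)"
      by (simp add: matrix_vector_mult_def B_mat_def W_mat_def kronecker_def)
    also have "\<dots> = (\<Sum>j\<in>UNIV. \<Sum>l\<in>UNIV. A $ i $ j * (mat 1 :: real^'n^'n) $ k $ l * x $ (j, l))"
      by (simp add: sum.cartesian_product case_prod_beta UNIV_Times_UNIV[symmetric] del: UNIV_Times_UNIV)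
    also have "\<dots> = (\<Sum>j\<in>UNIV. A $ i $ j * x $ (j, k))"
      by (intro sum.cong refl) (simp add: mat_def if_distrib if_distribR cong: if_cong)
    finally show ?thesis .
  qed
  then show "block (B_mat A *v x) (Inr i) = gossip A (block x) i"
    by (simp add: block_def gossip_def vec_eq_iff)
qed

text \<open>This identity is how the Frobenius norm of \<open>B\<close> in the step size dominates the gossip part and the
proximal part of the Newton matrix together.\<close>

lemma norm_B_mat_sq:
  fixes x :: "real^('m::finite \<times> 'n::finite)"
  shows "(norm (B_mat A *v x))\<^sup>2 = (norm x)\<^sup>2 + (\<Sum>i\<in>UNIV. (norm (gossip A (block x) i))\<^sup>2)"
  by (simp add: norm_block_sq[of "B_mat A *v x"] sum_UNIV_Plus block_B_mat norm_block_sq[of x])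

section \<open>The objective and its gradient\<close>

definition dual_point :: "real^'m^'m \<Rightarrow> real \<Rightarrow> real^(('m + 'm) \<times> 'n) \<Rightarrow> real^('m::finite \<times> 'n::finite)
    \<Rightarrow> real^(('m + 'm) \<times> 'n)" where
  "dual_point A \<sigma> lam x = \<sigma> *\<^sub>R (B_mat A *v x) - lam"

lemma dual_u_eq_block:
  assumes "gossip_matrix E A"
  shows "dual_u E A \<sigma> lam x b = block (dual_point A \<sigma> lam x) b"
  unfolding dual_u_def sum_neighbours_eq_gossip[OF assms] dual_point_def
  by (cases b) (simp_all add: block_B_mat)

text \<open>Completing the minimisation over \<open>y\<close> block by block: the first \<open>m\<close> blocks give Moreau envelopes, and the last \<open>m\<close>
blocks, where \<open>y\<close> has to vanish, leave a quadratic penalty.\<close>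

definition phi_real :: "('m::finite \<Rightarrow> real^'n::finite \<Rightarrow> real) \<Rightarrow> ('m \<Rightarrow> real^'n \<Rightarrow> ereal) \<Rightarrow> real^'m^'m \<Rightarrow>
   real \<Rightarrow> real^(('m + 'm) \<times> 'n) \<Rightarrow> real^('m \<times> 'n) \<Rightarrow> real" where
  "phi_real f g A \<sigma> lam x = (\<Sum>i\<in>UNIV. f i (block x i))
     + (\<Sum>i\<in>UNIV. envelope \<sigma> (g i) (block (dual_point A \<sigma> lam x) (Inl i)))
     + 1 / (2 * \<sigma>) * (\<Sum>i\<in>UNIV. (norm (block (dual_point A \<sigma> lam x) (Inr i)))\<^sup>2)
     - 1 / (2 * \<sigma>) * (norm lam)\<^sup>2"

lemma phi_objective_feasible:
  fixes f :: "'m::finite \<Rightarrow> real^'n::finite \<Rightarrow> real"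
  assumes \<sigma>: "\<sigma> > 0" and y: "\<And>i. block y (Inr i) = 0" and r: "\<And>i. g i (block y (Inl i)) = ereal (r i)"
  shows "ereal (F_obj f x) + G_obj g y +
     ereal (\<sigma> / 2 * (norm (B_mat A *v x - y - (1 / \<sigma>) *\<^sub>R lam))\<^sup>2 - 1 / (2 * \<sigma>) * (norm lam)\<^sup>2)
   = ereal ((\<Sum>i\<in>UNIV. f i (block x i))
     + (\<Sum>i\<in>UNIV. r i + \<sigma> / 2 * (norm ((1 / \<sigma>) *\<^sub>R block (dual_point A \<sigma> lam x) (Inl i) - block y (Inl i)))\<^sup>2)
     + 1 / (2 * \<sigma>) * (\<Sum>i\<in>UNIV. (norm (block (dual_point A \<sigma> lam x) (Inr i)))\<^sup>2)
     - 1 / (2 * \<sigma>) * (norm lam)\<^sup>2)"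
proof -
  define u where "u = dual_point A \<sigma> lam x"
  have eq: "B_mat A *v x - y - (1 / \<sigma>) *\<^sub>R lam = (1 / \<sigma>) *\<^sub>R u - y"
    using \<sigma> by (simp add: u_def dual_point_def scaleR_diff_right)
  have "(norm ((1 / \<sigma>) *\<^sub>R u - y))\<^sup>2 = (\<Sum>i\<in>UNIV. (norm ((1 / \<sigma>) *\<^sub>R block u (Inl i) - block y (Inl i)))\<^sup>2)
      + (\<Sum>i\<in>UNIV. (norm ((1 / \<sigma>) *\<^sub>R block u (Inr i)))\<^sup>2)"
    by (simp add: norm_block_sq[of "(1 / \<sigma>) *\<^sub>R u - y"] sum_UNIV_Plus y)
  also have "(\<Sum>i\<in>UNIV. (norm ((1 / \<sigma>) *\<^sub>R block u (Inr i)))\<^sup>2) = (1 / \<sigma>)\<^sup>2 * (\<Sum>i\<in>UNIV. (norm (block u (Inr i)))\<^sup>2)"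
    unfolding sum_distrib_left by (simp add: power_mult_distrib power_divide)
  finally have "\<sigma> / 2 * (norm ((1 / \<sigma>) *\<^sub>R u - y))\<^sup>2
      = (\<Sum>i\<in>UNIV. \<sigma> / 2 * (norm ((1 / \<sigma>) *\<^sub>R block u (Inl i) - block y (Inl i)))\<^sup>2)
        + 1 / (2 * \<sigma>) * (\<Sum>i\<in>UNIV. (norm (block u (Inr i)))\<^sup>2)"
    using \<sigma> by (simp add: distrib_left sum_distrib_left power2_eq_square)
  moreover have "G_obj g y = ereal (\<Sum>i\<in>UNIV. r i)" using y by (simp add: G_obj_def r)
  ultimately show ?thesis unfolding eq u_def[symmetric] by (simp add: F_obj_def sum.distrib)
qed

lemma phi_eq_phi_real:
  fixes f :: "'m::finite \<Rightarrow> real^'n::finite \<Rightarrow> real"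
  assumes g: "\<And>i. closed_proper_convex (g i)" and \<sigma>: "\<sigma> > 0"
  shows "phi f g A \<sigma> lam x = ereal (phi_real f g A \<sigma> lam x)"
proof (rule antisym)
  define u where "u = dual_point A \<sigma> lam x"
  define obj where "obj y = ereal (F_obj f x) + G_obj g y +
     ereal (\<sigma> / 2 * (norm (B_mat A *v x - y - (1 / \<sigma>) *\<^sub>R lam))\<^sup>2 - 1 / (2 * \<sigma>) * (norm lam)\<^sup>2)" for y
  have phi: "phi f g A \<sigma> lam x = (INF y. obj y)" by (simp add: phi_def obj_def)
  show "phi f g A \<sigma> lam x \<le> ereal (phi_real f g A \<sigma> lam x)"
  proof -
    define p where "p i = (1 / \<sigma>) *\<^sub>R (block u (Inl i) - dual_prox \<sigma> (g i) (block u (Inl i)))" for i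
    define y :: "real^(('m + 'm) \<times> 'n)" where "y = unblock (\<lambda>b. case b of Inl i \<Rightarrow> p i | Inr i \<Rightarrow> 0)"
    have "\<exists>r. g i (p i) = ereal r" for i
      using dual_prox_subgradient[OF g \<sigma>, of i "block u (Inl i)"] by (auto simp: subgradient_at_def p_def)
    then obtain r where r: "\<And>i. g i (p i) = ereal (r i)" by metis
    have env: "envelope \<sigma> (g i) (block u (Inl i)) = r i + \<sigma> / 2 * (norm ((1 / \<sigma>) *\<^sub>R block u (Inl i) - p i))\<^sup>2" for i
      using envelope_attained[OF g \<sigma>, of i "block u (Inl i)"] r[of i] by (simp add: p_def)
    have "obj y = ereal (phi_real f g A \<sigma> lam x)"
      unfolding obj_def
      by (subst phi_objective_feasible[OF \<sigma>, where r = r])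
        (simp_all add: y_def r phi_real_def u_def[symmetric] env)
    then show ?thesis unfolding phi by (metis INF_lower UNIV_I)
  qed
  show "ereal (phi_real f g A \<sigma> lam x) \<le> phi f g A \<sigma> lam x"
    unfolding phi
  proof (rule INF_greatest)
    fix y
    show "ereal (phi_real f g A \<sigma> lam x) \<le> obj y"
    proof (cases "(\<forall>i. block y (Inr i) = 0) \<and> (\<forall>i. g i (block y (Inl i)) \<noteq> \<infinity>)")
      case True
      have "\<exists>r. g i (block y (Inl i)) = ereal r" for i
        using True g[of i] by (cases "g i (block y (Inl i))") (auto simp: closed_proper_convex_def)
      then obtain r where r: "\<And>i. g i (block y (Inl i)) = ereal (r i)" by metis
      have "envelope \<sigma> (g i) (block u (Inl i)) \<le> r i + \<sigma> / 2 * (norm ((1 / \<sigma>) *\<^sub>R block u (Inl i) - block y (Inl i)))\<^sup>2" for i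
        using envelope_le[OF g \<sigma>, of i "block u (Inl i)" "block y (Inl i)"] r[of i] by simp
      then have "(\<Sum>i\<in>UNIV. envelope \<sigma> (g i) (block u (Inl i)))
          \<le> (\<Sum>i\<in>UNIV. r i + \<sigma> / 2 * (norm ((1 / \<sigma>) *\<^sub>R block u (Inl i) - block y (Inl i)))\<^sup>2)"
        by (rule sum_mono)
      then show ?thesis
        unfolding obj_def using True r
        by (subst phi_objective_feasible[OF \<sigma>, where r = r]) (simp_all add: phi_real_def u_def[symmetric])
    next
      case False
      have "G_obj g y = \<infinity>"
      proof (cases "\<forall>i. block y (Inr i) = 0")
        case True
        with False obtain i where "g i (block y (Inl i)) = \<infinity>" by auto
        then have "(\<Sum>i\<in>UNIV. g i (block y (Inl i))) = \<infinity>"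
          by (subst sum_Pinfty) auto
        then show ?thesis using True by (simp add: G_obj_def)
      next
        case False
        then show ?thesis unfolding G_obj_def by (rule if_not_P)
      qed
      then show ?thesis by (simp add: obj_def)
    qed
  qed
qed

text \<open>The gradient of the objective, which is also the constant term that every agent uses in its inner
loop.\<close>

definition newton_residual :: "('m::finite \<Rightarrow> real^'n::finite \<Rightarrow> real) \<Rightarrow> ('m \<Rightarrow> real^'n \<Rightarrow> ereal) \<Rightarrow> real^'m^'m \<Rightarrow>
   real \<Rightarrow> real^(('m + 'm) \<times> 'n) \<Rightarrow> real^('m \<times> 'n) \<Rightarrow> real^('m \<times> 'n)" where
  "newton_residual f g A \<sigma> lam x = unblock (\<lambda>i. gradient (f i) (block x i)
     + dual_prox \<sigma> (g i) (block (dual_point A \<sigma> lam x) (Inl i))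
     + gossip A (\<lambda>k. block (dual_point A \<sigma> lam x) (Inr k)) i)"

lemma gradient_eqI:
  assumes "GDERIV f x :> D"
  shows "gradient f x = D"
  unfolding gradient_def
proof (rule the_equality)
  show "GDERIV f x :> D" by (rule assms)
  fix D' assume "GDERIV f x :> D'"
  with assms have "(\<lambda>h. h \<bullet> D') = (\<lambda>h. h \<bullet> D)" unfolding gderiv_def by (metis has_derivative_unique)
  then show "D' = D" by (metis vector_eq_ldot)
qed

lemma GDERIV_gradient:
  fixes f :: "'a::euclidean_space \<Rightarrow> real"
  assumes "f differentiable (at x)"
  shows "GDERIV f x :> gradient f x"
proof -
  obtain f' where f': "(f has_derivative f') (at x)" using assms by (auto simp: differentiable_def)
  then have "linear f'" by (rule has_derivative_linear)
  then have "f' h = h \<bullet> adjoint f' 1" for h using adjoint_works[of f' h 1] by simp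
  then have "f' = (\<lambda>h. h \<bullet> adjoint f' 1)" by blast
  with f' have "GDERIV f x :> adjoint f' 1" unfolding gderiv_def by simp
  then show ?thesis using gradient_eqI by metis
qed

text \<open>The chain rule yields the transpose of \<open>B\<close>; symmetry of the gossip matrix turns it into the communication
step that the agents perform.\<close>

lemma GDERIV_phi_real:
  fixes f :: "'m::finite \<Rightarrow> real^'n::finite \<Rightarrow> real"
  assumes f: "\<And>i x. f i differentiable (at x)" and g: "\<And>i. closed_proper_convex (g i)"
    and \<sigma>: "\<sigma> > 0" and A: "gossip_matrix E A"
  shows "GDERIV (phi_real f g A \<sigma> lam) x :> newton_residual f g A \<sigma> lam x"
proof -
  define u where "u = dual_point A \<sigma> lam"
  have bl: "((\<lambda>x. block x i) has_derivative (\<lambda>h. block h i)) (at x within S)" for i and x :: "real^('b::finite \<times> 'n)" and S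
    by (rule bounded_linear_imp_has_derivative) (simp add: linear_block flip: linear_conv_bounded_linear)
  have u: "(u has_derivative (\<lambda>h. \<sigma> *\<^sub>R (B_mat A *v h))) (at x)" for x
    unfolding u_def dual_point_def[abs_def]
    by (auto intro!: derivative_eq_intros bounded_linear_imp_has_derivative simp: linear_conv_bounded_linear[symmetric])
  have ub: "((\<lambda>x. block (u x) b) has_derivative (\<lambda>h. \<sigma> *\<^sub>R block (B_mat A *v h) b)) (at x)" for b x
    using has_derivative_compose[OF u bl] by simp
  have fd: "((\<lambda>x. f i (block x i)) has_derivative (\<lambda>h. block h i \<bullet> gradient (f i) (block x i))) (at x)" for i
    by (rule has_derivative_compose[OF bl]) (rule GDERIV_gradient[OF f, unfolded gderiv_def])
  have ed: "((\<lambda>x. envelope \<sigma> (g i) (block (u x) (Inl i))) has_derivative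
      (\<lambda>h. block h i \<bullet> dual_prox \<sigma> (g i) (block (u x) (Inl i)))) (at x)" for i
    using has_derivative_compose[OF ub[of "Inl i" x] GDERIV_envelope[OF g[of i] \<sigma>, unfolded gderiv_def]] \<sigma>
    by (simp add: block_B_mat)
  have nd: "((\<lambda>x. (norm (block (u x) (Inr i)))\<^sup>2) has_derivative
      (\<lambda>h. 2 * \<sigma> * (gossip A (block h) i \<bullet> block (u x) (Inr i)))) (at x)" for i
    unfolding power2_norm_eq_inner
    by (rule has_derivative_eq_rhs[OF has_derivative_inner[OF ub ub]])
      (simp add: fun_eq_iff block_B_mat inner_commute)
  have "(phi_real f g A \<sigma> lam has_derivative (\<lambda>h. (\<Sum>i\<in>UNIV. block h i \<bullet> gradient (f i) (block x i))
      + (\<Sum>i\<in>UNIV. block h i \<bullet> dual_prox \<sigma> (g i) (block (u x) (Inl i)))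
      + 1 / (2 * \<sigma>) * (\<Sum>i\<in>UNIV. 2 * \<sigma> * (gossip A (block h) i \<bullet> block (u x) (Inr i))) - 0)) (at x)"
    unfolding phi_real_def[abs_def] u_def[symmetric]
    by (intro has_derivative_diff has_derivative_add has_derivative_sum has_derivative_const
        has_derivative_mult_right fd ed nd)
  moreover have "(\<Sum>i\<in>UNIV. block h i \<bullet> gradient (f i) (block x i))
      + (\<Sum>i\<in>UNIV. block h i \<bullet> dual_prox \<sigma> (g i) (block (u x) (Inl i)))
      + 1 / (2 * \<sigma>) * (\<Sum>i\<in>UNIV. 2 * \<sigma> * (gossip A (block h) i \<bullet> block (u x) (Inr i))) - 0
     = h \<bullet> newton_residual f g A \<sigma> lam x" for h
  proof -
    have "1 / (2 * \<sigma>) * (\<Sum>i\<in>UNIV. 2 * \<sigma> * (gossip A (block h) i \<bullet> block (u x) (Inr i)))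
        = (\<Sum>i\<in>UNIV. gossip A (block h) i \<bullet> block (u x) (Inr i))"
      using \<sigma> by (simp add: sum_distrib_left[symmetric])
    also have "\<dots> = (\<Sum>i\<in>UNIV. block h i \<bullet> gossip A (\<lambda>k. block (u x) (Inr k)) i)"
      by (rule gossip_symmetric[OF A])
    finally show ?thesis
      by (simp add: inner_block[of h] newton_residual_def u_def[symmetric] inner_add_right sum.distrib)
  qed
  ultimately show ?thesis unfolding gderiv_def by simp
qed

lemma newton_residual_minimizer:
  fixes f :: "'m::finite \<Rightarrow> real^'n::finite \<Rightarrow> real"
  assumes f: "\<And>i x. f i differentiable (at x)" and g: "\<And>i. closed_proper_convex (g i)"
    and \<sigma>: "\<sigma> > 0" and A: "gossip_matrix E A"
    and min: "is_arg_min (phi f g A \<sigma> lam) (\<lambda>_. True) xhat"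
  shows "newton_residual f g A \<sigma> lam xhat = 0"
proof -
  have "phi_real f g A \<sigma> lam xhat \<le> phi_real f g A \<sigma> lam y" for y
    using min by (simp add: is_arg_min_def phi_eq_phi_real[OF g \<sigma>] not_less)
  moreover have "GDERIV (phi_real f g A \<sigma> lam) xhat :> newton_residual f g A \<sigma> lam xhat"
    by (rule GDERIV_phi_real[OF f g \<sigma> A])
  ultimately have "(\<lambda>h. h \<bullet> newton_residual f g A \<sigma> lam xhat) = (\<lambda>h. 0)"
    unfolding gderiv_def using differential_zero_maxmin[OF UNIV_I open_UNIV, of "phi_real f g A \<sigma> lam"]
    by blast
  then show ?thesis by (metis inner_eq_zero_iff)
qed

section \<open>One step of the method\<close>

text \<open>The generalised Newton matrix \<open>diag V + \<sigma> \<cdot> B\<^sup>T (diag (H, I)) B\<close>, applied block by block.\<close>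

definition newton_op :: "real^'m^'m \<Rightarrow> real \<Rightarrow> ('m \<Rightarrow> real^'n^'n) \<Rightarrow> ('m \<Rightarrow> real^'n^'n) \<Rightarrow>
    real^('m::finite \<times> 'n::finite) \<Rightarrow> real^('m \<times> 'n)" where
  "newton_op A \<sigma> V H x = unblock (\<lambda>i. V i *v block x i + \<sigma> *\<^sub>R (H i *v block x i)
     + \<sigma> *\<^sub>R gossip A (gossip A (block x)) i)"

lemma block_fun_linear:
  "block (x + y) = (\<lambda>i. block x i + block y i)"
  "block (x - y) = (\<lambda>i. block x i - block y i)"
  "block (c *\<^sub>R x) = (\<lambda>i. c *\<^sub>R block x i)"
  by (rule ext, simp)+

lemma gossip_fun_linear:
  "gossip A (\<lambda>k. v k + w k) = (\<lambda>i. gossip A v i + gossip A w i)"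
  "gossip A (\<lambda>k. v k - w k) = (\<lambda>i. gossip A v i - gossip A w i)"
  "gossip A (\<lambda>k. c *\<^sub>R v k) = (\<lambda>i. c *\<^sub>R gossip A v i)"
  by (rule ext, simp add: gossip_linear_simps)+

lemma linear_newton_op: "linear (newton_op A \<sigma> V H)"
proof (rule linearI; rule block_eqI)
  fix x y i
  show "block (newton_op A \<sigma> V H (x + y)) i = block (newton_op A \<sigma> V H x + newton_op A \<sigma> V H y) i"
    by (simp add: newton_op_def block_fun_linear gossip_fun_linear matrix_vector_right_distrib scaleR_add_right)
next
  fix c x i
  show "block (newton_op A \<sigma> V H (c *\<^sub>R x)) i = block (c *\<^sub>R newton_op A \<sigma> V H x) i"
    by (simp add: newton_op_def block_fun_linear gossip_fun_linear matrix_vector_mult_scaleR scaleR_add_right mult.commute)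
qed

lemma newton_op_inner:
  assumes "gossip_matrix E A"
  shows "newton_op A \<sigma> V H x \<bullet> y = (\<Sum>i\<in>UNIV. (V i *v block x i) \<bullet> block y i)
    + \<sigma> * (\<Sum>i\<in>UNIV. (H i *v block x i) \<bullet> block y i)
    + \<sigma> * (\<Sum>i\<in>UNIV. gossip A (block x) i \<bullet> gossip A (block y) i)"
  unfolding gossip_symmetric[OF assms, of "gossip A (block x)", symmetric]
  by (simp add: newton_op_def inner_block[of _ y] inner_add_left sum.distrib sum_distrib_left)

lemma newton_op_symmetric:
  assumes "gossip_matrix E A" "\<And>i h k. (V i *v h) \<bullet> k = (V i *v k) \<bullet> h" "\<And>i h k. (H i *v h) \<bullet> k = (H i *v k) \<bullet> h"
  shows "newton_op A \<sigma> V H x \<bullet> y = newton_op A \<sigma> V H y \<bullet> x"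
  unfolding newton_op_inner[OF assms(1)]
  by (simp add: assms(2)[of _ "block x _"] assms(3)[of _ "block x _"] inner_commute[of "gossip A (block x) _"])

lemma newton_op_lower:
  assumes "gossip_matrix E A" "\<sigma> > 0" "\<And>i h. \<mu> * (norm h)\<^sup>2 \<le> (V i *v h) \<bullet> h" "\<And>i h. 0 \<le> (H i *v h) \<bullet> h"
  shows "\<mu> * (norm x)\<^sup>2 \<le> newton_op A \<sigma> V H x \<bullet> x"
proof -
  have "\<mu> * (norm x)\<^sup>2 \<le> (\<Sum>i\<in>UNIV. (V i *v block x i) \<bullet> block x i)"
    unfolding norm_block_sq[of x] sum_distrib_left by (intro sum_mono assms)
  moreover have "0 \<le> \<sigma> * (\<Sum>i\<in>UNIV. (H i *v block x i) \<bullet> block x i)"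
    using assms(2,4) by (intro mult_nonneg_nonneg sum_nonneg) auto
  moreover have "0 \<le> \<sigma> * (\<Sum>i\<in>UNIV. gossip A (block x) i \<bullet> gossip A (block x) i)"
    using assms(2) by (intro mult_nonneg_nonneg sum_nonneg) auto
  ultimately show ?thesis unfolding newton_op_inner[OF assms(1)] by linarith
qed

lemma newton_op_upper:
  fixes x :: "real^('m::finite \<times> 'n::finite)"
  assumes "gossip_matrix E A" "\<sigma> > 0" "\<And>i h. (V i *v h) \<bullet> h \<le> K * (norm h)\<^sup>2" "\<And>i h. (H i *v h) \<bullet> h \<le> (norm h)\<^sup>2"
  shows "newton_op A \<sigma> V H x \<bullet> x
    \<le> (K + \<sigma> * (norm (B_mat A :: real^('m \<times> 'n)^(('m + 'm) \<times> 'n)))\<^sup>2) * (norm x)\<^sup>2"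
proof -
  let ?B = "B_mat A :: real^('m \<times> 'n)^(('m + 'm) \<times> 'n)"
  have 1: "(\<Sum>i\<in>UNIV. (V i *v block x i) \<bullet> block x i) \<le> K * (norm x)\<^sup>2"
    unfolding norm_block_sq[of x] sum_distrib_left by (intro sum_mono assms)
  have 2: "(\<Sum>i\<in>UNIV. (H i *v block x i) \<bullet> block x i) \<le> (norm x)\<^sup>2"
    unfolding norm_block_sq[of x] by (intro sum_mono assms)
  have "(norm x)\<^sup>2 + (\<Sum>i\<in>UNIV. (norm (gossip A (block x) i))\<^sup>2) \<le> (norm ?B * norm x)\<^sup>2"
    unfolding norm_B_mat_sq[symmetric] by (intro power_mono norm_matrix_vector_le) simp
  with 2 have "\<sigma> * ((\<Sum>i\<in>UNIV. (H i *v block x i) \<bullet> block x i)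
      + (\<Sum>i\<in>UNIV. gossip A (block x) i \<bullet> gossip A (block x) i)) \<le> \<sigma> * (norm ?B * norm x)\<^sup>2"
    using assms(2) by (intro mult_left_mono) (auto simp: power2_norm_eq_inner)
  with 1 show ?thesis unfolding newton_op_inner[OF assms(1)] by (simp add: power_mult_distrib algebra_simps)
qed

lemma strongly_convex_monotone:
  assumes "strongly_convex m f"
  shows "m * (norm (y - z))\<^sup>2 \<le> (gradient f y - gradient f z) \<bullet> (y - z)"
proof -
  have "f y + gradient f y \<bullet> (z - y) + m / 2 * (norm (z - y))\<^sup>2 \<le> f z"
    "f z + gradient f z \<bullet> (y - z) + m / 2 * (norm (y - z))\<^sup>2 \<le> f y"
    using assms by (auto simp: strongly_convex_def)
  then show ?thesis by (simp add: norm_minus_commute[of z y] inner_diff_left inner_diff_right)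
qed

lemma smooth_lipschitz:
  assumes "smooth K f"
  shows "norm (gradient f y - gradient f z) \<le> K * norm (y - z)" "K \<ge> 0"
  using assms by (auto simp: smooth_def lipschitz_on_def dist_norm)

lemma smooth_upper:
  assumes "smooth K f"
  shows "(gradient f y - gradient f z) \<bullet> (y - z) \<le> K * (norm (y - z))\<^sup>2"
proof -
  have "(gradient f y - gradient f z) \<bullet> (y - z) \<le> norm (gradient f y - gradient f z) * norm (y - z)"
    by (rule norm_cauchy_schwarz)
  also have "\<dots> \<le> (K * norm (y - z)) * norm (y - z)"
    using smooth_lipschitz[OF assms] by (intro mult_right_mono) auto
  finally show ?thesis by (simp add: power2_eq_square)
qed

lemma dual_point_add:
  "block (dual_point A \<sigma> lam (x + e)) (Inl i) = block (dual_point A \<sigma> lam x) (Inl i) + \<sigma> *\<^sub>R block e i"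
  "block (dual_point A \<sigma> lam (x + e)) (Inr i) = block (dual_point A \<sigma> lam x) (Inr i) + \<sigma> *\<^sub>R gossip A (block e) i"
  by (simp_all add: dual_point_def matrix_vector_right_distrib block_B_mat scaleR_add_right)

lemma newton_residual_diff:
  "block (newton_residual f g A \<sigma> lam (x + e) - newton_residual f g A \<sigma> lam x) i
   = (gradient (f i) (block x i + block e i) - gradient (f i) (block x i))
     + (dual_prox \<sigma> (g i) (block (dual_point A \<sigma> lam x) (Inl i) + \<sigma> *\<^sub>R block e i)
        - dual_prox \<sigma> (g i) (block (dual_point A \<sigma> lam x) (Inl i)))
     + \<sigma> *\<^sub>R gossip A (gossip A (block e)) i"
  unfolding newton_residual_def block_linear_simps block_unblock dual_point_add gossip_fun_linear
  by (simp add: gossip_fun_linear)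

text \<open>The residual is a sum of the maps \<open>gradient (f i)\<close> and \<open>dual_prox \<sigma> (g i)\<close>, which are linearised up to second
order, and of a gossip term that the Newton matrix reproduces exactly.\<close>

lemma newton_residual_semismooth:
  fixes f :: "'m::finite \<Rightarrow> real^'n::finite \<Rightarrow> real"
  assumes g: "\<And>i. closed_proper_convex (g i)" and \<sigma>: "\<sigma> > 0"
    and ssf: "\<And>i. strongly_semismooth (gradient (f i))" and ssg: "\<And>i. strongly_semismooth (Prox (g i))"
  shows "\<exists>C\<ge>0. \<forall>\<^sub>F e in nhds 0. \<forall>V H.
     (\<forall>i. V i \<in> clarke (gradient (f i)) (block (x + e) i)) \<longrightarrow>
     (\<forall>i. H i \<in> clarke (dual_prox \<sigma> (g i)) (block (dual_point A \<sigma> lam (x + e)) (Inl i))) \<longrightarrow>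
     norm (newton_op A \<sigma> V H e - (newton_residual f g A \<sigma> lam (x + e) - newton_residual f g A \<sigma> lam x))
       \<le> C * (norm e)\<^sup>2"
proof -
  define u where "u = dual_point A \<sigma> lam x"
  have "\<forall>i. \<exists>C. \<forall>\<^sub>F h in nhds 0. \<forall>V \<in> clarke (gradient (f i)) (block x i + h).
      norm (gradient (f i) (block x i + h) - gradient (f i) (block x i) - V *v h) \<le> C * (norm h)\<^sup>2"
    using ssf unfolding strongly_semismooth_def strongly_semismooth_at_def by blast
  from choice[OF this] obtain C1 where C1: "\<And>i. \<forall>\<^sub>F h in nhds 0. \<forall>V \<in> clarke (gradient (f i)) (block x i + h).
      norm (gradient (f i) (block x i + h) - gradient (f i) (block x i) - V *v h) \<le> C1 i * (norm h)\<^sup>2"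
    by blast
  have "\<forall>i. \<exists>C. \<forall>\<^sub>F k in nhds 0. \<forall>H \<in> clarke (dual_prox \<sigma> (g i)) (block u (Inl i) + k).
      norm (dual_prox \<sigma> (g i) (block u (Inl i) + k) - dual_prox \<sigma> (g i) (block u (Inl i)) - H *v k) \<le> C * (norm k)\<^sup>2"
    by (intro allI dual_prox_semismooth_estimate g \<sigma> ssg)
  from choice[OF this] obtain C2 where C2: "\<And>i. \<forall>\<^sub>F k in nhds 0. \<forall>H \<in> clarke (dual_prox \<sigma> (g i)) (block u (Inl i) + k).
      norm (dual_prox \<sigma> (g i) (block u (Inl i) + k) - dual_prox \<sigma> (g i) (block u (Inl i)) - H *v k) \<le> C2 i * (norm k)\<^sup>2"
    by blast
  have lim: "((\<lambda>e :: real^('m \<times> 'n). c *\<^sub>R block e i) \<longlongrightarrow> 0) (nhds 0)" for c and i :: 'm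
  proof (rule tendsto_0_le[where K = "\<bar>c\<bar>"])
    show "((\<lambda>e. e) \<longlongrightarrow> (0 :: real^('m \<times> 'n))) (nhds 0)" by (rule filterlim_ident)
  qed (auto simp: mult.commute intro!: always_eventually mult_left_mono norm_block_le)
  have E1: "\<forall>\<^sub>F e in nhds 0. \<forall>i. \<forall>V \<in> clarke (gradient (f i)) (block x i + block e i).
      norm (gradient (f i) (block x i + block e i) - gradient (f i) (block x i) - V *v block e i) \<le> C1 i * (norm (block e i))\<^sup>2"
    using filterlim_iff[THEN iffD1, OF lim[of 1], rule_format, OF C1]
    by (intro eventually_all_finite) simp
  have E2: "\<forall>\<^sub>F e in nhds 0. \<forall>i. \<forall>H \<in> clarke (dual_prox \<sigma> (g i)) (block u (Inl i) + \<sigma> *\<^sub>R block e i).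
      norm (dual_prox \<sigma> (g i) (block u (Inl i) + \<sigma> *\<^sub>R block e i) - dual_prox \<sigma> (g i) (block u (Inl i)) - H *v (\<sigma> *\<^sub>R block e i))
        \<le> C2 i * (norm (\<sigma> *\<^sub>R block e i))\<^sup>2"
    using filterlim_iff[THEN iffD1, OF lim[of \<sigma>], rule_format, OF C2]
    by (intro eventually_all_finite) simp
  define C where "C = (\<Sum>i\<in>UNIV. \<bar>C1 i\<bar> + \<bar>C2 i\<bar> * \<sigma>\<^sup>2)"
  have "C \<ge> 0" by (auto simp: C_def intro!: sum_nonneg)
  moreover have "\<forall>\<^sub>F e in nhds 0. \<forall>V H.
     (\<forall>i. V i \<in> clarke (gradient (f i)) (block (x + e) i)) \<longrightarrow>
     (\<forall>i. H i \<in> clarke (dual_prox \<sigma> (g i)) (block (dual_point A \<sigma> lam (x + e)) (Inl i))) \<longrightarrow>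
     norm (newton_op A \<sigma> V H e - (newton_residual f g A \<sigma> lam (x + e) - newton_residual f g A \<sigma> lam x))
       \<le> C * (norm e)\<^sup>2"
    using E1 E2
  proof (eventually_elim, intro allI impI)
    fix e V H
    assume e1: "\<forall>i. \<forall>V \<in> clarke (gradient (f i)) (block x i + block e i).
        norm (gradient (f i) (block x i + block e i) - gradient (f i) (block x i) - V *v block e i) \<le> C1 i * (norm (block e i))\<^sup>2"
      and e2: "\<forall>i. \<forall>H \<in> clarke (dual_prox \<sigma> (g i)) (block u (Inl i) + \<sigma> *\<^sub>R block e i).
        norm (dual_prox \<sigma> (g i) (block u (Inl i) + \<sigma> *\<^sub>R block e i) - dual_prox \<sigma> (g i) (block u (Inl i)) - H *v (\<sigma> *\<^sub>R block e i))
        \<le> C2 i * (norm (\<sigma> *\<^sub>R block e i))\<^sup>2"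
      and V: "\<forall>i. V i \<in> clarke (gradient (f i)) (block (x + e) i)"
      and H: "\<forall>i. H i \<in> clarke (dual_prox \<sigma> (g i)) (block (dual_point A \<sigma> lam (x + e)) (Inl i))"
    define R where "R = newton_op A \<sigma> V H e - (newton_residual f g A \<sigma> lam (x + e) - newton_residual f g A \<sigma> lam x)"
    have "norm (block R i) \<le> (\<bar>C1 i\<bar> + \<bar>C2 i\<bar> * \<sigma>\<^sup>2) * (norm e)\<^sup>2" for i
    proof -
      define a where "a = gradient (f i) (block x i + block e i) - gradient (f i) (block x i) - V i *v block e i"
      define b where "b = dual_prox \<sigma> (g i) (block u (Inl i) + \<sigma> *\<^sub>R block e i) - dual_prox \<sigma> (g i) (block u (Inl i)) - H i *v (\<sigma> *\<^sub>R block e i)"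
      have "block R i = - (a + b)"
        unfolding R_def block_linear_simps(2)[of "newton_op A \<sigma> V H e"] newton_residual_diff
        by (simp add: newton_op_def a_def b_def u_def matrix_vector_mult_scaleR)
      then have "norm (block R i) \<le> norm a + norm b" by (simp only: norm_minus_cancel norm_triangle_ineq)
      also have "norm a \<le> C1 i * (norm (block e i))\<^sup>2" using e1 V by (simp add: a_def)
      also have "C1 i * (norm (block e i))\<^sup>2 \<le> \<bar>C1 i\<bar> * (norm e)\<^sup>2"
        by (intro mult_mono power_mono norm_block_le) auto
      also have "norm b \<le> C2 i * (norm (\<sigma> *\<^sub>R block e i))\<^sup>2"
        using e2 H by (simp add: b_def u_def dual_point_add)
      also have "C2 i * (norm (\<sigma> *\<^sub>R block e i))\<^sup>2 = C2 i * (\<sigma>\<^sup>2 * (norm (block e i))\<^sup>2)"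
        by (simp add: power_mult_distrib)
      also have "C2 i * (\<sigma>\<^sup>2 * (norm (block e i))\<^sup>2) \<le> \<bar>C2 i\<bar> * (\<sigma>\<^sup>2 * (norm e)\<^sup>2)"
        proof (rule mult_mono)
          show "\<sigma>\<^sup>2 * (norm (block e i))\<^sup>2 \<le> \<sigma>\<^sup>2 * (norm e)\<^sup>2"
            by (rule mult_left_mono[OF power_mono[OF norm_block_le]]) auto
        qed auto
      finally show ?thesis by (simp add: algebra_simps)
    qed
    then have "(\<Sum>i\<in>UNIV. norm (block R i)) \<le> C * (norm e)\<^sup>2"
      unfolding C_def sum_distrib_right by (intro sum_mono)
    then show "norm R \<le> C * (norm e)\<^sup>2" using norm_le_sum_block[of R] by linarith
  qed
  ultimately show ?thesis by blast
qed

lemma newton_residual_lipschitz: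
  fixes f :: "'m::finite \<Rightarrow> real^'n::finite \<Rightarrow> real"
  assumes g: "\<And>i. closed_proper_convex (g i)" and \<sigma>: "\<sigma> > 0" and sm: "\<And>i. smooth (Ls i) (f i)"
  obtains K where "K \<ge> 0" "\<And>x e. norm (newton_residual f g A \<sigma> lam (x + e) - newton_residual f g A \<sigma> lam x) \<le> K * norm e"
proof -
  define G :: "real^('m \<times> 'n) \<Rightarrow> real^('m \<times> 'n)" where "G e = unblock (gossip A (gossip A (block e)))" for e
  have "linear G"
    by (rule linearI; rule block_eqI) (simp_all add: G_def block_fun_linear gossip_fun_linear)
  then obtain b where b: "b > 0" "\<And>e. norm (G e) \<le> b * norm e" using linear_bounded_pos by blast
  define K where "K = (\<Sum>i\<in>UNIV. Ls i + \<sigma> + \<sigma> * b)"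
  have "norm (newton_residual f g A \<sigma> lam (x + e) - newton_residual f g A \<sigma> lam x) \<le> K * norm e" for x e
  proof -
    define D where "D = newton_residual f g A \<sigma> lam (x + e) - newton_residual f g A \<sigma> lam x"
    have "norm (block D i) \<le> (Ls i + \<sigma> + \<sigma> * b) * norm e" for i
    proof -
      define u where "u = block (dual_point A \<sigma> lam x) (Inl i)"
      define p where "p = gradient (f i) (block x i + block e i) - gradient (f i) (block x i)"
      define q where "q = dual_prox \<sigma> (g i) (u + \<sigma> *\<^sub>R block e i) - dual_prox \<sigma> (g i) u"
      have "block D i = p + q + \<sigma> *\<^sub>R block (G e) i"
        unfolding D_def newton_residual_diff by (simp add: p_def q_def u_def G_def)
      then have "norm (block D i) \<le> norm p + norm q + norm (\<sigma> *\<^sub>R block (G e) i)"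
        by (simp only: norm_triangle_le norm_triangle_ineq add_right_mono)
      moreover have "norm p \<le> Ls i * norm e"
      proof -
        have "norm p \<le> Ls i * norm (block e i)"
          using smooth_lipschitz(1)[OF sm, of i "block x i + block e i" "block x i"] by (simp add: p_def)
        also have "\<dots> \<le> Ls i * norm e" using smooth_lipschitz(2)[OF sm] norm_block_le by (intro mult_left_mono) auto
        finally show ?thesis .
      qed
      moreover have "norm q \<le> \<sigma> * norm e"
      proof -
        have "norm q \<le> norm ((u + \<sigma> *\<^sub>R block e i) - u)"
          unfolding q_def by (rule firmly_nonexpansive_bounds(1)[OF dual_prox_firmly_nonexpansive[OF g \<sigma>]])
        also have "\<dots> \<le> \<sigma> * norm e" using \<sigma> norm_block_le[of e i] by simp
        finally show ?thesis .
      qed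
      moreover have "norm (\<sigma> *\<^sub>R block (G e) i) \<le> \<sigma> * (b * norm e)"
        using order_trans[OF norm_block_le b(2)] \<sigma> by simp
      ultimately show ?thesis by (simp add: algebra_simps)
    qed
    then have "(\<Sum>i\<in>UNIV. norm (block D i)) \<le> K * norm e"
      unfolding K_def sum_distrib_right by (intro sum_mono)
    then show "norm D \<le> K * norm e" using norm_le_sum_block[of D] by linarith
  qed
  moreover have "K \<ge> 0" unfolding K_def using smooth_lipschitz(2)[OF sm] \<sigma> b by (intro sum_nonneg) auto
  ultimately show thesis using that by blast
qed

text \<open>Strictness comes from the identity block of \<open>B\<close>, whose Frobenius norm is thus positive. It ensures that the
contraction factor \<open>1 - sqrt (\<mu> / L)\<close> of the inner loop is positive, so that its logarithm is meaningful.\<close>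

lemma mu_L_const_bounds:
  fixes f :: "'m::finite \<Rightarrow> real^'n::finite \<Rightarrow> real"
  assumes "\<And>i. mus i > 0" "\<And>i. strongly_convex (mus i) (f i)" "\<And>i. smooth (Ls i) (f i)" "\<sigma> > 0"
  shows "0 < mu_const mus" "mu_const mus < L_const TYPE('n) Ls A \<sigma>"
proof -
  show "0 < mu_const mus" using assms(1) by (simp add: mu_const_def)
  fix i :: 'm
  let ?B = "B_mat A :: real^('m \<times> 'n)^(('m + 'm) \<times> 'n)"
  define e :: "real^'n" where "e = axis undefined 1"
  have "mus i * (norm (e - 0))\<^sup>2 \<le> Ls i * (norm (e - 0))\<^sup>2"
    by (rule order_trans[OF strongly_convex_monotone[OF assms(2)] smooth_upper[OF assms(3)]])
  then have "mus i \<le> Ls i" by (simp add: e_def)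
  moreover have "Ls i \<le> Max (range Ls)" by simp
  moreover have "mu_const mus \<le> mus i" by (simp add: mu_const_def)
  moreover have "?B \<noteq> 0"
  proof
    assume "?B = 0"
    then have "?B $ (Inl i, undefined) $ (i, undefined) = 0" by simp
    then show False by (simp add: B_mat_def mat_def)
  qed
  then have "\<sigma> * (norm ?B)\<^sup>2 > 0" using assms(4) by simp
  ultimately show "mu_const mus < L_const TYPE('n) Ls A \<sigma>" unfolding L_const_def by linarith
qed

text \<open>Let \<open>ds\<close> be the exact Newton direction. Then \<open>M (x - xhat + ds)\<close> is the linearisation error of the residual, so
the exact Newton iterate is within \<open>\<epsilon> / \<mu>\<close> of the solution by coercivity of \<open>M\<close>. The inner loop misses
\<open>ds\<close> by at most \<open>\<eta> \<cdot> norm ds\<close>, and \<open>ds\<close> is not much longer than \<open>x - xhat\<close>.\<close>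

lemma dissn_step_error:
  fixes f :: "'m::finite \<Rightarrow> real^'n::finite \<Rightarrow> real"
  assumes f: "\<And>i x. f i differentiable (at x)"
    and mus: "\<And>i. mus i > 0"
    and sc: "\<And>i. strongly_convex (mus i) (f i)"
    and sm: "\<And>i. smooth (Ls i) (f i)"
    and g: "\<And>i. closed_proper_convex (g i)"
    and A: "gossip_matrix E A"
    and \<sigma>: "\<sigma> > 0"
    and \<eta>: "\<eta> > 0"
    and zero: "newton_residual f g A \<sigma> lam xhat = 0"
    and res: "\<And>V H. (\<forall>i. V i \<in> clarke (gradient (f i)) (block x i)) \<Longrightarrow>
      (\<forall>i. H i \<in> clarke (dual_prox \<sigma> (g i)) (block (dual_point A \<sigma> lam x) (Inl i))) \<Longrightarrow>
      norm (newton_op A \<sigma> V H (x - xhat) - newton_residual f g A \<sigma> lam x) \<le> \<epsilon>"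
    and step: "dissn_step f g E A \<sigma> lam (mu_const mus) (L_const TYPE('n) Ls A \<sigma>) \<eta> x x'"
  shows "norm (x' - xhat) \<le> \<epsilon> / mu_const mus + \<eta> * (\<epsilon> / mu_const mus + norm (x - xhat))"
proof -
  define \<mu> where "\<mu> = mu_const mus"
  define L where "L = L_const TYPE('n) Ls A \<sigma>"
  have \<mu>L: "0 < \<mu>" "\<mu> < L" unfolding \<mu>_def L_def 
    using mu_L_const_bounds[where f = f and mus = mus and Ls = Ls, OF mus sc sm \<sigma>] by auto
  define N where "N = N_iter \<mu> L \<eta>"
  define c where "c = newton_residual f g A \<sigma> lam x"
  obtain V H d where V: "\<And>i. V i \<in> clarke (gradient (f i)) (block x i)"
    and H: "\<And>i. H i \<in> clarke (dual_prox \<sigma> (g i)) (block (dual_point A \<sigma> lam x) (Inl i))"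
    and d: "inner_iterates E A \<sigma> \<mu> L V H (block c) N d"
    and x': "\<And>i. block x' i = block x i + d (N + 1) i"
  proof -
    have c: "(\<lambda>i. gradient (f i) (block x i) + dual_prox \<sigma> (g i) (block (dual_point A \<sigma> lam x) (Inl i))
        + gossip A (\<lambda>k. block (dual_point A \<sigma> lam x) (Inr k)) i) = block c"
      by (rule ext) (simp add: c_def newton_residual_def)
    show thesis
      using step that
      unfolding dissn_step_def Let_def dual_u_eq_block[OF A] sum_neighbours_eq_gossip[OF A] c
        \<mu>_def[symmetric] L_def[symmetric] N_def[symmetric] by blast
  qed
  define M where "M = newton_op A \<sigma> V H"
  define D where "D j = unblock (d j)" for j
  have Vb: "mu_const mus * (norm h)\<^sup>2 \<le> (V i *v h) \<bullet> h" "(V i *v h) \<bullet> h \<le> Max (range Ls) * (norm h)\<^sup>2" for i h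
  proof -
    have "mu_const mus * (norm h)\<^sup>2 \<le> mus i * (norm h)\<^sup>2" by (intro mult_right_mono) (auto simp: mu_const_def)
    also have "\<dots> \<le> (V i *v h) \<bullet> h"
      by (rule clarke_bounds(1)[OF V strongly_convex_monotone[OF sc] smooth_upper[OF sm]])
    finally show "mu_const mus * (norm h)\<^sup>2 \<le> (V i *v h) \<bullet> h" .
    have "(V i *v h) \<bullet> h \<le> Ls i * (norm h)\<^sup>2"
      by (rule clarke_bounds(2)[OF V strongly_convex_monotone[OF sc] smooth_upper[OF sm]])
    also have "\<dots> \<le> Max (range Ls) * (norm h)\<^sup>2" by (intro mult_right_mono) auto
    finally show "(V i *v h) \<bullet> h \<le> Max (range Ls) * (norm h)\<^sup>2" .
  qed
  have Hb: "0 \<le> (H i *v h) \<bullet> h" "(H i *v h) \<bullet> h \<le> (norm h)\<^sup>2" for i h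
    using clarke_bounds[OF H firmly_nonexpansive_bounds(2,3)[OF dual_prox_firmly_nonexpansive[OF g \<sigma>]], where h = h] by auto
  have Vs: "(V i *v h) \<bullet> k = (V i *v k) \<bullet> h" for i h k
    by (rule clarke_symmetric[OF V GDERIV_gradient[OF f]])
  have Hs: "(H i *v h) \<bullet> k = (H i *v k) \<bullet> h" for i h k
  proof (rule clarke_symmetric[OF H])
    \<comment> \<open>The dual proximal map is a gradient, hence its Clarke Jacobians are symmetric.\<close>
    show "GDERIV (\<lambda>u. \<sigma> * envelope \<sigma> (g i) u) u :> dual_prox \<sigma> (g i) u" for u
      using has_derivative_mult_right[OF GDERIV_envelope[OF g[of i] \<sigma>, of u, unfolded gderiv_def], of \<sigma>] \<sigma>
      by (simp add: gderiv_def)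
  qed
  have lin: "linear M" unfolding M_def by (rule linear_newton_op)
  interpret M: linear M by (rule lin)
  have sym: "M y \<bullet> z = M z \<bullet> y" for y z unfolding M_def by (rule newton_op_symmetric[OF A Vs Hs])
  have low: "\<mu> * (norm y)\<^sup>2 \<le> M y \<bullet> y" for y
    unfolding M_def \<mu>_def by (rule newton_op_lower[OF A \<sigma> Vb(1) Hb(1)])
  have up: "M y \<bullet> y \<le> L * (norm y)\<^sup>2" for y
    unfolding M_def L_def L_const_def by (rule newton_op_upper[OF A \<sigma> Vb(2) Hb(2)])
  have "inj M"
  proof (rule linear_injective_0[OF lin, THEN iffD2], intro allI impI)
    fix y assume "M y = 0"
    then show "y = 0" using low[of y] \<mu>L by (simp add: mult_le_0_iff)
  qed
  then have "surj M" using linear_injective_imp_surjective[OF lin] by blast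
  then obtain ds where ds: "M ds = - c" by (metis surjD)
  have acc: "norm (D (N + 1) - ds) \<le> \<eta> * norm ds"
    unfolding N_def
  proof (rule nesterov_inner_accuracy[OF lin sym low up \<mu>L \<eta>])
    show "M ds + c = 0" by (simp add: ds)
    show "D j = 0" if "j \<le> 0" for j
      using d that by (intro block_eqI) (simp add: D_def inner_iterates_def)
    fix j assume j: "0 \<le> j" "j \<le> N_iter \<mu> L \<eta>"
    define Dt where "Dt = D j + beta_const \<mu> L *\<^sub>R (D j - D (j - 1))"
    have dt: "d j i + beta_const \<mu> L *\<^sub>R (d j i - d (j - 1) i) = block Dt i" for i
      by (simp add: Dt_def D_def)
    have "d (j + 1) i = block Dt i - (1 / L) *\<^sub>R (V i *v block Dt i + \<sigma> *\<^sub>R (H i *v block Dt i)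
              + \<sigma> *\<^sub>R gossip A (\<lambda>k. gossip A (block Dt) k) i + block c i)" for i
      using d j unfolding inner_iterates_def Let_def sum_neighbours_eq_gossip[OF A] N_def by (simp add: dt)
    then have "D (j + 1) = Dt - (1 / L) *\<^sub>R (M Dt + c)"
      by (intro block_eqI) (simp add: D_def M_def newton_op_def)
    then show "D (j + 1) = (D j + beta_const \<mu> L *\<^sub>R (D j - D (j - 1)))
       - (1 / L) *\<^sub>R (M (D j + beta_const \<mu> L *\<^sub>R (D j - D (j - 1))) + c)"
      by (simp only: Dt_def)
  qed
  define w where "w = (x - xhat) + ds"
  have Mw: "norm (M w) \<le> \<epsilon>"
    using res[of V H] V H by (simp add: w_def M.add ds M_def[symmetric] c_def)
  have w: "norm w \<le> \<epsilon> / \<mu>"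
  proof -
    have "(\<mu> * norm w) * norm w \<le> norm (M w) * norm w"
      using order_trans[OF low norm_cauchy_schwarz, of w] by (simp add: power2_eq_square)
    then have "\<mu> * norm w \<le> norm (M w)" by (cases "w = 0") auto
    then show ?thesis using Mw \<mu>L by (simp add: field_simps)
  qed
  have "x' - xhat = w + (D (N + 1) - ds)"
    by (rule block_eqI) (simp add: x' w_def D_def)
  then have "norm (x' - xhat) \<le> norm w + norm (D (N + 1) - ds)" by (simp only: norm_triangle_ineq)
  also have "\<dots> \<le> \<epsilon> / \<mu> + \<eta> * norm ds" using w acc by (rule add_mono)
  also have "\<dots> \<le> \<epsilon> / \<mu> + \<eta> * (\<epsilon> / \<mu> + norm (x - xhat))"
  proof -
    have "ds = w - (x - xhat)" by (simp add: w_def)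
    then have "norm ds \<le> norm w + norm (x - xhat)" by (simp only: norm_triangle_ineq4)
    then show ?thesis using w \<eta> by (intro add_left_mono mult_left_mono) auto
  qed
  finally show ?thesis by (simp add: \<mu>_def)
qed

section \<open>Convergence of the method\<close>

theorem mainTheorem5:
  fixes f :: "'m::finite \<Rightarrow> real^'n::finite \<Rightarrow> real"
    and g :: "'m \<Rightarrow> real^'n \<Rightarrow> ereal"
    and mus Ls :: "'m \<Rightarrow> real"
    and E :: "('m \<times> 'm) set"
    and A :: "real^'m^'m"
    and \<sigma> :: real
    and lam :: "real^(('m + 'm) \<times> 'n)"
    and \<eta> :: "nat \<Rightarrow> real"
    and xhat :: "real^('m \<times> 'n)"
  assumes "\<And>i x. f i differentiable (at x)"
    and "\<And>i. mus i > 0"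
    and "\<And>i. strongly_convex (mus i) (f i)"
    and "\<And>i. smooth (Ls i) (f i)"
    and "\<And>i. closed_proper_convex (g i)"
    and "gossip_matrix E A"
    and "undirected_connected E"
    and "\<sigma> > 0"
    and "\<And>i. strongly_semismooth (gradient (f i))"
    and "\<And>i. strongly_semismooth (Prox (g i))"
    and "\<And>t. \<eta> t > 0"
    and "\<eta> \<longlonglongrightarrow> 0"
    and "is_arg_min (phi f g A \<sigma> lam) (\<lambda>_. True) xhat"
  shows "\<exists>\<delta>>0. \<forall>x. x 0 \<in> ball xhat \<delta> \<and> dissn_sequence f g mus Ls E A \<sigma> lam \<eta> x \<longrightarrow>
           converges_superlinearly x xhat \<and>
           ((\<exists>etat. \<forall>t. \<eta> t \<le> etat * norm (gradient (\<lambda>z. real_of_ereal (phi f g A \<sigma> lam z)) (x t)))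
              \<longrightarrow> converges_quadratically x xhat)"
proof -
  note f = assms(1) and mus = assms(2) and sc = assms(3) and sm = assms(4) and g = assms(5)
    and A = assms(6) and \<sigma> = assms(8) and \<eta> = assms(11)
  define \<Psi> where "\<Psi> = newton_residual f g A \<sigma> lam"
  define \<mu> where "\<mu> = mu_const mus"
  have \<mu>: "\<mu> > 0" unfolding \<mu>_def by (rule mu_L_const_bounds(1)[where f = f and mus = mus and Ls = Ls, OF mus sc sm \<sigma>])
  have zero: "\<Psi> xhat = 0"
    unfolding \<Psi>_def by (rule newton_residual_minimizer[OF f g \<sigma> A assms(13)])
  have "(\<lambda>z. real_of_ereal (phi f g A \<sigma> lam z)) = phi_real f g A \<sigma> lam"
    by (simp add: phi_eq_phi_real[OF g \<sigma>] fun_eq_iff)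
  then have grad: "gradient (\<lambda>z. real_of_ereal (phi f g A \<sigma> lam z)) z = \<Psi> z" for z
    unfolding \<Psi>_def by (simp only:) (rule gradient_eqI[OF GDERIV_phi_real[OF f g \<sigma> A]])
  have "\<exists>K\<ge>0. \<forall>x e. norm (\<Psi> (x + e) - \<Psi> x) \<le> K * norm e"
    unfolding \<Psi>_def
    by (rule newton_residual_lipschitz[where f = f and g = g and A = A and lam = lam, OF g \<sigma> sm]) blast
  then obtain K where K: "K \<ge> 0" "\<And>x e. norm (\<Psi> (x + e) - \<Psi> x) \<le> K * norm e" by blast
  have \<Psi>_le: "norm (\<Psi> z) \<le> K * norm (z - xhat)" for z
    using K(2)[of xhat "z - xhat"] zero by simp
  obtain C where C: "C \<ge> 0" and ev: "\<forall>\<^sub>F e in nhds 0. \<forall>V H.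
     (\<forall>i. V i \<in> clarke (gradient (f i)) (block (xhat + e) i)) \<longrightarrow>
     (\<forall>i. H i \<in> clarke (dual_prox \<sigma> (g i)) (block (dual_point A \<sigma> lam (xhat + e)) (Inl i))) \<longrightarrow>
     norm (newton_op A \<sigma> V H e - (\<Psi> (xhat + e) - \<Psi> xhat)) \<le> C * (norm e)\<^sup>2"
    using newton_residual_semismooth[where f = f and g = g and A = A and lam = lam and x = xhat, OF g \<sigma> assms(9,10)]
    unfolding \<Psi>_def[symmetric] by (elim exE conjE) (rule that)
  then obtain \<delta>0 where \<delta>0: "\<delta>0 > 0" and res: "\<And>e V H. norm e < \<delta>0 \<Longrightarrow>
     (\<forall>i. V i \<in> clarke (gradient (f i)) (block (xhat + e) i)) \<Longrightarrow>
     (\<forall>i. H i \<in> clarke (dual_prox \<sigma> (g i)) (block (dual_point A \<sigma> lam (xhat + e)) (Inl i))) \<Longrightarrow>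
     norm (newton_op A \<sigma> V H e - \<Psi> (xhat + e)) \<le> C * (norm e)\<^sup>2"
    unfolding eventually_nhds_metric zero by (auto simp: dist_norm)
  define Q where "Q = C / \<mu>"
  have Q: "Q \<ge> 0" using C \<mu> by (simp add: Q_def)
  \<comment> \<open>The factor \<open>Q \<cdot> \<delta>0 + 1\<close> bounds the length of the Newton direction relative to the error.\<close>
  define D where "D = Q * \<delta>0 + 1"
  have D: "D \<ge> 0" using Q \<delta>0 by (simp add: D_def)
  have step: "norm (x' - xhat) \<le> (Q * norm (x - xhat) + D * \<eta> t) * norm (x - xhat)"
    if small: "norm (x - xhat) < \<delta>0"
      and st: "dissn_step f g E A \<sigma> lam (mu_const mus) (L_const TYPE('n) Ls A \<sigma>) (\<eta> t) x x'" for x x' t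
  proof -
    define r where "r = norm (x - xhat)"
    have r: "0 \<le> r" "r < \<delta>0" using small by (auto simp: r_def)
    have "norm (x' - xhat) \<le> (C * r\<^sup>2) / \<mu> + \<eta> t * ((C * r\<^sup>2) / \<mu> + r)"
      unfolding \<mu>_def r_def
    proof (rule dissn_step_error[OF f mus sc sm g A \<sigma> \<eta> zero[unfolded \<Psi>_def] _ st])
      fix V H
      assume "\<forall>i. V i \<in> clarke (gradient (f i)) (block x i)"
        "\<forall>i. H i \<in> clarke (dual_prox \<sigma> (g i)) (block (dual_point A \<sigma> lam x) (Inl i))"
      then show "norm (newton_op A \<sigma> V H (x - xhat) - newton_residual f g A \<sigma> lam x) \<le> C * (norm (x - xhat))\<^sup>2"
        using res[OF small, of V H] by (simp add: \<Psi>_def)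
    qed
    also have "(C * r\<^sup>2) / \<mu> = Q * r * r" by (simp add: Q_def power2_eq_square)
    also have "Q * r * r + \<eta> t * (Q * r * r + r) \<le> Q * r * r + \<eta> t * (Q * \<delta>0 * r + r)"
      using Q r \<eta>[of t] by (intro add_left_mono mult_left_mono add_right_mono mult_right_mono) auto
    also have "\<dots> = (Q * r + D * \<eta> t) * r" by (simp add: D_def algebra_simps)
    finally show ?thesis by (simp add: r_def)
  qed
  obtain \<delta> where \<delta>: "\<delta> > 0" and conv: "\<forall>x. x 0 \<in> ball xhat \<delta> \<and>
      (\<forall>t. norm (x t - xhat) < \<delta>0 \<longrightarrow> norm (x (Suc t) - xhat) \<le> (Q * norm (x t - xhat) + D * \<eta> t) * norm (x t - xhat)) \<longrightarrow>
      converges_superlinearly x xhat \<and> (\<forall>t. norm (x t - xhat) < \<delta>0)"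
    using inexact_newton_local_convergence[OF \<delta>0 Q D \<eta> assms(12), of xhat] by (elim exE conjE) (rule that)
  have "converges_superlinearly x xhat \<and>
      ((\<exists>etat. \<forall>t. \<eta> t \<le> etat * norm (gradient (\<lambda>z. real_of_ereal (phi f g A \<sigma> lam z)) (x t)))
         \<longrightarrow> converges_quadratically x xhat)"
    if x0: "x 0 \<in> ball xhat \<delta>" and seq: "dissn_sequence f g mus Ls E A \<sigma> lam \<eta> x" for x
  proof -
    have st: "dissn_step f g E A \<sigma> lam (mu_const mus) (L_const TYPE('n) Ls A \<sigma>) (\<eta> t) (x t) (x (Suc t))" for t
      using seq by (simp add: dissn_sequence_def)
    have cs: "converges_superlinearly x xhat" and small: "\<And>t. norm (x t - xhat) < \<delta>0"
      using conv[rule_format, OF conjI, of x, OF x0] step[OF _ st] by auto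
    have "converges_quadratically x xhat"
      if q: "\<And>t. \<eta> t \<le> etat * norm (\<Psi> (x t))" for etat
    proof -
      have "norm (x (Suc t) - xhat) \<le> (Q + D * (\<bar>etat\<bar> * K)) * (norm (x t - xhat))\<^sup>2" for t
      proof -
        have "\<eta> t \<le> \<bar>etat\<bar> * (K * norm (x t - xhat))"
          by (rule order_trans[OF q]) (intro mult_mono \<Psi>_le; simp)
        then have "(Q * norm (x t - xhat) + D * \<eta> t) * norm (x t - xhat)
          \<le> (Q * norm (x t - xhat) + D * (\<bar>etat\<bar> * (K * norm (x t - xhat)))) * norm (x t - xhat)"
          using D by (intro mult_right_mono add_left_mono mult_left_mono) auto
        with step[OF small st, of t]
        show ?thesis by (simp add: power2_eq_square algebra_simps)
      qed
      then have "(\<lambda>t. norm (x (Suc t) - xhat)) \<in> O(\<lambda>t. (norm (x t - xhat))\<^sup>2)"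
        by (intro bigoI[of _ "Q + D * (\<bar>etat\<bar> * K)"]) simp
      then show ?thesis using cs by (simp add: converges_quadratically_def converges_superlinearly_def)
    qed
    then show ?thesis using cs unfolding grad by blast
  qed
  with \<delta> show ?thesis by blast
qed

end
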